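(* Let $(M=\Gamma\backslash G,J)$ be a nilmanifold endowed with a complex structure of special type. If $g$ is an invariant geometrically-Bott-Chern-formal Hermitian metric on $(M,J)$, then $g$ is also SKT.
   Context: A nilmanifold is a compact quotient $M=\Gamma\backslash G$ of a simply connected nilpotent Lie group $G$ (with Lie algebra $\mathfrak g$) by a lattice $\Gamma$. Structures are invariant if induced by left-invariant ones on $G$. If $\dim_{\mathbb R}M=2k$, an invariant almost complex structure $J$ is of special type if there is a coframe $\{\eta^1,\dots,\eta^k\}$ of invariant $(1,0)$-forms with $$d\eta^j=0\ (j=1,\dots,k-1),\qquad d\eta^k\in\mathrm{Span}_{\mathbb C}\langle\eta^i\wedge\eta^j,\ \eta^i\wedge\overline{\eta^j}\rangle_{i,j=1,\dots,k-1};$$ such $J$ is automatically integrable. A Hermitian metric with fundamental form $\omega$ is SKT if $\partial\overline\partial\omega=0$. On a compact complex manifold with Hermitian metric $g$, a $(p,q)$-form $\alpha$ is Bott-Chern harmonic if $d\alpha=0$ and $\partial\overline\partial *_g\alpha=0$ ($*_g$ the $\mathbb C$-antilinear Hodge operator); $g$ is geometrically-Bott-Chern-formal if the space of Bott-Chern harmonic forms is closed under the wedge product. *)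

theory Defs
  imports
    "HOL-Analysis.Analysis"
    "HOL-Library.Function_Algebras"
    "HOL-Algebra.Coset"
begin

section \<open>Smooth maps between open subsets of normed spaces\<close>

text \<open>For open \<open>S\<close> in a finite-dimensional space this is the usual notion of a \<open>C\<^sup>n\<close> map:
  a differentiable map all of whose directional derivatives are of class \<open>n - 1\<close>.\<close>

primrec Ck_on :: "nat \<Rightarrow> 'a::real_normed_vector set \<Rightarrow> ('a \<Rightarrow> 'b::real_normed_vector) \<Rightarrow> bool" where
  "Ck_on 0 S f \<longleftrightarrow> continuous_on S f"
| "Ck_on (Suc n) S f \<longleftrightarrow> (\<forall>x\<in>S. f differentiable (at x)) \<and>
     (\<forall>v. Ck_on n S (\<lambda>x. frechet_derivative f (at x) v))"

definition smooth_on :: "'a::real_normed_vector set \<Rightarrow> ('a \<Rightarrow> 'b::real_normed_vector) \<Rightarrow> bool" where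
  "smooth_on S f \<longleftrightarrow> (\<forall>n. Ck_on n S f)"

section \<open>Lie groups\<close>

text \<open>The topology of the underlying manifold is the one of the type \<open>'g\<close> of group elements; the
  manifold is modelled on the Euclidean space \<open>'e\<close>, so that its dimension is \<open>DIM('e)\<close>.\<close>

record ('g, 'e) lgroup = "'g monoid" +
  atlas :: "('g set \<times> ('g \<Rightarrow> 'e)) set"

definition smooth_atlas :: "('g::topological_space set \<times> ('g \<Rightarrow> 'e::euclidean_space)) set \<Rightarrow> bool" where
  "smooth_atlas A \<longleftrightarrow>
     (\<Union>(U, \<phi>)\<in>A. U) = UNIV \<and>
     (\<forall>(U, \<phi>)\<in>A. open U \<and> open (\<phi> ` U) \<and> homeomorphism U (\<phi> ` U) \<phi> (inv_into U \<phi>)) \<and>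
     (\<forall>(U, \<phi>)\<in>A. \<forall>(V, \<psi>)\<in>A. smooth_on (\<phi> ` (U \<inter> V)) (\<psi> \<circ> inv_into U \<phi>))"

definition lie_group ::
  "('g::{t2_space, second_countable_topology}, 'e::euclidean_space) lgroup \<Rightarrow> bool" where
  "lie_group G \<longleftrightarrow>
     group G \<and> carrier G = UNIV \<and> smooth_atlas (atlas G) \<and>
     continuous_on UNIV (\<lambda>(x, y). x \<otimes>\<^bsub>G\<^esub> y) \<and>
     continuous_on UNIV (\<lambda>x. inv\<^bsub>G\<^esub> x) \<and>
     (\<forall>(U, \<phi>)\<in>atlas G. \<forall>(V, \<psi>)\<in>atlas G. \<forall>(W, \<theta>)\<in>atlas G.
        smooth_on {(a, b). a \<in> \<phi> ` U \<and> b \<in> \<psi> ` V \<and> inv_into U \<phi> a \<otimes>\<^bsub>G\<^esub> inv_into V \<psi> b \<in> W}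
          (\<lambda>(a, b). \<theta> (inv_into U \<phi> a \<otimes>\<^bsub>G\<^esub> inv_into V \<psi> b))) \<and>
     (\<forall>(U, \<phi>)\<in>atlas G. \<forall>(W, \<theta>)\<in>atlas G.
        smooth_on {a \<in> \<phi> ` U. inv\<^bsub>G\<^esub> (inv_into U \<phi> a) \<in> W}
          (\<lambda>a. \<theta> (inv\<^bsub>G\<^esub> (inv_into U \<phi> a))))"

primrec lower_central_series :: "('g, 'b) monoid_scheme \<Rightarrow> nat \<Rightarrow> 'g set" where
  "lower_central_series G 0 = carrier G"
| "lower_central_series G (Suc n) =
     \<Inter>{H. subgroup H G \<and> (\<forall>x\<in>carrier G. \<forall>y\<in>lower_central_series G n.
             x \<otimes>\<^bsub>G\<^esub> y \<otimes>\<^bsub>G\<^esub> inv\<^bsub>G\<^esub> x \<otimes>\<^bsub>G\<^esub> inv\<^bsub>G\<^esub> y \<in> H)}"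

definition nilpotent_group :: "('g, 'b) monoid_scheme \<Rightarrow> bool" where
  "nilpotent_group G \<longleftrightarrow> (\<exists>n. lower_central_series G n = {\<one>\<^bsub>G\<^esub>})"

text \<open>The points of \<open>\<Gamma>\<setminus>G\<close> are the cosets \<open>\<Gamma>x\<close>, i.e. the elements of \<open>rcosets\<^bsub>G\<^esub> \<Gamma>\<close>.\<close>

definition coset_topology :: "('g::topological_space, 'b) monoid_scheme \<Rightarrow> 'g set \<Rightarrow> 'g set topology" where
  "coset_topology G \<Gamma> = topology (\<lambda>\<U>. \<U> \<subseteq> rcosets\<^bsub>G\<^esub> \<Gamma> \<and> open (\<Union>\<U>))"

definition cocompact_lattice :: "('g::topological_space, 'b) monoid_scheme \<Rightarrow> 'g set \<Rightarrow> bool" where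
  "cocompact_lattice G \<Gamma> \<longleftrightarrow> subgroup \<Gamma> G \<and> discrete \<Gamma> \<and> compact_space (coset_topology G \<Gamma>)"

definition nilmanifold ::
  "('g::{t2_space, second_countable_topology}, 'e::euclidean_space) lgroup \<Rightarrow> 'g set \<Rightarrow> bool" where
  "nilmanifold G \<Gamma> \<longleftrightarrow>
     lie_group G \<and> simply_connected (UNIV :: 'g set) \<and> nilpotent_group G \<and> cocompact_lattice G \<Gamma>"

section \<open>Functions, vector fields and the Lie algebra\<close>

definition smooth_functions ::
  "('g::topological_space, 'e::euclidean_space) lgroup \<Rightarrow> ('g \<Rightarrow> complex) set" where
  "smooth_functions G = {f. \<forall>(U, \<phi>)\<in>atlas G. smooth_on (\<phi> ` U) (f \<circ> inv_into U \<phi>)}"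

text \<open>Smooth functions on \<open>M = \<Gamma>\<setminus>G\<close>, as \<open>\<Gamma>\<close>-invariant smooth functions on \<open>G\<close>.\<close>

definition quotient_functions ::
  "('g::topological_space, 'e::euclidean_space) lgroup \<Rightarrow> 'g set \<Rightarrow> ('g \<Rightarrow> complex) set" where
  "quotient_functions G \<Gamma> = {f \<in> smooth_functions G. \<forall>\<gamma>\<in>\<Gamma>. \<forall>x. f (\<gamma> \<otimes>\<^bsub>G\<^esub> x) = f x}"

text \<open>Complex vector fields and complex-valued forms are both of type
  \<open>'a \<Rightarrow> 'b \<Rightarrow> complex\<close> and carry the pointwise complex vector space structure.\<close>

definition cscale :: "complex \<Rightarrow> ('a \<Rightarrow> 'b \<Rightarrow> complex) \<Rightarrow> 'a \<Rightarrow> 'b \<Rightarrow> complex" where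
  "cscale c h = (\<lambda>a b. c * h a b)"

global_interpretation cvec: vector_space "cscale :: complex \<Rightarrow> ('a \<Rightarrow> 'b \<Rightarrow> complex) \<Rightarrow> _"
  by unfold_locales (auto simp: cscale_def fun_eq_iff algebra_simps)

type_synonym 'g vfield = "('g \<Rightarrow> complex) \<Rightarrow> 'g \<Rightarrow> complex"

text \<open>Complex vector fields on \<open>G\<close> (sections of \<open>TG \<otimes> \<complex>\<close>), as derivations of the algebra of complex-valued
  smooth functions. The value on non-smooth functions is fixed to 0 so that equality of
  operators is equality of vector fields.\<close>

definition vector_fields ::
  "('g::topological_space, 'e::euclidean_space) lgroup \<Rightarrow> 'g vfield set" where
  "vector_fields G = {Z.
     (\<forall>f\<in>smooth_functions G. Z f \<in> smooth_functions G) \<and>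
     (\<forall>f\<in>smooth_functions G. \<forall>h\<in>smooth_functions G. Z (f + h) = Z f + Z h) \<and>
     (\<forall>c. \<forall>f\<in>smooth_functions G. Z (\<lambda>x. c * f x) = (\<lambda>x. c * Z f x)) \<and>
     (\<forall>f\<in>smooth_functions G. \<forall>h\<in>smooth_functions G. Z (f * h) = f * Z h + Z f * h) \<and>
     (\<forall>f. f \<notin> smooth_functions G \<longrightarrow> Z f = 0)}"

definition vconj :: "'g vfield \<Rightarrow> 'g vfield" where
  "vconj Z = (\<lambda>f x. cnj (Z (\<lambda>y. cnj (f y)) x))"

definition lie_algebra_C ::
  "('g::topological_space, 'e::euclidean_space) lgroup \<Rightarrow> 'g vfield set" where
  "lie_algebra_C G = {Z \<in> vector_fields G. \<forall>a\<in>carrier G. \<forall>f\<in>smooth_functions G. \<forall>x.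
     Z (\<lambda>y. f (a \<otimes>\<^bsub>G\<^esub> y)) x = Z f (a \<otimes>\<^bsub>G\<^esub> x)}"

text \<open>\<open>lie_algebra_C G\<close> is \<open>\<gg> \<otimes> \<complex>\<close>; the real left-invariant fields form the Lie algebra \<open>\<gg>\<close> itself.\<close>

definition lie_algebra ::
  "('g::topological_space, 'e::euclidean_space) lgroup \<Rightarrow> 'g vfield set" where
  "lie_algebra G = {Z \<in> lie_algebra_C G. vconj Z = Z}"

definition lie_bracket :: "'g vfield \<Rightarrow> 'g vfield \<Rightarrow> 'g vfield" where
  "lie_bracket Z W = (\<lambda>f. Z (W f) - W (Z f))"

section \<open>Differential forms on the quotient\<close>

text \<open>The left-invariant fields descend to \<open>M = \<Gamma>\<setminus>G\<close> and trivialise its tangent bundle. A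
  complex-valued (not necessarily invariant) \<open>r\<close>-form \<open>\<alpha>\<close> on \<open>M\<close> is therefore given by the smooth
  functions \<open>\<alpha>(Z\<^sub>1,\<dots>,Z\<^sub>r)\<close> on \<open>M\<close>, for \<open>Z\<^sub>i \<in> \<gg> \<otimes> \<complex>\<close>, depending on the \<open>Z\<^sub>i\<close> in a multilinear and
  alternating way. Arguments are collected in a list, and \<open>\<alpha>\<close> is 0 on lists that are not
  \<open>r\<close>-tuples of elements of \<open>\<gg> \<otimes> \<complex>\<close>, so that sums of forms of different degrees make sense.\<close>

type_synonym 'g dform = "'g vfield list \<Rightarrow> 'g \<Rightarrow> complex"

definition dforms ::
  "('g::topological_space, 'e::euclidean_space) lgroup \<Rightarrow> 'g set \<Rightarrow> nat \<Rightarrow> 'g dform set" where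
  "dforms G \<Gamma> r = {\<alpha>.
     (\<forall>Zs. \<alpha> Zs \<in> quotient_functions G \<Gamma>) \<and>
     (\<forall>Zs. \<not> (length Zs = r \<and> set Zs \<subseteq> lie_algebra_C G) \<longrightarrow> \<alpha> Zs = 0) \<and>
     (\<forall>Xs Ys. \<forall>Z\<in>lie_algebra_C G. \<forall>W\<in>lie_algebra_C G.
        set Xs \<subseteq> lie_algebra_C G \<longrightarrow> set Ys \<subseteq> lie_algebra_C G \<longrightarrow>
        \<alpha> (Xs @ (Z + W) # Ys) = \<alpha> (Xs @ Z # Ys) + \<alpha> (Xs @ W # Ys)) \<and>
     (\<forall>Xs Ys c. \<forall>Z\<in>lie_algebra_C G.
        set Xs \<subseteq> lie_algebra_C G \<longrightarrow> set Ys \<subseteq> lie_algebra_C G \<longrightarrow>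
        \<alpha> (Xs @ cscale c Z # Ys) = (\<lambda>x. c * \<alpha> (Xs @ Z # Ys) x)) \<and>
     (\<forall>Zs. \<not> distinct Zs \<longrightarrow> \<alpha> Zs = 0)}"

text \<open>A form is invariant iff it is induced by a left-invariant form on \<open>G\<close>, i.e. iff its
  components with respect to left-invariant fields are left-invariant functions.\<close>

definition invariant_form ::
  "('g, 'e) lgroup \<Rightarrow> 'g dform \<Rightarrow> bool" where
  "invariant_form G \<alpha> \<longleftrightarrow> (\<forall>Zs. \<forall>a\<in>carrier G. \<forall>x. \<alpha> Zs (a \<otimes>\<^bsub>G\<^esub> x) = \<alpha> Zs x)"

definition form_conj :: "'g dform \<Rightarrow> 'g dform" where
  "form_conj \<alpha> = (\<lambda>Zs x. cnj (\<alpha> (map vconj Zs) x))"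

text \<open>The sign of the shuffle that moves the positions in \<open>S\<close> before the remaining ones.\<close>

definition shuffle_sign :: "nat \<Rightarrow> nat set \<Rightarrow> complex" where
  "shuffle_sign n S = (-1) ^ card {(i, j). i \<in> S \<and> j \<in> {..<n} - S \<and> j < i}"

definition wedge :: "'g dform \<Rightarrow> 'g dform \<Rightarrow> 'g dform" (infixr "\<and>\<^sub>d" 75) where
  "\<alpha> \<and>\<^sub>d \<beta> = (\<lambda>Zs x. \<Sum>S\<in>Pow {..<length Zs}.
     shuffle_sign (length Zs) S * \<alpha> (nths Zs S) x * \<beta> (nths Zs (- S)) x)"

definition one_form :: "'g dform" where
  "one_form = (\<lambda>Zs x. if Zs = [] then 1 else 0)"

text \<open>The exterior derivative, by the invariant (Koszul) formula.\<close>

definition ext_d ::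
  "('g::topological_space, 'e::euclidean_space) lgroup \<Rightarrow> 'g dform \<Rightarrow> 'g dform" where
  "ext_d G \<alpha> = (\<lambda>Zs x. if set Zs \<subseteq> lie_algebra_C G then
       (\<Sum>i<length Zs. (-1) ^ i * (Zs ! i) (\<alpha> (nths Zs (- {i}))) x)
     + (\<Sum>(i, j)\<in>{(i, j). i < j \<and> j < length Zs}.
          (-1) ^ (i + j) * \<alpha> (lie_bracket (Zs ! i) (Zs ! j) # nths Zs (- {i, j})) x)
     else 0)"

section \<open>Invariant complex structures and the bigrading\<close>

text \<open>An invariant almost complex structure is an endomorphism of \<open>\<gg>\<close>; \<open>J\<close> is its complex linear
  extension to \<open>\<gg> \<otimes> \<complex>\<close>.\<close>

definition almost_complex_structure ::
  "('g::topological_space, 'e::euclidean_space) lgroup \<Rightarrow> ('g vfield \<Rightarrow> 'g vfield) \<Rightarrow> bool" where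
  "almost_complex_structure G J \<longleftrightarrow>
     (\<forall>Z\<in>lie_algebra_C G. J Z \<in> lie_algebra_C G) \<and>
     (\<forall>Z\<in>lie_algebra_C G. \<forall>W\<in>lie_algebra_C G. J (Z + W) = J Z + J W) \<and>
     (\<forall>c. \<forall>Z\<in>lie_algebra_C G. J (cscale c Z) = cscale c (J Z)) \<and>
     (\<forall>Z\<in>lie_algebra_C G. J (vconj Z) = vconj (J Z)) \<and>
     (\<forall>Z\<in>lie_algebra_C G. J (J Z) = - Z)"

definition fields_10 ::
  "('g::topological_space, 'e::euclidean_space) lgroup \<Rightarrow> ('g vfield \<Rightarrow> 'g vfield) \<Rightarrow> 'g vfield set" where
  "fields_10 G J = {Z \<in> lie_algebra_C G. J Z = cscale \<i> Z}"

definition fields_01 ::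
  "('g::topological_space, 'e::euclidean_space) lgroup \<Rightarrow> ('g vfield \<Rightarrow> 'g vfield) \<Rightarrow> 'g vfield set" where
  "fields_01 G J = {Z \<in> lie_algebra_C G. J Z = cscale (- \<i>) Z}"

definition pq_forms ::
  "('g::topological_space, 'e::euclidean_space) lgroup \<Rightarrow> 'g set \<Rightarrow> ('g vfield \<Rightarrow> 'g vfield) \<Rightarrow>
     nat \<Rightarrow> nat \<Rightarrow> 'g dform set" where
  "pq_forms G \<Gamma> J p q = {\<alpha> \<in> dforms G \<Gamma> (p + q).
     \<forall>Zs. set Zs \<subseteq> fields_10 G J \<union> fields_01 G J \<and>
        length (filter (\<lambda>Z. Z \<in> fields_10 G J) Zs) \<noteq> p \<longrightarrow> \<alpha> Zs = 0}"

definition proj_10 :: "('g vfield \<Rightarrow> 'g vfield) \<Rightarrow> 'g vfield \<Rightarrow> 'g vfield" where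
  "proj_10 J Z = cscale (1 / 2) (Z - cscale \<i> (J Z))"

definition proj_01 :: "('g vfield \<Rightarrow> 'g vfield) \<Rightarrow> 'g vfield \<Rightarrow> 'g vfield" where
  "proj_01 J Z = cscale (1 / 2) (Z + cscale \<i> (J Z))"

text \<open>The \<open>(p, q)\<close>-component of a form: expand \<open>\<alpha>(Z\<^sub>1,\<dots>,Z\<^sub>r)\<close> along the decompositions of the
  \<open>Z\<^sub>i\<close> into their \<open>(1, 0)\<close>- and \<open>(0, 1)\<close>-parts and keep the terms with exactly \<open>p\<close> arguments
  of type \<open>(1, 0)\<close>.\<close>

definition pq_component ::
  "('g::topological_space, 'e::euclidean_space) lgroup \<Rightarrow> ('g vfield \<Rightarrow> 'g vfield) \<Rightarrow>
     nat \<Rightarrow> nat \<Rightarrow> 'g dform \<Rightarrow> 'g dform" where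
  "pq_component G J p q \<alpha> = (\<lambda>Zs.
     if length Zs = p + q \<and> set Zs \<subseteq> lie_algebra_C G then
       (\<Sum>S | S \<subseteq> {..<p + q} \<and> card S = p.
          \<alpha> (map (\<lambda>i. if i \<in> S then proj_10 J (Zs ! i) else proj_01 J (Zs ! i)) [0..<p + q]))
     else 0)"

text \<open>The operators \<open>\<partial>\<close> and \<open>\<partial>\<close>-bar: on \<open>(p, q)\<close>-forms they are the components of \<open>d\<close> of type
  \<open>(p + 1, q)\<close> and \<open>(p, q + 1)\<close>, extended additively to all forms. On lists of length \<open>n\<close> only
  forms with \<open>p + q = n - 1\<close> contribute.\<close>

definition del ::
  "('g::topological_space, 'e::euclidean_space) lgroup \<Rightarrow> ('g vfield \<Rightarrow> 'g vfield) \<Rightarrow>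
     'g dform \<Rightarrow> 'g dform" where
  "del G J \<alpha> = (\<lambda>Zs. \<Sum>p<length Zs. let q = length Zs - 1 - p in
     pq_component G J (p + 1) q (ext_d G (pq_component G J p q \<alpha>)) Zs)"

definition delbar ::
  "('g::topological_space, 'e::euclidean_space) lgroup \<Rightarrow> ('g vfield \<Rightarrow> 'g vfield) \<Rightarrow>
     'g dform \<Rightarrow> 'g dform" where
  "delbar G J \<alpha> = (\<lambda>Zs. \<Sum>p<length Zs. let q = length Zs - 1 - p in
     pq_component G J p (q + 1) (ext_d G (pq_component G J p q \<alpha>)) Zs)"

text \<open>A basis of the invariant \<open>(1, 0)\<close>-forms, with the structure equations of special type.\<close>

definition special_type ::
  "('g::topological_space, 'e::euclidean_space) lgroup \<Rightarrow> 'g set \<Rightarrow> ('g vfield \<Rightarrow> 'g vfield) \<Rightarrow> bool" where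
  "special_type G \<Gamma> J \<longleftrightarrow> almost_complex_structure G J \<and>
     (\<exists>k \<eta>. DIM('e) = 2 * k \<and>
        inj_on \<eta> {1..k} \<and> cvec.independent (\<eta> ` {1..k}) \<and>
        cvec.span (\<eta> ` {1..k}) = {\<alpha> \<in> pq_forms G \<Gamma> J 1 0. invariant_form G \<alpha>} \<and>
        (\<forall>j\<in>{1..<k}. ext_d G (\<eta> j) = 0) \<and>
        ext_d G (\<eta> k) \<in> cvec.span
          ({\<eta> i \<and>\<^sub>d \<eta> j | i j. i \<in> {1..<k} \<and> j \<in> {1..<k}} \<union>
           {\<eta> i \<and>\<^sub>d form_conj (\<eta> j) | i j. i \<in> {1..<k} \<and> j \<in> {1..<k}}))"

section \<open>Hermitian metrics\<close>

text \<open>A (not necessarily invariant) metric on \<open>M\<close> is given by its components \<open>g(Z, W)\<close> on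
  left-invariant fields; \<open>g\<close> is the complex bilinear extension of the Riemannian metric.\<close>

type_synonym 'g metric_tensor = "'g vfield \<Rightarrow> 'g vfield \<Rightarrow> 'g \<Rightarrow> complex"

definition hermitian_metric ::
  "('g::topological_space, 'e::euclidean_space) lgroup \<Rightarrow> 'g set \<Rightarrow> ('g vfield \<Rightarrow> 'g vfield) \<Rightarrow>
     'g metric_tensor \<Rightarrow> bool" where
  "hermitian_metric G \<Gamma> J g \<longleftrightarrow>
     (\<forall>Z\<in>lie_algebra_C G. \<forall>W\<in>lie_algebra_C G.
        g Z W \<in> quotient_functions G \<Gamma> \<and>
        g Z W = g W Z \<and>
        g (vconj Z) (vconj W) = (\<lambda>x. cnj (g Z W x)) \<and>
        g (J Z) (J W) = g Z W \<and>
        (\<forall>c. g (cscale c Z) W = (\<lambda>x. c * g Z W x)) \<and>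
        (\<forall>V\<in>lie_algebra_C G. g (Z + V) W = g Z W + g V W)) \<and>
     (\<forall>Z\<in>lie_algebra G. Z \<noteq> 0 \<longrightarrow> (\<forall>x. Re (g Z Z x) > 0))"

definition invariant_metric ::
  "('g::topological_space, 'e::euclidean_space) lgroup \<Rightarrow> 'g metric_tensor \<Rightarrow> bool" where
  "invariant_metric G g \<longleftrightarrow>
     (\<forall>Z\<in>lie_algebra_C G. \<forall>W\<in>lie_algebra_C G. \<forall>a\<in>carrier G. \<forall>x.
        g Z W (a \<otimes>\<^bsub>G\<^esub> x) = g Z W x)"

definition fundamental_form ::
  "('g::topological_space, 'e::euclidean_space) lgroup \<Rightarrow> ('g vfield \<Rightarrow> 'g vfield) \<Rightarrow>
     'g metric_tensor \<Rightarrow> 'g dform" where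
  "fundamental_form G J g = (\<lambda>Zs. case Zs of
       [Z, W] \<Rightarrow> if Z \<in> lie_algebra_C G \<and> W \<in> lie_algebra_C G then g (J Z) W else 0
     | _ \<Rightarrow> 0)"

text \<open>The volume form \<open>\<omega>\<^sup>k / k!\<close> of the Hermitian metric, where \<open>dim M = 2k\<close>.\<close>

definition volume_form ::
  "('g::topological_space, 'e::euclidean_space) lgroup \<Rightarrow> ('g vfield \<Rightarrow> 'g vfield) \<Rightarrow>
     'g metric_tensor \<Rightarrow> 'g dform" where
  "volume_form G J g = (let k = DIM('e) div 2 in
     cscale (1 / fact k) (((\<lambda>\<beta>. fundamental_form G J g \<and>\<^sub>d \<beta>) ^^ k) one_form))"

definition orthonormal_basis_at ::
  "('g::topological_space, 'e::euclidean_space) lgroup \<Rightarrow> 'g metric_tensor \<Rightarrow> 'g \<Rightarrow> 'g vfield set \<Rightarrow> bool" where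
  "orthonormal_basis_at G g x B \<longleftrightarrow>
     finite B \<and> B \<subseteq> lie_algebra G \<and> cvec.span B = lie_algebra_C G \<and>
     (\<forall>Z\<in>B. \<forall>W\<in>B. g Z W x = (if Z = W then 1 else 0))"

text \<open>The pointwise Hermitian inner product of \<open>r\<close>-forms, normalised so that the wedge products
  of an orthonormal coframe are orthonormal. It does not depend on the chosen basis.\<close>

definition form_inner ::
  "('g::topological_space, 'e::euclidean_space) lgroup \<Rightarrow> 'g metric_tensor \<Rightarrow> nat \<Rightarrow>
     'g dform \<Rightarrow> 'g dform \<Rightarrow> 'g \<Rightarrow> complex" where
  "form_inner G g r \<alpha> \<beta> = (\<lambda>x. let B = (SOME B. orthonormal_basis_at G g x B) in
     (\<Sum>Zs | length Zs = r \<and> set Zs \<subseteq> B. \<alpha> Zs x * cnj (\<beta> Zs x)) / fact r)"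

text \<open>The antilinear Hodge operator on \<open>r\<close>-forms: \<open>\<alpha> \<and> *\<beta> = \<langle>\<alpha>, \<beta>\<rangle> vol\<close>.\<close>

definition hodge_star ::
  "('g::topological_space, 'e::euclidean_space) lgroup \<Rightarrow> 'g set \<Rightarrow> ('g vfield \<Rightarrow> 'g vfield) \<Rightarrow>
     'g metric_tensor \<Rightarrow> nat \<Rightarrow> 'g dform \<Rightarrow> 'g dform" where
  "hodge_star G \<Gamma> J g r \<beta> =
     (if r \<le> DIM('e) then
        THE \<gamma>. \<gamma> \<in> dforms G \<Gamma> (DIM('e) - r) \<and>
          (\<forall>\<alpha>\<in>dforms G \<Gamma> r. \<alpha> \<and>\<^sub>d \<gamma> =
             (\<lambda>Zs x. form_inner G g r \<alpha> \<beta> x * volume_form G J g Zs x))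
      else 0)"

definition SKT ::
  "('g::topological_space, 'e::euclidean_space) lgroup \<Rightarrow> ('g vfield \<Rightarrow> 'g vfield) \<Rightarrow>
     'g metric_tensor \<Rightarrow> bool" where
  "SKT G J g \<longleftrightarrow> del G J (delbar G J (fundamental_form G J g)) = 0"

definition bott_chern_harmonic ::
  "('g::topological_space, 'e::euclidean_space) lgroup \<Rightarrow> 'g set \<Rightarrow> ('g vfield \<Rightarrow> 'g vfield) \<Rightarrow>
     'g metric_tensor \<Rightarrow> nat \<Rightarrow> nat \<Rightarrow> 'g dform set" where
  "bott_chern_harmonic G \<Gamma> J g p q = {\<alpha> \<in> pq_forms G \<Gamma> J p q.
     ext_d G \<alpha> = 0 \<and> del G J (delbar G J (hodge_star G \<Gamma> J g (p + q) \<alpha>)) = 0}"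

text \<open>The space of all harmonic forms is the direct sum over all bidegrees of the spaces above, so
  by bilinearity it is closed under \<open>\<and>\<close> iff products of bihomogeneous harmonic forms are harmonic.\<close>

definition geometrically_BC_formal ::
  "('g::topological_space, 'e::euclidean_space) lgroup \<Rightarrow> 'g set \<Rightarrow> ('g vfield \<Rightarrow> 'g vfield) \<Rightarrow>
     'g metric_tensor \<Rightarrow> bool" where
  "geometrically_BC_formal G \<Gamma> J g \<longleftrightarrow>
     (\<forall>p q r s. \<forall>\<alpha>\<in>bott_chern_harmonic G \<Gamma> J g p q. \<forall>\<beta>\<in>bott_chern_harmonic G \<Gamma> J g r s.
        \<alpha> \<and>\<^sub>d \<beta> \<in> bott_chern_harmonic G \<Gamma> J g (p + r) (q + s))"

end

theory Submission
  imports Defs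
begin

text \<open>Write \<open>d\<eta>\<^sub>k = A + B\<close> with \<open>A\<close> of type \<open>(2, 0)\<close> and \<open>B\<close> of type \<open>(1, 1)\<close>, and let \<open>u\<close> be the
  vector dual to \<open>\<eta>\<^sub>k\<close>. All brackets lie in the center spanned by \<open>u\<close> and its conjugate, so on
  invariant forms the exterior derivative is the contraction by \<open>u\<close> wedged with \<open>A + B\<close>, plus the
  conjugate term. Hence \<open>Q = del (delbar \<omega>)\<close> is a multiple of \<open>A \<and> A' - B' \<and> B\<close> (primes denote
  conjugates), a combination of products of four forms \<open>\<eta>\<^sub>i\<close> or their conjugates with \<open>i < k\<close>. These
  1-forms are closed and, for degree reasons, Bott-Chern harmonic; by formality so is every such
  product \<open>\<sigma>\<close>. Exact invariant forms of top degree vanish, so integration by parts moves both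
  operators in \<open>\<langle>Q, \<sigma>\<rangle> vol = Q \<and> *\<sigma>\<close> from \<open>\<omega>\<close> to \<open>*\<sigma>\<close>, which they annihilate. So
  \<open>\<langle>Q, Q\<rangle> = 0\<close> and \<open>Q = 0\<close>.\<close>

section \<open>Contraction and wedge product\<close>

text \<open>The definitions are combinatorial: forms are functions on lists of fields,
  \<open>wedge\<close> is a sum over shuffles, \<open>del\<close> and \<open>delbar\<close> are sums
  over bidegrees, and the Hodge star is a description ranging over all smooth forms. Three devices
  make them computable. Contraction with the first argument turns identities for
  \<open>wedge\<close> into inductions on the argument list. Rescaling the (1, 0)-directions by t
  turns bidegrees into powers of t, so that components are found by comparing coefficients.
  Contracting the volume form gives the star explicitly and shows that it preserves invariance. The
  vanishing of exact invariant top forms is linear algebra here: the product of \<open>A\<close> or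
  \<open>B\<close> with a contraction by \<open>u\<close> is again annihilated by \<open>u\<close>,
  and a top form annihilated by a vector of the frame is zero; likewise for \<open>v\<close>. The
  same fact makes the closed 1-forms harmonic, since their stars have degree one below the top.
  Formality is applied twice, from 1-forms to 2-forms and from 2-forms to their products. The dual
  frame, and with it the dimension of the Lie algebra, is extracted from the requirement that the
  coframe is a basis of the invariant (1, 0)-forms.\<close>

definition contr :: "'g vfield \<Rightarrow> 'g dform \<Rightarrow> 'g dform" where
  "contr Z \<alpha> = (\<lambda>Zs. \<alpha> (Z # Zs))"

text \<open>The grading involution, (-1)^n in degree n. Stated on all lists, it lets the sign rules
  hold without assuming that forms are homogeneous.\<close>

definition parity :: "'g dform \<Rightarrow> 'g dform" where
  "parity \<alpha> = (\<lambda>Zs x. (-1) ^ length Zs * \<alpha> Zs x)"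

definition homogeneous :: "nat \<Rightarrow> 'g dform \<Rightarrow> bool" where
  "homogeneous n \<alpha> \<longleftrightarrow> (\<forall>Zs. length Zs \<noteq> n \<longrightarrow> \<alpha> Zs = 0)"

lemma contr_add: "contr Z (\<alpha> + \<beta>) = contr Z \<alpha> + contr Z \<beta>"
  and contr_scale: "contr Z (cscale c \<alpha>) = cscale c (contr Z \<alpha>)"
  and contr_zero: "contr Z 0 = 0"
  by (auto simp: contr_def cscale_def fun_eq_iff)

lemma parity_scale: "parity (cscale c \<alpha>) = cscale c (parity \<alpha>)"
  and parity_parity: "parity (parity \<alpha>) = \<alpha>"
  and contr_parity: "contr Z (parity \<alpha>) = cscale (-1) (parity (contr Z \<alpha>))"
  by (auto simp: parity_def cscale_def contr_def fun_eq_iff algebra_simps simp flip: power_mult_distrib)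

lemma parity_homogeneous: "homogeneous n \<alpha> \<Longrightarrow> parity \<alpha> = cscale ((-1) ^ n) \<alpha>"
  unfolding parity_def cscale_def homogeneous_def
  by (intro ext) (metis mult_zero_right zero_fun_apply)

lemma wedge_add_left: "(\<alpha> + \<beta>) \<and>\<^sub>d \<gamma> = \<alpha> \<and>\<^sub>d \<gamma> + \<beta> \<and>\<^sub>d \<gamma>"
  and wedge_add_right: "\<gamma> \<and>\<^sub>d (\<alpha> + \<beta>) = \<gamma> \<and>\<^sub>d \<alpha> + \<gamma> \<and>\<^sub>d \<beta>"
  and wedge_scale_left: "(cscale c \<alpha>) \<and>\<^sub>d \<gamma> = cscale c (\<alpha> \<and>\<^sub>d \<gamma>)"
  and wedge_scale_right: "\<gamma> \<and>\<^sub>d (cscale c \<alpha>) = cscale c (\<gamma> \<and>\<^sub>d \<alpha>)"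
  and wedge_zero_left: "0 \<and>\<^sub>d \<gamma> = 0"
  and wedge_zero_right: "\<gamma> \<and>\<^sub>d 0 = 0"
  by (auto simp: wedge_def cscale_def fun_eq_iff algebra_simps sum.distrib sum_negf sum_distrib_left
      intro!: sum.cong)

lemma wedge_minus_left: "(- \<alpha>) \<and>\<^sub>d \<gamma> = - (\<alpha> \<and>\<^sub>d \<gamma>)"
  and wedge_minus_right: "\<gamma> \<and>\<^sub>d (- \<alpha>) = - (\<gamma> \<and>\<^sub>d \<alpha>)"
  using wedge_scale_left[of "-1" \<alpha> \<gamma>] wedge_scale_right[of \<gamma> "-1" \<alpha>] by simp_all

lemma wedge_Nil: "(\<alpha> \<and>\<^sub>d \<beta>) [] x = \<alpha> [] x * \<beta> [] x"
  by (simp add: wedge_def shuffle_sign_def)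

lemma length_nths_subset: "S \<subseteq> {..<length xs} \<Longrightarrow> length (nths xs S) = card S"
  unfolding length_nths by (rule arg_cong[where f = card]) auto

lemma length_nths_Compl: "length (nths xs S) + length (nths xs (- S)) = length xs"
  by (induction xs arbitrary: S) (simp_all add: nths_Cons Collect_neg_eq)

text \<open>Shuffles are split by whether position 0, the first argument, goes to the left or to the
  right factor.\<close>

lemma Pow_lessThan_Suc_shift:
  "Pow {..<Suc n} = (\<lambda>S. insert 0 (Suc ` S)) ` Pow {..<n} \<union> (\<lambda>S. Suc ` S) ` Pow {..<n}"
proof -
  have "{..<Suc n} = insert 0 (Suc ` {..<n})"
    by (rule lessThan_Suc_eq_insert_0)
  moreover have "Pow (Suc ` {..<n}) = (\<lambda>S. Suc ` S) ` Pow {..<n}"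
    by (rule image_Pow_surj[symmetric]) simp
  ultimately show ?thesis
    by (simp add: Pow_insert image_image Un_commute)
qed

text \<open>The new position 0 precedes every other one: outside the subset it forms one inversion
  with each element of the subset, inside it forms none.\<close>

lemma shuffle_sign_Suc:
  assumes "S \<subseteq> {..<n}"
  shows "shuffle_sign (Suc n) (Suc ` S) = (-1) ^ card S * shuffle_sign n S"
    and "shuffle_sign (Suc n) (insert 0 (Suc ` S)) = shuffle_sign n S"
proof -
  let ?I = "{(i, j). i \<in> S \<and> j \<in> {..<n} - S \<and> j < i}"
  let ?f = "\<lambda>(i, j). (Suc i, Suc j)"
  have fin: "finite S" "finite ?I"
    using assms finite_subset[of ?I "{..<n} \<times> {..<n}"] by (auto intro: finite_subset)
  have inj: "inj_on ?f ?I"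
    by (auto intro: inj_onI)
  have *: "{(i, j). i \<in> Suc ` S \<and> j \<in> {..<Suc n} - Suc ` S \<and> j < i}
      = (\<lambda>i. (Suc i, 0)) ` S \<union> ?f ` ?I" (is "?L = ?R")
  proof (intro Set.set_eqI iffI)
    fix p assume "p \<in> ?L"
    then obtain i j where p: "p = (Suc i, j)" "i \<in> S" "j < Suc n" "j \<notin> Suc ` S" "j < Suc i"
      by auto
    then show "p \<in> ?R"
      by (cases j) (auto simp: image_iff)
  qed auto
  have "card ?L = card S + card ?I"
    unfolding * using fin inj
    by (subst card_Un_disjoint) (auto simp: card_image inj_on_def)
  then show "shuffle_sign (Suc n) (Suc ` S) = (-1) ^ card S * shuffle_sign n S"
    by (simp add: shuffle_sign_def power_add)
  have **: "{(i, j). i \<in> insert 0 (Suc ` S) \<and> j \<in> {..<Suc n} - insert 0 (Suc ` S) \<and> j < i}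
      = ?f ` ?I" (is "?L' = _")
  proof (intro Set.set_eqI iffI)
    fix p assume "p \<in> ?L'"
    then obtain i j where p: "p = (Suc i, j)" "i \<in> S" "j < Suc n" "j \<notin> insert 0 (Suc ` S)" "j < Suc i"
      by auto
    then show "p \<in> ?f ` ?I"
      by (cases j) (auto simp: image_iff)
  qed auto
  have "card ?L' = card ?I"
    unfolding ** using inj by (rule card_image)
  then show "shuffle_sign (Suc n) (insert 0 (Suc ` S)) = shuffle_sign n S"
    by (simp add: shuffle_sign_def)
qed

text \<open>Contraction is an antiderivation; this recursion on the argument list replaces all
  combinatorics of shuffles.\<close>

lemma contr_wedge:
  fixes \<alpha> \<beta> :: "'a dform"
  shows "contr Z (\<alpha> \<and>\<^sub>d \<beta>) = contr Z \<alpha> \<and>\<^sub>d \<beta> + parity \<alpha> \<and>\<^sub>d contr Z \<beta>"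
proof (intro ext)
  fix Zs :: "'a vfield list" and x
  let ?n = "length Zs"
  let ?t = "\<lambda>S. shuffle_sign (Suc ?n) S * \<alpha> (nths (Z # Zs) S) x * \<beta> (nths (Z # Zs) (- S)) x"
  have inj: "inj_on (\<lambda>S. insert 0 (Suc ` S)) (Pow {..<?n})" "inj_on ((`) Suc) (Pow {..<?n})"
  proof -
    show "inj_on (\<lambda>S. insert 0 (Suc ` S)) (Pow {..<?n})"
    proof (rule inj_onI)
      fix S T :: "nat set" assume eq: "insert 0 (Suc ` S) = insert 0 (Suc ` T)"
      have "S = {j. Suc j \<in> insert 0 (Suc ` S)}" by auto
      also have "\<dots> = T" unfolding eq by auto
      finally show "S = T" .
    qed
  qed (auto simp: inj_on_def inj_image_eq_iff)
  have "contr Z (\<alpha> \<and>\<^sub>d \<beta>) Zs x = sum ?t (Pow {..<Suc ?n})"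
    by (simp add: contr_def wedge_def)
  also have "\<dots> = sum ?t ((\<lambda>S. insert 0 (Suc ` S)) ` Pow {..<?n}) + sum ?t ((`) Suc ` Pow {..<?n})"
    unfolding Pow_lessThan_Suc_shift by (rule sum.union_disjoint) auto
  also have "\<dots> = (\<Sum>S\<in>Pow {..<?n}. ?t (insert 0 (Suc ` S))) + (\<Sum>S\<in>Pow {..<?n}. ?t (Suc ` S))"
    using inj by (simp add: sum.reindex)
  also have "(\<Sum>S\<in>Pow {..<?n}. ?t (insert 0 (Suc ` S))) = (contr Z \<alpha> \<and>\<^sub>d \<beta>) Zs x"
    unfolding wedge_def contr_def
  proof (rule sum.cong[OF refl])
    fix S assume "S \<in> Pow {..<?n}"
    moreover have "{j. Suc j \<in> insert 0 (Suc ` S)} = S" "{j. Suc j \<in> - insert 0 (Suc ` S)} = - S"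
      by auto
    ultimately show "?t (insert 0 (Suc ` S)) =
        shuffle_sign ?n S * \<alpha> (Z # nths Zs S) x * \<beta> (nths Zs (- S)) x"
      by (simp add: nths_Cons shuffle_sign_Suc)
  qed
  \<comment> \<open>Here the first argument passes the \<open>card S\<close> arguments of \<alpha>
    before reaching \<beta>; this sign is \<open>parity \<alpha>\<close>.\<close>
  also have "(\<Sum>S\<in>Pow {..<?n}. ?t (Suc ` S)) = (parity \<alpha> \<and>\<^sub>d contr Z \<beta>) Zs x"
    unfolding wedge_def contr_def parity_def
  proof (rule sum.cong[OF refl])
    fix S assume "S \<in> Pow {..<?n}"
    moreover have "{j. Suc j \<in> Suc ` S} = S" "{j. Suc j \<in> - Suc ` S} = - S"
      by auto
    ultimately show "?t (Suc ` S) = shuffle_sign ?n S *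
        ((-1) ^ length (nths Zs S) * \<alpha> (nths Zs S) x) * \<beta> (Z # nths Zs (- S)) x"
      by (simp add: nths_Cons shuffle_sign_Suc length_nths_subset)
  qed
  finally show "contr Z (\<alpha> \<and>\<^sub>d \<beta>) Zs x = (contr Z \<alpha> \<and>\<^sub>d \<beta> + parity \<alpha> \<and>\<^sub>d contr Z \<beta>) Zs x"
    by (simp only: plus_fun_apply)
qed

lemma parity_wedge:
  fixes \<alpha> \<beta> :: "'a dform"
  shows "parity (\<alpha> \<and>\<^sub>d \<beta>) = parity \<alpha> \<and>\<^sub>d parity \<beta>"
proof (intro ext)
  fix Zs :: "'a vfield list" and x
  have "(-1) ^ length Zs = (-1) ^ length (nths Zs S) * (-1 :: complex) ^ length (nths Zs (- S))" for S
    by (simp add: length_nths_Compl flip: power_add)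
  then show "parity (\<alpha> \<and>\<^sub>d \<beta>) Zs x = (parity \<alpha> \<and>\<^sub>d parity \<beta>) Zs x"
    unfolding parity_def wedge_def sum_distrib_left
    by (intro sum.cong) (auto simp: mult_ac)
qed

lemma wedge_Cons:
  "(\<alpha> \<and>\<^sub>d \<beta>) (Z # Zs) = (contr Z \<alpha> \<and>\<^sub>d \<beta>) Zs + (parity \<alpha> \<and>\<^sub>d contr Z \<beta>) Zs"
  using contr_wedge[of Z \<alpha> \<beta>] by (metis contr_def plus_fun_apply)

text \<open>Both sides obey the same recursion when an argument is contracted off, and they agree on
  the empty list. The forms are generalised in the induction because contraction and
  \<open>parity\<close> change them.\<close>

lemma wedge_assoc: "(\<alpha> \<and>\<^sub>d \<beta>) \<and>\<^sub>d \<gamma> = \<alpha> \<and>\<^sub>d (\<beta> \<and>\<^sub>d \<gamma>)"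
proof
  show "((\<alpha> \<and>\<^sub>d \<beta>) \<and>\<^sub>d \<gamma>) Zs = (\<alpha> \<and>\<^sub>d (\<beta> \<and>\<^sub>d \<gamma>)) Zs" for Zs
  proof (induction Zs arbitrary: \<alpha> \<beta> \<gamma>)
    case Nil
    show ?case by (rule ext) (simp add: wedge_Nil)
  next
    case (Cons Z Zs)
    show ?case
      by (simp add: wedge_Cons contr_wedge parity_wedge wedge_add_left wedge_add_right Cons
          add.assoc)
  qed
qed

lemma homogeneous_add: "homogeneous n \<alpha> \<Longrightarrow> homogeneous n \<beta> \<Longrightarrow> homogeneous n (\<alpha> + \<beta>)"
  and homogeneous_scale: "homogeneous n \<alpha> \<Longrightarrow> homogeneous n (cscale c \<alpha>)"
  and homogeneous_zero: "homogeneous n 0"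
  by (auto simp: homogeneous_def cscale_def fun_eq_iff)

lemma homogeneous_contr: "homogeneous (Suc n) \<alpha> \<Longrightarrow> homogeneous n (contr Z \<alpha>)"
  and homogeneous_contr_diff: "homogeneous n \<alpha> \<Longrightarrow> homogeneous (n - 1) (contr Z \<alpha>)"
  and contr_homogeneous_0: "homogeneous 0 \<alpha> \<Longrightarrow> contr Z \<alpha> = 0"
  by (auto simp: homogeneous_def contr_def fun_eq_iff)

lemma homogeneous_wedge:
  fixes \<alpha> \<beta> :: "'a dform"
  assumes "homogeneous m \<alpha>" "homogeneous n \<beta>"
  shows "homogeneous (m + n) (\<alpha> \<and>\<^sub>d \<beta>)"
  unfolding homogeneous_def
proof (intro allI impI ext)
  fix Zs :: "'a vfield list" and x assume *: "length Zs \<noteq> m + n"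
  have "\<alpha> (nths Zs S) x * \<beta> (nths Zs (- S)) x = 0" for S
    using assms length_nths_Compl[of Zs S] *
    by (cases "length (nths Zs S) = m") (auto simp: homogeneous_def)
  then show "(\<alpha> \<and>\<^sub>d \<beta>) Zs x = (0 :: 'a \<Rightarrow> complex) x"
    by (auto simp: wedge_def mult.assoc intro!: sum.neutral)
qed

text \<open>The usual sign (-1)^(p q) appears as p iterations of \<open>parity\<close> on \<beta>,
  so that only \<alpha> has to be homogeneous.\<close>

lemma wedge_commute:
  fixes \<alpha> \<beta> :: "'a dform"
  assumes "homogeneous p \<alpha>"
  shows "\<alpha> \<and>\<^sub>d \<beta> = (parity ^^ p) \<beta> \<and>\<^sub>d \<alpha>"
proof
  have iter_contr: "contr Z ((parity ^^ p) \<beta>) = cscale ((-1) ^ p) ((parity ^^ p) (contr Z \<beta>))"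
    for p Z and \<beta> :: "'a dform"
  proof (induction p)
    case (Suc p)
    then show ?case
      by (simp only: funpow.simps comp_apply contr_parity parity_scale) (simp add: cscale_def)
  qed (simp add: cscale_def)
  have iter_Nil: "(parity ^^ p) \<beta> [] = \<beta> []" for p and \<beta> :: "'a dform"
    by (induction p) (auto simp: parity_def)
  show "(\<alpha> \<and>\<^sub>d \<beta>) Zs = ((parity ^^ p) \<beta> \<and>\<^sub>d \<alpha>) Zs" for Zs :: "'a vfield list"
    using assms
  proof (induction Zs arbitrary: p \<alpha> \<beta>)
    case Nil
    then show ?case by (intro ext) (simp add: wedge_Nil iter_Nil)
  next
    case (Cons Z Zs)
    \<comment> \<open>Contraction lowers the degree of \<alpha> by one, so the induction hypothesis
      gives one \<open>parity\<close> fewer; as \<open>parity\<close> is an involution, this equals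
      one more.\<close>
    have 1: "(contr Z \<alpha> \<and>\<^sub>d \<beta>) Zs = (parity ((parity ^^ p) \<beta>) \<and>\<^sub>d contr Z \<alpha>) Zs"
    proof (cases p)
      case 0
      then show ?thesis
        using Cons.prems by (simp add: contr_homogeneous_0 wedge_zero_left wedge_zero_right)
    next
      case (Suc q)
      then have "homogeneous q (contr Z \<alpha>)"
        using Cons.prems homogeneous_contr by blast
      then show ?thesis
        using Cons.IH Suc by (simp add: parity_parity)
    qed
    have 2: "(parity \<alpha> \<and>\<^sub>d contr Z \<beta>) Zs = (contr Z ((parity ^^ p) \<beta>) \<and>\<^sub>d \<alpha>) Zs"
      by (simp add: parity_homogeneous[OF Cons.prems] iter_contr wedge_scale_left)
         (simp add: cscale_def Cons.IH[OF Cons.prems])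
    show ?case
      by (simp add: wedge_Cons 1 2 add.commute)
  qed
qed

lemma wedge_commute_2: "homogeneous 2 \<alpha> \<Longrightarrow> \<alpha> \<and>\<^sub>d \<beta> = \<beta> \<and>\<^sub>d \<alpha>"
  using wedge_commute[of 2 \<alpha> \<beta>] by (simp add: numeral_2_eq_2 parity_parity)

section \<open>Alternating forms\<close>

text \<open>Antisymmetry is required for adjacent transpositions, and linearity without conditions
  on the remaining arguments; in this slotwise form, with no reference to a degree, the property
  passes to contractions at once.\<close>

definition alternating :: "'g vfield set \<Rightarrow> 'g dform \<Rightarrow> bool" where
  "alternating V \<alpha> \<longleftrightarrow>
     (\<forall>Xs Z Ys. Z \<notin> V \<longrightarrow> \<alpha> (Xs @ Z # Ys) = 0) \<and>
     (\<forall>Xs Ys. \<forall>Z\<in>V. \<forall>W\<in>V. \<alpha> (Xs @ (Z + W) # Ys) = \<alpha> (Xs @ Z # Ys) + \<alpha> (Xs @ W # Ys)) \<and>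
     (\<forall>Xs Ys c. \<forall>Z\<in>V. \<alpha> (Xs @ cscale c Z # Ys) = (\<lambda>x. c * \<alpha> (Xs @ Z # Ys) x)) \<and>
     (\<forall>Xs Ys Z W. \<alpha> (Xs @ Z # W # Ys) = (\<lambda>x. - \<alpha> (Xs @ W # Z # Ys) x))"

lemma alternatingD:
  assumes "alternating V \<alpha>"
  shows "Z \<notin> V \<Longrightarrow> \<alpha> (Xs @ Z # Ys) = 0"
    and "Z \<in> V \<Longrightarrow> W \<in> V \<Longrightarrow> \<alpha> (Xs @ (Z + W) # Ys) = \<alpha> (Xs @ Z # Ys) + \<alpha> (Xs @ W # Ys)"
    and "Z \<in> V \<Longrightarrow> \<alpha> (Xs @ cscale c Z # Ys) = (\<lambda>x. c * \<alpha> (Xs @ Z # Ys) x)"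
    and "\<alpha> (Xs @ Z # W # Ys) = (\<lambda>x. - \<alpha> (Xs @ W # Z # Ys) x)"
  using assms unfolding alternating_def by (blast+)

lemma alternating_outside:
  assumes "alternating V \<alpha>" "\<not> set Zs \<subseteq> V"
  shows "\<alpha> Zs = 0"
proof -
  obtain Z where "Z \<in> set Zs" "Z \<notin> V" using assms by blast
  then show ?thesis by (metis alternatingD(1)[OF assms(1)] split_list)
qed

lemma alternating_contr_add:
  assumes "alternating V \<alpha>" "Z \<in> V" "W \<in> V"
  shows "contr (Z + W) \<alpha> = contr Z \<alpha> + contr W \<alpha>"
  using alternatingD(2)[OF assms, of "[]"] by (simp add: contr_def fun_eq_iff)

lemma alternating_contr_scale:
  assumes "alternating V \<alpha>" "Z \<in> V"
  shows "contr (cscale c Z) \<alpha> = cscale c (contr Z \<alpha>)"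
  using alternatingD(3)[OF assms, of "[]"] by (simp add: contr_def cscale_def fun_eq_iff)

lemma alternating_contr_outside: "alternating V \<alpha> \<Longrightarrow> Z \<notin> V \<Longrightarrow> contr Z \<alpha> = 0"
  using alternatingD(1)[of V \<alpha> Z "[]"] by (simp add: contr_def fun_eq_iff)

lemma alternating_contr_swap:
  assumes "alternating V \<alpha>"
  shows "contr Z (contr W \<alpha>) = cscale (- 1) (contr W (contr Z \<alpha>))"
  unfolding contr_def cscale_def
  by (intro ext) (use alternatingD(4)[OF assms, of "[]"] in \<open>metis append_Nil mult_minus1\<close>)

lemma alternating_contr_twice:
  assumes "alternating V \<alpha>"
  shows "contr Z (contr Z \<alpha>) = 0"
proof (intro ext)
  fix Zs x
  have "contr Z (contr Z \<alpha>) Zs x = - contr Z (contr Z \<alpha>) Zs x"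
    using alternating_contr_swap[OF assms, of Z Z] by (metis cscale_def mult_minus1)
  then show "contr Z (contr Z \<alpha>) Zs x = 0 Zs x" by simp
qed

lemma alternatingI:
  assumes "\<And>Xs Z Ys. Z \<notin> V \<Longrightarrow> \<alpha> (Xs @ Z # Ys) = 0"
    and "\<And>Xs Ys Z W. Z \<in> V \<Longrightarrow> W \<in> V \<Longrightarrow>
      \<alpha> (Xs @ (Z + W) # Ys) = \<alpha> (Xs @ Z # Ys) + \<alpha> (Xs @ W # Ys)"
    and "\<And>Xs Ys c Z. Z \<in> V \<Longrightarrow> \<alpha> (Xs @ cscale c Z # Ys) = (\<lambda>x. c * \<alpha> (Xs @ Z # Ys) x)"
    and "\<And>Xs Ys Z W. \<alpha> (Xs @ Z # W # Ys) = (\<lambda>x. - \<alpha> (Xs @ W # Z # Ys) x)"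
  shows "alternating V \<alpha>"
  unfolding alternating_def by (intro conjI allI ballI impI assms)

lemma alternating_contr:
  assumes "alternating V \<alpha>"
  shows "alternating V (contr X \<alpha>)"
  unfolding contr_def
  by (rule alternatingI; rule alternatingD[OF assms, where Xs = "X # _", unfolded append_Cons])

lemma alternating_add:
  assumes "alternating V \<alpha>" "alternating V \<beta>"
  shows "alternating V (\<alpha> + \<beta>)"
proof (rule alternatingI)
  fix Xs Ys Z W
  show "(\<alpha> + \<beta>) (Xs @ Z # W # Ys) = (\<lambda>x. - (\<alpha> + \<beta>) (Xs @ W # Z # Ys) x)"
    using alternatingD(4)[OF assms(1), of Xs Z W Ys] alternatingD(4)[OF assms(2), of Xs Z W Ys]
    by (simp add: fun_eq_iff)
qed (simp_all add: alternatingD(1-3)[OF assms(1)] alternatingD(1-3)[OF assms(2)] fun_eq_iff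
    algebra_simps)

lemma alternating_scale:
  assumes "alternating V \<alpha>"
  shows "alternating V (cscale c \<alpha>)"
proof (rule alternatingI)
  fix Xs Ys Z W
  show "cscale c \<alpha> (Xs @ Z # W # Ys) = (\<lambda>x. - cscale c \<alpha> (Xs @ W # Z # Ys) x)"
    using alternatingD(4)[OF assms(1), of Xs Z W Ys] by (simp add: cscale_def)
qed (unfold cscale_def[of c], simp_all add: alternatingD(1-3)[OF assms(1)] fun_eq_iff algebra_simps)

lemma alternating_zero: "alternating V 0"
  by (rule alternatingI) (simp_all add: fun_eq_iff)

lemma alternating_parity:
  assumes "alternating V \<alpha>"
  shows "alternating V (parity \<alpha>)"
proof (rule alternatingI)
  fix Xs Ys Z W
  show "parity \<alpha> (Xs @ Z # W # Ys) = (\<lambda>x. - parity \<alpha> (Xs @ W # Z # Ys) x)"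
    using alternatingD(4)[OF assms(1), of Xs Z W Ys] by (simp add: parity_def)
qed (simp_all add: alternatingD(1-3)[OF assms(1)] parity_def fun_eq_iff algebra_simps)

text \<open>Each condition is proved by induction on the arguments in front of the slot concerned:
  contracting them off distributes them over the two factors, which stay alternating, until the slot
  is the first argument.\<close>

lemma alternating_wedge:
  assumes "alternating V \<alpha>" "alternating V \<beta>"
  shows "alternating V (\<alpha> \<and>\<^sub>d \<beta>)"
proof -
  note step = alternating_contr alternating_parity
  have 1: "(\<alpha> \<and>\<^sub>d \<beta>) (Xs @ Z # Ys) = 0" if "Z \<notin> V" for Xs Z Ys
    using assms
  proof (induction Xs arbitrary: \<alpha> \<beta>)
    case Nil
    then show ?case
      using that by (simp add: wedge_Cons alternating_contr_outside wedge_zero_left wedge_zero_right)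
  next
    case (Cons X Xs)
    then show ?case by (simp add: wedge_Cons step)
  qed
  have 2: "(\<alpha> \<and>\<^sub>d \<beta>) (Xs @ (Z + W) # Ys) = (\<alpha> \<and>\<^sub>d \<beta>) (Xs @ Z # Ys) + (\<alpha> \<and>\<^sub>d \<beta>) (Xs @ W # Ys)"
    if "Z \<in> V" "W \<in> V" for Xs Z W Ys
    using assms
  proof (induction Xs arbitrary: \<alpha> \<beta>)
    case Nil
    have "contr (Z + W) \<alpha> = contr Z \<alpha> + contr W \<alpha>" "contr (Z + W) \<beta> = contr Z \<beta> + contr W \<beta>"
      using Nil that alternating_contr_add by blast+
    then have "contr (Z + W) (\<alpha> \<and>\<^sub>d \<beta>) = contr Z (\<alpha> \<and>\<^sub>d \<beta>) + contr W (\<alpha> \<and>\<^sub>d \<beta>)"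
      by (simp only: contr_wedge wedge_add_left wedge_add_right ac_simps)
    then show ?case
      by (metis append_Nil contr_def plus_fun_apply)
  next
    case (Cons X Xs)
    show ?case
      unfolding append_Cons wedge_Cons Cons.IH[OF step(1)[OF Cons.prems(1)] Cons.prems(2)]
        Cons.IH[OF step(2)[OF Cons.prems(1)] step(1)[OF Cons.prems(2)]]
      by (simp only: ac_simps)
  qed
  have 3: "(\<alpha> \<and>\<^sub>d \<beta>) (Xs @ cscale c Z # Ys) = (\<lambda>x. c * (\<alpha> \<and>\<^sub>d \<beta>) (Xs @ Z # Ys) x)"
    if "Z \<in> V" for Xs Z c Ys
    using assms
  proof (induction Xs arbitrary: \<alpha> \<beta>)
    case Nil
    then show ?case
      using that
      by (simp add: wedge_Cons alternating_contr_scale[where V = V] wedge_scale_left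
          wedge_scale_right)
        (simp add: cscale_def fun_eq_iff algebra_simps)
  next
    case (Cons X Xs)
    then show ?case by (simp add: wedge_Cons step fun_eq_iff algebra_simps)
  qed
  have 4: "(\<alpha> \<and>\<^sub>d \<beta>) (Xs @ Z # W # Ys) = (\<lambda>x. - (\<alpha> \<and>\<^sub>d \<beta>) (Xs @ W # Z # Ys) x)" for Xs Z W Ys
    using assms
  proof (induction Xs arbitrary: \<alpha> \<beta>)
    case Nil
    \<comment> \<open>Of the four terms of a double contraction, the outer two change sign by these
      equations, and the two mixed ones are exchanged with a sign coming from
      \<open>contr_parity\<close>.\<close>
    have "contr W (contr Z \<alpha>) = cscale (-1) (contr Z (contr W \<alpha>))"
      "contr W (contr Z \<beta>) = cscale (-1) (contr Z (contr W \<beta>))"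
      using Nil alternating_contr_swap by blast+
    then show ?case
      by (simp add: wedge_Cons contr_parity parity_parity wedge_minus_left wedge_minus_right)
        (simp add: fun_eq_iff)
  next
    case (Cons X Xs)
    then show ?case by (simp add: wedge_Cons step fun_eq_iff algebra_simps)
  qed
  show ?thesis
    by (rule alternatingI) (fact 1 2 3 4)+
qed

lemma alternating_move:
  assumes "alternating V \<alpha>"
  shows "\<alpha> (Xs @ Ys @ Z # Ws) = (\<lambda>x. (-1) ^ length Ys * \<alpha> (Xs @ Z # Ys @ Ws) x)"
proof (induction Ys arbitrary: Xs)
  case (Cons Y Ys)
  show ?case
    using Cons[of "Xs @ [Y]"] alternatingD(4)[OF assms, of Xs Y Z "Ys @ Ws"] by simp
qed simp

text \<open>Once moved next to each other, equal arguments make the value its own negative.\<close>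

lemma alternating_not_distinct:
  assumes "alternating V \<alpha>" "\<not> distinct Zs"
  shows "\<alpha> Zs = 0"
proof -
  obtain Xs Ys Ws Z where Zs: "Zs = Xs @ [Z] @ Ys @ [Z] @ Ws"
    using not_distinct_decomp[OF assms(2)] by blast
  have "\<alpha> (Xs @ Z # Z # Ys @ Ws) = (\<lambda>x. - \<alpha> (Xs @ Z # Z # Ys @ Ws) x)"
    by (rule alternatingD(4)[OF assms(1)])
  then have "\<alpha> (Xs @ Z # Z # Ys @ Ws) x = 0" for x
    using fun_cong[of "\<alpha> (Xs @ Z # Z # Ys @ Ws)" _ x] by fastforce
  then show ?thesis
    using alternating_move[OF assms(1), of "Xs @ [Z]" Ys Z Ws] Zs by (simp add: fun_eq_iff)
qed

lemma alternating_zero_arg: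
  assumes "alternating V \<alpha>" "0 \<in> set Zs"
  shows "\<alpha> Zs = 0"
proof -
  obtain Xs Ys where Zs: "Zs = Xs @ 0 # Ys" using split_list[OF assms(2)] by auto
  show ?thesis
  proof (cases "0 \<in> V")
    case True
    have "cscale 0 0 = (0 :: 'a vfield)" by (simp add: cscale_def fun_eq_iff)
    with alternatingD(3)[OF assms(1) True, of Xs 0 Ys] show ?thesis
      unfolding Zs by (simp add: fun_eq_iff)
  next
    case False
    then show ?thesis unfolding Zs by (rule alternatingD(1)[OF assms(1)])
  qed
qed

text \<open>Linear extension, one slot at a time: the list is split into a prefix from V and a
  suffix from E, and the last entry of the prefix is written in terms of E.\<close>

lemma alternating_eqI_span:
  assumes "alternating V \<alpha>" "cvec.span E = V"
    and zero: "\<And>Zs. set Zs \<subseteq> E \<Longrightarrow> \<alpha> Zs x = 0"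
  shows "\<alpha> Zs x = 0"
proof (cases "set Zs \<subseteq> V")
  case True
  have "\<alpha> (Xs @ Ys) x = 0" if "set Xs \<subseteq> V" "set Ys \<subseteq> E" for Xs Ys
    using that
  proof (induction Xs arbitrary: Ys rule: rev_induct)
    case Nil
    then show ?case using zero by simp
  next
    case (snoc Z Xs)
    have "Z \<in> cvec.span E" using snoc.prems assms(2) by simp
    \<comment> \<open>Membership in V is carried along because additivity is only available
      there.\<close>
    then have "Z \<in> V \<and> \<alpha> (Xs @ Z # Ys) x = 0"
    proof (induction rule: cvec.span_induct_alt)
      case base
      have "\<alpha> (Xs @ 0 # Ys) = 0" by (rule alternating_zero_arg[OF assms(1)]) simp
      then show ?case
        using assms(2) cvec.span_zero by (metis zero_fun_apply)
    next
      case (step c W Z)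
      have "W \<in> V" "Z \<in> V" "cscale c W \<in> V" "cscale c W + Z \<in> V"
        using step cvec.span_base[of W E] cvec.span_scale[of W E c] cvec.span_add assms(2) by auto
      moreover have "\<alpha> (Xs @ W # Ys) x = 0"
        using snoc step.hyps by simp
      moreover have "\<alpha> (Xs @ (cscale c W + Z) # Ys) x = c * \<alpha> (Xs @ W # Ys) x + \<alpha> (Xs @ Z # Ys) x"
        if "W \<in> V" "Z \<in> V" "cscale c W \<in> V"
        unfolding alternatingD(2)[OF assms(1) that(3,2)] alternatingD(3)[OF assms(1) that(1)]
          plus_fun_apply ..
      ultimately show ?case
        using step.IH by (metis add_0 mult_zero_right)
    qed
    then show ?case by simp
  qed
  from this[OF True, of "[]"] show ?thesis by simp
next
  case False
  then show ?thesis using alternating_outside[OF assms(1)] by simp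
qed

text \<open>A list from E longer than E repeats an entry.\<close>

lemma alternating_degree_too_large:
  assumes "alternating V \<alpha>" "cvec.span E = V" "finite E" "card E < n" "homogeneous n \<alpha>"
  shows "\<alpha> = 0"
proof (intro ext)
  fix Zs x
  have "\<alpha> Ys x = 0" if "set Ys \<subseteq> E" for Ys
  proof (cases "length Ys = n")
    case True
    have "\<not> distinct Ys"
      using card_mono[OF assms(3) that] distinct_card[of Ys] assms(4) True by auto
    then show ?thesis using alternating_not_distinct[OF assms(1)] by simp
  next
    case False
    then show ?thesis using assms(5) by (simp add: homogeneous_def)
  qed
  then show "\<alpha> Zs x = 0 Zs x"
    using alternating_eqI_span[OF assms(1,2)] by simp
qed

text \<open>A list of n distinct vectors from E exhausts E, hence contains u; moving u to the front
  gives a value of \<open>contr u \<alpha>\<close>.\<close>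

lemma alternating_top_contr_zero:
  assumes "alternating V \<alpha>" "cvec.span E = V" "finite E" "card E \<le> n" "homogeneous n \<alpha>"
    and "u \<in> E" "contr u \<alpha> = 0"
  shows "\<alpha> = 0"
proof (intro ext)
  fix Zs x
  have "\<alpha> Ys x = 0" if "set Ys \<subseteq> E" for Ys
  proof (cases "length Ys = n \<and> distinct Ys")
    case True
    then have "set Ys = E"
      using distinct_card[of Ys] assms(3,4) that card_seteq by metis
    then have "u \<in> set Ys" using assms(6) by simp
    then obtain As Bs where "Ys = As @ u # Bs" by (meson split_list)
    moreover have "\<alpha> (u # As @ Bs) = 0"
      using fun_cong[OF assms(7), of "As @ Bs"] by (simp add: contr_def)
    ultimately show ?thesis
      using alternating_move[OF assms(1), of "[]" As u Bs] by simp
  next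
    case False
    then show ?thesis
      using assms(5) alternating_not_distinct[OF assms(1)] by (auto simp: homogeneous_def)
  qed
  then show "\<alpha> Zs x = 0 Zs x"
    using alternating_eqI_span[OF assms(1,2)] by simp
qed

section \<open>Interior products of top-degree forms\<close>

lemma wedge_homogeneous_0:
  assumes "homogeneous 0 \<alpha>"
  shows "(\<alpha> \<and>\<^sub>d \<beta>) Ys x = \<alpha> [] x * \<beta> Ys x"
proof (induction Ys arbitrary: \<beta>)
  case (Cons Y Ys)
  have "parity \<alpha> = \<alpha>" using parity_homogeneous[OF assms] by (simp add: cscale_def)
  then show ?case
    by (simp add: wedge_Cons contr_homogeneous_0[OF assms] wedge_zero_left Cons)
      (simp add: contr_def)
qed (simp add: wedge_Nil)

text \<open>The iterated interior product, with the head of the list contracted first. Applied to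
  the volume form it yields the building blocks of the Hodge star.\<close>

definition contr_list :: "'g vfield list \<Rightarrow> 'g dform \<Rightarrow> 'g dform" where
  "contr_list Zs \<alpha> = (\<lambda>Ys. \<alpha> (Zs @ Ys))"

lemma contr_list_simps:
  "contr_list [] \<alpha> = \<alpha>"
  "contr_list (Zs @ [Z]) \<alpha> = contr Z (contr_list Zs \<alpha>)"
  "contr_list (Z # Zs) \<alpha> = contr_list Zs (contr Z \<alpha>)"
  by (simp_all add: contr_list_def contr_def)

lemma alternating_contr_list: "alternating V \<alpha> \<Longrightarrow> alternating V (contr_list Zs \<alpha>)"
  by (induction Zs arbitrary: \<alpha>) (simp_all add: contr_list_simps alternating_contr)

lemma homogeneous_contr_list:
  "homogeneous n \<alpha> \<Longrightarrow> homogeneous (n - length Zs) (contr_list Zs \<alpha>)"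
  unfolding homogeneous_def contr_list_def by auto

text \<open>The product of \<alpha> with \<open>contr_list Zs' \<tau>\<close>, where Zs' lacks the
  last entry of Zs, exceeds the top degree and is zero; contracting it with this entry trades a
  contraction of \<tau> for one of \<alpha>, which lowers the degree of \<alpha>.\<close>

lemma wedge_contr_list:
  assumes V: "cvec.span E = V" "finite E" "card E \<le> N"
    and \<tau>: "alternating V \<tau>" "homogeneous N \<tau>"
    and \<alpha>: "alternating V \<alpha>" "homogeneous r \<alpha>" "length Zs = r"
  shows "(\<alpha> \<and>\<^sub>d contr_list Zs \<tau>) Ys x = \<alpha> Zs x * \<tau> Ys x"
  using \<alpha>
proof (induction r arbitrary: \<alpha> Zs)
  case 0
  then show ?case by (simp add: contr_list_simps wedge_homogeneous_0)
next
  case (Suc r)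
  then obtain Z Zs' where Zs: "Zs = Zs' @ [Z]" "length Zs' = r"
    by (metis length_Suc_conv_rev)
  let ?\<tau> = "contr_list Zs' \<tau>"
  show ?case
  proof (cases "N \<le> r")
    \<comment> \<open>For N < r the truncated difference N - r would spoil the degree count; in this
      whole case \<alpha> itself exceeds the top degree.\<close>
    case True
    then have "\<alpha> = 0"
      using alternating_degree_too_large[OF Suc.prems(1) V(1,2) _ Suc.prems(2)] V(3) by linarith
    then show ?thesis by (metis wedge_zero_left mult_zero_left zero_fun_apply)
  next
    case False
    have "homogeneous (Suc r + (N - r)) (\<alpha> \<and>\<^sub>d ?\<tau>)"
      using homogeneous_wedge[OF Suc.prems(2) homogeneous_contr_list[OF \<tau>(2), of Zs']] Zs by simp
    then have "\<alpha> \<and>\<^sub>d ?\<tau> = 0"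
      using V(3) False
      by (intro alternating_degree_too_large[OF alternating_wedge[OF Suc.prems(1)
            alternating_contr_list[OF \<tau>(1)]] V(1,2)]) auto
    then have "(\<alpha> \<and>\<^sub>d ?\<tau>) (Z # Ys) x = 0" by simp
    moreover have "parity \<alpha> \<and>\<^sub>d contr Z ?\<tau> = cscale ((-1) ^ Suc r) (\<alpha> \<and>\<^sub>d contr Z ?\<tau>)"
      by (simp only: parity_homogeneous[OF Suc.prems(2)] wedge_scale_left)
    ultimately have "(contr Z \<alpha> \<and>\<^sub>d ?\<tau>) Ys x + (-1) ^ Suc r * (\<alpha> \<and>\<^sub>d contr Z ?\<tau>) Ys x = 0"
      by (simp add: wedge_Cons cscale_def)
    then have "(\<alpha> \<and>\<^sub>d contr Z ?\<tau>) Ys x = (-1) ^ r * (contr Z \<alpha> \<and>\<^sub>d ?\<tau>) Ys x"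
      by (cases "even r") (auto simp: add_eq_0_iff)
    also have "\<dots> = (-1) ^ r * contr Z \<alpha> Zs' x * \<tau> Ys x"
      using Suc.IH[of "contr Z \<alpha>" Zs'] Suc.prems Zs
      by (simp add: alternating_contr homogeneous_contr)
    also have "\<dots> = \<alpha> Zs x * \<tau> Ys x"
      using alternating_move[OF Suc.prems(1), of "[]" Zs' Z "[]"] Zs by (simp add: contr_def)
    finally show ?thesis by (simp add: Zs contr_list_simps)
  qed
qed

text \<open>An even F passes through \<open>parity \<alpha>\<close> without a sign, so multiplying
  the antiderivation \<open>contr u\<close> by F gives an antiderivation again.\<close>

lemma wedge_contr_Leibniz:
  assumes "homogeneous 2 F"
  shows "F \<and>\<^sub>d contr u (\<alpha> \<and>\<^sub>d \<beta>) = (F \<and>\<^sub>d contr u \<alpha>) \<and>\<^sub>d \<beta> + parity \<alpha> \<and>\<^sub>d (F \<and>\<^sub>d contr u \<beta>)"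
  using wedge_commute_2[OF assms, of "parity \<alpha>"]
  by (simp add: contr_wedge wedge_add_right wedge_assoc) (metis wedge_assoc)

text \<open>Contraction with u annihilates both factors, F by assumption and the other one because u
  is contracted twice. The product has degree N, so \<open>alternating_top_contr_zero\<close>
  applies. This is the algebraic substitute for the theorem of Stokes.\<close>

lemma wedge_contr_Stokes:
  assumes V: "cvec.span E = V" "finite E" "card E \<le> N" "2 \<le> N"
    and F: "alternating V F" "homogeneous 2 F" "contr u F = 0" "u \<in> E"
    and \<tau>: "alternating V \<tau>" "homogeneous (N - 1) \<tau>"
  shows "F \<and>\<^sub>d contr u \<tau> = 0"
proof (rule alternating_top_contr_zero[OF _ V(1-3) _ F(4)])
  show "alternating V (F \<and>\<^sub>d contr u \<tau>)"
    using F \<tau> by (intro alternating_wedge alternating_contr)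
  have "2 + (N - 1 - 1) = N" using V(4) by simp
  then show "homogeneous N (F \<and>\<^sub>d contr u \<tau>)"
    using homogeneous_wedge[OF F(2) homogeneous_contr_diff[OF \<tau>(2)], of u] by simp
  show "contr u (F \<and>\<^sub>d contr u \<tau>) = 0"
    by (simp add: contr_wedge F(3) wedge_zero_left wedge_zero_right
        alternating_contr_twice[OF \<tau>(1)])
qed

section \<open>Invariant forms on a Lie group\<close>

lemma frechet_derivative_cong_open:
  assumes "open S" "x \<in> S" "\<And>y. y \<in> S \<Longrightarrow> f y = h y"
  shows "f differentiable (at x) \<longleftrightarrow> h differentiable (at x)"
    and "frechet_derivative f (at x) = frechet_derivative h (at x)"
proof -
  have *: "(f has_derivative D) (at x) \<longleftrightarrow> (h has_derivative D) (at x)" for D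
    using assms has_derivative_transform_within_open[of f D x UNIV S h]
      has_derivative_transform_within_open[of h D x UNIV S f] by auto
  show "f differentiable (at x) \<longleftrightarrow> h differentiable (at x)"
    unfolding differentiable_def by (simp add: *)
  show "frechet_derivative f (at x) = frechet_derivative h (at x)"
    unfolding frechet_derivative_def by (simp add: *)
qed

text \<open>Differentiation rules hold only at points of S, while \<open>frechet_derivative\<close>
  is a total function. Since S is open, agreement on S suffices, and the rules may be substituted
  under \<open>Ck_on\<close>.\<close>

lemma Ck_on_cong:
  assumes "open S" "\<And>y. y \<in> S \<Longrightarrow> f y = h y"
  shows "Ck_on n S f \<longleftrightarrow> Ck_on n S h"
  using assms(2)
proof (induction n arbitrary: f h)
  case 0
  then show ?case by (simp cong: continuous_on_cong)
next
  case (Suc n)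
  have "Ck_on n S (\<lambda>x. frechet_derivative f (at x) v) \<longleftrightarrow>
      Ck_on n S (\<lambda>x. frechet_derivative h (at x) v)" for v
    using frechet_derivative_cong_open(2)[OF assms(1) _ Suc.prems] by (intro Suc.IH) simp
  then show ?case
    using frechet_derivative_cong_open(1)[OF assms(1) _ Suc.prems] by simp
qed

lemma Ck_on_SucD: "Ck_on (Suc n) S f \<Longrightarrow> Ck_on n S f"
proof (induction n arbitrary: f)
  case 0
  then show ?case
    by (metis Ck_on.simps differentiable_at_withinI differentiable_imp_continuous_on
        differentiable_on_def)
next
  case (Suc n)
  then show ?case by (metis Ck_on.simps(2))
qed

lemma Ck_on_add:
  assumes "open S"
  shows "Ck_on n S f \<Longrightarrow> Ck_on n S h \<Longrightarrow> Ck_on n S (\<lambda>x. f x + h x)"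
proof (induction n arbitrary: f h)
  case (Suc n)
  have "Ck_on n S (\<lambda>x. frechet_derivative (\<lambda>x. f x + h x) (at x) v)" for v
  proof -
    have main: "Ck_on n S (\<lambda>x. frechet_derivative f (at x) v + frechet_derivative h (at x) v)"
      using Suc by simp
    have eq: "frechet_derivative (\<lambda>x. f x + h x) (at x) v =
        frechet_derivative f (at x) v + frechet_derivative h (at x) v" if "x \<in> S" for x
      using Suc.prems that
      by (subst frechet_derivative_at[symmetric, OF has_derivative_add])
        (auto simp: frechet_derivative_works[symmetric])
    show ?thesis by (rule iffD2[OF Ck_on_cong[OF assms eq] main])
  qed
  then show ?case using Suc.prems by (auto intro: differentiable_add)
qed (auto intro: continuous_on_add)

lemma Ck_on_mult:
  fixes f h :: "'a::real_normed_vector \<Rightarrow> 'b::real_normed_algebra"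
  assumes "open S"
  shows "Ck_on n S f \<Longrightarrow> Ck_on n S h \<Longrightarrow> Ck_on n S (\<lambda>x. f x * h x)"
proof (induction n arbitrary: f h)
  case (Suc n)
  have "Ck_on n S (\<lambda>x. frechet_derivative (\<lambda>x. f x * h x) (at x) v)" for v
  proof -
    \<comment> \<open>The product rule also contains f and h themselves, so both must be lowered
      from class n + 1 to class n.\<close>
    have main: "Ck_on n S (\<lambda>x. f x * frechet_derivative h (at x) v + frechet_derivative f (at x) v * h x)"
      using Suc.prems Ck_on_SucD[OF Suc.prems(1)] Ck_on_SucD[OF Suc.prems(2)]
      by (intro Ck_on_add[OF assms] Suc.IH) auto
    have eq: "frechet_derivative (\<lambda>x. f x * h x) (at x) v =
        f x * frechet_derivative h (at x) v + frechet_derivative f (at x) v * h x" if "x \<in> S" for x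
      using Suc.prems that
      by (subst frechet_derivative_at[symmetric, OF has_derivative_mult])
        (auto simp: frechet_derivative_works[symmetric])
    show ?thesis by (rule iffD2[OF Ck_on_cong[OF assms eq] main])
  qed
  then show ?case using Suc.prems by (auto intro: differentiable_mult)
qed (auto intro: continuous_on_mult)

lemma Ck_on_bounded_linear:
  assumes "open S" "bounded_linear L"
  shows "Ck_on n S f \<Longrightarrow> Ck_on n S (\<lambda>x. L (f x))"
proof (induction n arbitrary: f)
  case 0
  then show ?case
    using assms(2) by (auto intro: bounded_linear.continuous_on)
next
  case (Suc n)
  have *: "((\<lambda>x. L (f x)) has_derivative (\<lambda>v. L (frechet_derivative f (at x) v))) (at x)"
    if "x \<in> S" for x
    using Suc.prems that
    by (intro bounded_linear.has_derivative[OF assms(2)]) (auto simp: frechet_derivative_works[symmetric])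
  have "Ck_on n S (\<lambda>x. frechet_derivative (\<lambda>x. L (f x)) (at x) v)" for v
  proof -
    have main: "Ck_on n S (\<lambda>x. L (frechet_derivative f (at x) v))"
      using Suc by simp
    have eq: "frechet_derivative (\<lambda>x. L (f x)) (at x) v = L (frechet_derivative f (at x) v)"
      if "x \<in> S" for x
      using frechet_derivative_at[OF *[OF that]] by metis
    show ?thesis by (rule iffD2[OF Ck_on_cong[OF assms(1) eq] main])
  qed
  then show ?case using * by (auto simp: differentiable_def)
qed

lemma Ck_on_const: "Ck_on n S (\<lambda>_. c)"
  by (induction n arbitrary: c) auto

section \<open>Left-invariant fields and invariant forms\<close>

locale lie_group_forms =
  fixes G :: "('g::{t2_space, second_countable_topology}, 'e::euclidean_space) lgroup"
    and \<Gamma> :: "'g set"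
  assumes lie_group: "lie_group G"
begin

abbreviation "V \<equiv> lie_algebra_C G"

lemma chart_open: "(U, \<phi>) \<in> atlas G \<Longrightarrow> open (\<phi> ` U)"
  using lie_group by (auto simp: lie_group_def smooth_atlas_def)

lemma smooth_functions_const: "(\<lambda>_. c) \<in> smooth_functions G"
  by (auto simp: smooth_functions_def smooth_on_def o_def Ck_on_const)

lemma smooth_functions_zero: "0 \<in> smooth_functions G"
  using smooth_functions_const[of 0] by (simp add: zero_fun_def)

lemma smooth_functionsI:
  "(\<And>U \<phi> n. (U, \<phi>) \<in> atlas G \<Longrightarrow> Ck_on n (\<phi> ` U) (\<lambda>x. f (inv_into U \<phi> x))) \<Longrightarrow>
    f \<in> smooth_functions G"
  unfolding smooth_functions_def smooth_on_def o_def by auto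

lemma smooth_functionsD:
  "f \<in> smooth_functions G \<Longrightarrow> (U, \<phi>) \<in> atlas G \<Longrightarrow> Ck_on n (\<phi> ` U) (\<lambda>x. f (inv_into U \<phi> x))"
  unfolding smooth_functions_def smooth_on_def o_def by (auto dest!: bspec)

lemma smooth_functions_add:
  assumes "f \<in> smooth_functions G" "h \<in> smooth_functions G"
  shows "f + h \<in> smooth_functions G"
  unfolding plus_fun_def
  by (rule smooth_functionsI, rule Ck_on_add) (use assms chart_open smooth_functionsD in blast)+

lemma smooth_functions_mult:
  assumes "f \<in> smooth_functions G" "h \<in> smooth_functions G"
  shows "f * h \<in> smooth_functions G"
  unfolding times_fun_def
  by (rule smooth_functionsI, rule Ck_on_mult) (use assms chart_open smooth_functionsD in blast)+

lemma smooth_functions_scale: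
  assumes "f \<in> smooth_functions G"
  shows "(\<lambda>x. c * f x) \<in> smooth_functions G"
  using smooth_functions_mult[OF smooth_functions_const[of c] assms] by (simp add: times_fun_def)

lemma smooth_functions_cnj:
  assumes "f \<in> smooth_functions G"
  shows "(\<lambda>x. cnj (f x)) \<in> smooth_functions G"
  by (rule smooth_functionsI, rule Ck_on_bounded_linear[OF _ bounded_linear_cnj])
    (use assms chart_open smooth_functionsD in blast)+

lemma smooth_functions_diff:
  assumes "f \<in> smooth_functions G" "h \<in> smooth_functions G"
  shows "f - h \<in> smooth_functions G"
proof -
  have "f - h = f + (\<lambda>x. (-1) * h x)" by (simp add: fun_eq_iff)
  then show ?thesis using smooth_functions_add smooth_functions_scale assms by metis
qed

text \<open>The equivalence serves the default value: a field is 0 on functions that are not smooth,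
  and \<open>vconj\<close> evaluates it at the conjugate function.\<close>

lemma smooth_functions_cnj_iff:
  "(\<lambda>x. cnj (f x)) \<in> smooth_functions G \<longleftrightarrow> f \<in> smooth_functions G"
proof
  assume "(\<lambda>x. cnj (f x)) \<in> smooth_functions G"
  from smooth_functions_cnj[OF this] show "f \<in> smooth_functions G"
    by (simp only: complex_cnj_cnj)
qed (rule smooth_functions_cnj)

lemma vector_fieldsD:
  assumes "Z \<in> vector_fields G"
  shows "f \<in> smooth_functions G \<Longrightarrow> Z f \<in> smooth_functions G"
    and "f \<in> smooth_functions G \<Longrightarrow> h \<in> smooth_functions G \<Longrightarrow> Z (f + h) = Z f + Z h"
    and "f \<in> smooth_functions G \<Longrightarrow> Z (\<lambda>x. c * f x) = (\<lambda>x. c * Z f x)"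
    and "f \<in> smooth_functions G \<Longrightarrow> h \<in> smooth_functions G \<Longrightarrow> Z (f * h) = f * Z h + Z f * h"
    and "f \<notin> smooth_functions G \<Longrightarrow> Z f = 0"
  using assms unfolding vector_fields_def by blast+

lemma vector_fields_zero_fun: "Z \<in> vector_fields G \<Longrightarrow> Z 0 = 0"
  using vector_fieldsD(3)[of Z 0 0] smooth_functions_zero by (simp add: zero_fun_def fun_eq_iff)

text \<open>The Leibniz rule for the product 1 * 1 gives Z 1 = 2 * Z 1.\<close>

lemma vector_fields_const:
  assumes "Z \<in> vector_fields G"
  shows "Z (\<lambda>_. c) = 0"
proof -
  have "Z ((\<lambda>_. 1) * (\<lambda>_. 1)) = (\<lambda>_. 1) * Z (\<lambda>_. 1) + Z (\<lambda>_. 1) * (\<lambda>_. 1)"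
    by (rule vector_fieldsD(4)[OF assms smooth_functions_const smooth_functions_const])
  then have "Z (\<lambda>_. 1) = 0"
    by (simp add: times_fun_def fun_eq_iff)
  then show ?thesis
    using vector_fieldsD(3)[OF assms smooth_functions_const[of 1], of c] by (simp add: fun_eq_iff)
qed

lemma left_invariant:
  assumes "Z \<in> V" "f \<in> smooth_functions G"
  shows "Z (\<lambda>y. f (a \<otimes>\<^bsub>G\<^esub> y)) x = Z f (a \<otimes>\<^bsub>G\<^esub> x)"
  using assms lie_group by (simp add: lie_algebra_C_def lie_group_def)

lemma lie_algebra_CI:
  assumes "Z \<in> vector_fields G"
    and "\<And>a f x. f \<in> smooth_functions G \<Longrightarrow> Z (\<lambda>y. f (a \<otimes>\<^bsub>G\<^esub> y)) x = Z f (a \<otimes>\<^bsub>G\<^esub> x)"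
  shows "Z \<in> V"
  using assms by (simp add: lie_algebra_C_def)

lemma lie_algebra_C_vector_fields: "Z \<in> V \<Longrightarrow> Z \<in> vector_fields G"
  by (simp add: lie_algebra_C_def)

lemma lie_algebra_C_subspace: "cvec.subspace V"
proof (rule cvec.subspaceI)
  show "0 \<in> V"
    by (rule lie_algebra_CI) (auto simp: vector_fields_def smooth_functions_zero fun_eq_iff)
next
  fix Z W assume *: "Z \<in> V" "W \<in> V"
  note vf = lie_algebra_C_vector_fields[OF *(1)] lie_algebra_C_vector_fields[OF *(2)]
  show "Z + W \<in> V"
  proof (rule lie_algebra_CI)
    show "Z + W \<in> vector_fields G"
      using vf[THEN vector_fieldsD(1)] vf[THEN vector_fieldsD(2)] vf[THEN vector_fieldsD(3)]
        vf[THEN vector_fieldsD(4)] vf[THEN vector_fieldsD(5)]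
      by (simp add: vector_fields_def smooth_functions_add algebra_simps fun_eq_iff)
  qed (use * in \<open>simp add: left_invariant\<close>)
next
  fix c Z assume *: "Z \<in> V"
  note vf = lie_algebra_C_vector_fields[OF *]
  show "cscale c Z \<in> V"
  proof (rule lie_algebra_CI)
    show "cscale c Z \<in> vector_fields G"
      using vf[THEN vector_fieldsD(1)] vf[THEN vector_fieldsD(2)] vf[THEN vector_fieldsD(3)]
        vf[THEN vector_fieldsD(4)] vf[THEN vector_fieldsD(5)]
      by (simp add: vector_fields_def cscale_def smooth_functions_scale algebra_simps fun_eq_iff)
  qed (use * in \<open>simp add: left_invariant cscale_def\<close>)
qed

lemma vconj_closed:
  assumes "Z \<in> V"
  shows "vconj Z \<in> V"
proof (rule lie_algebra_CI)
  note vf = lie_algebra_C_vector_fields[OF assms]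
  show "vconj Z \<in> vector_fields G"
    unfolding vector_fields_def
  proof (intro CollectI conjI ballI allI impI)
    fix f assume f: "f \<in> smooth_functions G"
    then show "vconj Z f \<in> smooth_functions G"
      using vf[THEN vector_fieldsD(1)] by (simp add: vconj_def smooth_functions_cnj_iff)
    fix c
    have "Z (\<lambda>x. cnj c * cnj (f x)) = (\<lambda>x. cnj c * Z (\<lambda>x. cnj (f x)) x)"
      using f by (intro vf[THEN vector_fieldsD(3)]) (simp add: smooth_functions_cnj_iff)
    then show "vconj Z (\<lambda>x. c * f x) = (\<lambda>x. c * vconj Z f x)"
      by (simp add: vconj_def fun_eq_iff)
    fix h assume h: "h \<in> smooth_functions G"
    have "Z ((\<lambda>x. cnj (f x)) + (\<lambda>x. cnj (h x))) = Z (\<lambda>x. cnj (f x)) + Z (\<lambda>x. cnj (h x))"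
      using f h by (intro vf[THEN vector_fieldsD(2)]) (simp_all add: smooth_functions_cnj_iff)
    then show "vconj Z (f + h) = vconj Z f + vconj Z h"
      by (simp add: vconj_def fun_eq_iff plus_fun_def)
    have "Z ((\<lambda>x. cnj (f x)) * (\<lambda>x. cnj (h x))) =
        (\<lambda>x. cnj (f x)) * Z (\<lambda>x. cnj (h x)) + Z (\<lambda>x. cnj (f x)) * (\<lambda>x. cnj (h x))"
      using f h by (intro vf[THEN vector_fieldsD(4)]) (simp_all add: smooth_functions_cnj_iff)
    then show "vconj Z (f * h) = f * vconj Z h + vconj Z f * h"
      by (simp add: vconj_def fun_eq_iff plus_fun_def times_fun_def)
  next
    fix f assume "f \<notin> smooth_functions G"
    then show "vconj Z f = 0"
      using vf[THEN vector_fieldsD(5)] by (simp add: vconj_def smooth_functions_cnj_iff fun_eq_iff)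
  qed
next
  fix a f x assume "f \<in> smooth_functions G"
  then show "vconj Z (\<lambda>y. f (a \<otimes>\<^bsub>G\<^esub> y)) x = vconj Z f (a \<otimes>\<^bsub>G\<^esub> x)"
    using left_invariant[OF assms, of "\<lambda>x. cnj (f x)" a x]
    by (simp add: vconj_def smooth_functions_cnj_iff)
qed

lemma lie_bracket_closed:
  assumes "Z \<in> V" "W \<in> V"
  shows "lie_bracket Z W \<in> V"
proof (rule lie_algebra_CI)
  note Z = vector_fieldsD[OF lie_algebra_C_vector_fields[OF assms(1)]]
  note W = vector_fieldsD[OF lie_algebra_C_vector_fields[OF assms(2)]]
  \<comment> \<open>On a function that is not smooth, the bracket consists of the values of Z and W
    at the zero function.\<close>
  note zero = vector_fields_zero_fun[OF lie_algebra_C_vector_fields[OF assms(1)]]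
    vector_fields_zero_fun[OF lie_algebra_C_vector_fields[OF assms(2)]]
  show "lie_bracket Z W \<in> vector_fields G"
    unfolding vector_fields_def lie_bracket_def
    by (simp add: Z W zero smooth_functions_diff smooth_functions_mult smooth_functions_scale
        fun_eq_iff algebra_simps)
next
  fix a f x assume f: "f \<in> smooth_functions G"
  note Z = vector_fieldsD(1)[OF lie_algebra_C_vector_fields[OF assms(1)] f]
  note W = vector_fieldsD(1)[OF lie_algebra_C_vector_fields[OF assms(2)] f]
  have "Z (\<lambda>y. f (a \<otimes>\<^bsub>G\<^esub> y)) = (\<lambda>y. Z f (a \<otimes>\<^bsub>G\<^esub> y))" "W (\<lambda>y. f (a \<otimes>\<^bsub>G\<^esub> y)) = (\<lambda>y. W f (a \<otimes>\<^bsub>G\<^esub> y))"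
    using left_invariant f assms by blast+
  then show "lie_bracket Z W (\<lambda>y. f (a \<otimes>\<^bsub>G\<^esub> y)) x = lie_bracket Z W f (a \<otimes>\<^bsub>G\<^esub> x)"
    using left_invariant[OF assms(1) W, of a x]
      left_invariant[OF assms(2) Z, of a x] by (simp add: lie_bracket_def)
qed

lemma vconj_lie_bracket: "vconj (lie_bracket Z W) = lie_bracket (vconj Z) (vconj W)"
  by (simp add: vconj_def lie_bracket_def fun_eq_iff)

text \<open>Left translations act transitively, so this is left invariance with the group
  eliminated, as \<open>invariant_iff_constant\<close> confirms.\<close>

definition constant_form :: "'g dform \<Rightarrow> bool" where
  "constant_form \<alpha> \<longleftrightarrow> (\<forall>Zs x y. \<alpha> Zs x = \<alpha> Zs y)"

lemma translation_transitive: "\<exists>a. y = a \<otimes>\<^bsub>G\<^esub> x"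
proof -
  have G: "group G" "carrier G = UNIV" using lie_group by (auto simp: lie_group_def)
  then have "y = (y \<otimes>\<^bsub>G\<^esub> inv\<^bsub>G\<^esub> x) \<otimes>\<^bsub>G\<^esub> x"
    by (simp add: monoid.m_assoc group.is_monoid group.l_inv monoid.r_one)
  then show ?thesis ..
qed

lemma invariant_iff_constant: "invariant_form G \<alpha> \<longleftrightarrow> constant_form \<alpha>"
proof -
  have "carrier G = UNIV" using lie_group by (auto simp: lie_group_def)
  then show ?thesis
    unfolding invariant_form_def constant_form_def using translation_transitive by (metis UNIV_I)
qed

text \<open>Antisymmetry comes from polarisation: expand the zero value at two adjacent copies of Z
  + W. If an argument lies outside \<open>V\<close>, both sides vanish.\<close>

lemma dformsD:
  assumes "\<alpha> \<in> dforms G \<Gamma> r"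
  shows "alternating V \<alpha>" "homogeneous r \<alpha>"
proof -
  note d = assms[unfolded dforms_def, simplified]
  show "homogeneous r \<alpha>" using d by (auto simp: homogeneous_def)
  have out: "\<alpha> Zs = 0" if "\<not> set Zs \<subseteq> V" for Zs using d that by blast
  have clos: "Z + W \<in> V" "cscale c Z \<in> V" if "Z \<in> V" "W \<in> V" for Z W c
    using that lie_algebra_C_subspace cvec.subspace_add cvec.subspace_scale by blast+
  have nd: "\<alpha> Zs = 0" if "\<not> distinct Zs" for Zs using d that by blast
  have add: "\<alpha> (Xs @ (Z + W) # Ys) = \<alpha> (Xs @ Z # Ys) + \<alpha> (Xs @ W # Ys)"
    if "Z \<in> V" "W \<in> V" for Xs Ys Z W
  proof (cases "set Xs \<subseteq> V \<and> set Ys \<subseteq> V")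
    case True
    then show ?thesis using d that by blast
  qed (use out in auto)
  have scale: "\<alpha> (Xs @ cscale c Z # Ys) = (\<lambda>x. c * \<alpha> (Xs @ Z # Ys) x)"
    if "Z \<in> V" for Xs Ys Z c
  proof (cases "set Xs \<subseteq> V \<and> set Ys \<subseteq> V")
    case True
    then show ?thesis using d that by blast
  next
    case False
    then have "\<not> set (Xs @ cscale c Z # Ys) \<subseteq> V" "\<not> set (Xs @ Z # Ys) \<subseteq> V" by auto
    then show ?thesis using out by (simp add: fun_eq_iff)
  qed
  have swap: "\<alpha> (Xs @ Z # W # Ys) = (\<lambda>x. - \<alpha> (Xs @ W # Z # Ys) x)" for Xs Ys Z W
  proof (cases "Z \<in> V \<and> W \<in> V")
    case True
    then have ZW: "Z \<in> V" "W \<in> V" "Z + W \<in> V" using clos by auto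
    have "\<alpha> (Xs @ (Z + W) # (Z + W) # Ys) = 0"
      "\<alpha> (Xs @ Z # Z # Ys) = 0" "\<alpha> (Xs @ W # W # Ys) = 0"
      by (rule nd; simp)+
    moreover have "\<alpha> (Xs @ (Z + W) # (Z + W) # Ys) =
        \<alpha> (Xs @ Z # Z # Ys) + \<alpha> (Xs @ Z # W # Ys) + (\<alpha> (Xs @ W # Z # Ys) + \<alpha> (Xs @ W # W # Ys))"
      using add[of Z W Xs "(Z + W) # Ys"] add[of Z W "Xs @ [Z]" Ys] add[of Z W "Xs @ [W]" Ys] ZW
      by simp
    ultimately have "\<alpha> (Xs @ Z # W # Ys) + \<alpha> (Xs @ W # Z # Ys) = 0" by simp
    then show ?thesis by (simp add: fun_eq_iff add_eq_0_iff2)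
  next
    case False
    then have "\<not> set (Xs @ Z # W # Ys) \<subseteq> V" "\<not> set (Xs @ W # Z # Ys) \<subseteq> V" by auto
    then show ?thesis using out by (simp add: fun_eq_iff)
  qed
  show "alternating V \<alpha>"
    unfolding alternating_def
  proof (intro conjI allI ballI impI add scale swap)
    fix Xs Ys Z assume "Z \<notin> V"
    then show "\<alpha> (Xs @ Z # Ys) = 0" by (intro out) auto
  qed
qed

text \<open>Constant components are smooth and invariant under \<Gamma>, hence functions on the
  quotient.\<close>

lemma dformsI:
  assumes "alternating V \<alpha>" "homogeneous r \<alpha>" "constant_form \<alpha>"
  shows "\<alpha> \<in> dforms G \<Gamma> r"
proof -
  have "\<alpha> Zs \<in> quotient_functions G \<Gamma>" for Zs
  proof -
    obtain c where "\<alpha> Zs = (\<lambda>_. c)"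
      using assms(3) unfolding constant_form_def by (metis ext)
    then show ?thesis by (simp add: quotient_functions_def smooth_functions_const)
  qed
  moreover have "\<alpha> Zs = 0" if "\<not> (length Zs = r \<and> set Zs \<subseteq> V)" for Zs
    using that assms(2) alternating_outside[OF assms(1)] by (auto simp: homogeneous_def)
  ultimately show ?thesis
    unfolding dforms_def
    by (auto simp: alternatingD(2,3)[OF assms(1)] alternating_not_distinct[OF assms(1)])
qed

text \<open>The exterior algebra of the dual of \<open>V\<close> in degree n, described without
  \<Gamma>; \<open>invariant_dforms_iff\<close> identifies it with the invariant forms on the
  quotient.\<close>

definition invariant_dforms :: "nat \<Rightarrow> 'g dform set" where
  "invariant_dforms n = {\<alpha>. alternating V \<alpha> \<and> homogeneous n \<alpha> \<and> constant_form \<alpha>}"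

lemma invariant_dformsD:
  assumes "\<alpha> \<in> invariant_dforms n"
  shows "alternating V \<alpha>" "homogeneous n \<alpha>" "constant_form \<alpha>"
  using assms by (auto simp: invariant_dforms_def)

lemma invariant_dforms_iff: "\<alpha> \<in> invariant_dforms n \<longleftrightarrow> \<alpha> \<in> dforms G \<Gamma> n \<and> invariant_form G \<alpha>"
proof
  assume "\<alpha> \<in> invariant_dforms n"
  from invariant_dformsD[OF this] dformsI show "\<alpha> \<in> dforms G \<Gamma> n \<and> invariant_form G \<alpha>"
    by (simp only: invariant_iff_constant)
next
  assume *: "\<alpha> \<in> dforms G \<Gamma> n \<and> invariant_form G \<alpha>"
  from dformsD[OF conjunct1[OF *]] conjunct2[OF *] show "\<alpha> \<in> invariant_dforms n"
    by (simp only: invariant_dforms_def invariant_iff_constant mem_Collect_eq)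
qed

lemma invariant_dforms_add:
  assumes "\<alpha> \<in> invariant_dforms n" "\<beta> \<in> invariant_dforms n"
  shows "\<alpha> + \<beta> \<in> invariant_dforms n"
proof -
  have "constant_form (\<alpha> + \<beta>)"
    using assms[THEN invariant_dformsD(3)] unfolding constant_form_def plus_fun_apply by metis
  then show ?thesis
    using assms by (simp add: invariant_dforms_def alternating_add homogeneous_add)
qed

lemma invariant_dforms_scale:
  assumes "\<alpha> \<in> invariant_dforms n"
  shows "cscale c \<alpha> \<in> invariant_dforms n"
proof -
  have "constant_form (cscale c \<alpha>)"
    using invariant_dformsD(3)[OF assms] unfolding constant_form_def cscale_def by metis
  then show ?thesis
    using assms by (simp add: invariant_dforms_def alternating_scale homogeneous_scale)
qed

lemma invariant_dforms_zero: "0 \<in> invariant_dforms n"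
proof -
  have "constant_form 0" by (simp add: constant_form_def)
  then show ?thesis by (simp add: invariant_dforms_def alternating_zero homogeneous_zero)
qed

lemma invariant_dforms_subspace: "cvec.subspace (invariant_dforms n)"
  by (rule cvec.subspaceI, rule invariant_dforms_zero, erule (1) invariant_dforms_add,
      erule invariant_dforms_scale)

lemma invariant_dforms_wedge:
  assumes "\<alpha> \<in> invariant_dforms m" "\<beta> \<in> invariant_dforms n"
  shows "\<alpha> \<and>\<^sub>d \<beta> \<in> invariant_dforms (m + n)"
proof -
  have "constant_form (\<alpha> \<and>\<^sub>d \<beta>)"
    unfolding constant_form_def
  proof (intro allI)
    fix Zs x y
    have "\<alpha> Ys x = \<alpha> Ys y" "\<beta> Ys x = \<beta> Ys y" for Ys
      using assms[THEN invariant_dformsD(3)] unfolding constant_form_def by blast+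
    then show "(\<alpha> \<and>\<^sub>d \<beta>) Zs x = (\<alpha> \<and>\<^sub>d \<beta>) Zs y"
      by (simp only: wedge_def)
  qed
  then show ?thesis
    using assms by (auto simp: invariant_dforms_def alternating_wedge homogeneous_wedge)
qed

lemma invariant_dforms_contr:
  assumes "\<alpha> \<in> invariant_dforms n"
  shows "contr Z \<alpha> \<in> invariant_dforms (n - 1)"
proof -
  have "constant_form (contr Z \<alpha>)"
    using invariant_dformsD(3)[OF assms] unfolding constant_form_def contr_def by metis
  then show ?thesis
    using assms by (simp add: invariant_dforms_def alternating_contr
        homogeneous_contr_diff[simplified])
qed

lemma invariant_dforms_contr_list:
  assumes "\<alpha> \<in> invariant_dforms n"
  shows "contr_list Zs \<alpha> \<in> invariant_dforms (n - length Zs)"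
proof -
  have "constant_form (contr_list Zs \<alpha>)"
    using invariant_dformsD(3)[OF assms] unfolding constant_form_def contr_list_def by metis
  then show ?thesis
    using assms by (simp add: invariant_dforms_def alternating_contr_list homogeneous_contr_list)
qed

end

section \<open>Bidegrees and the operators del and delbar\<close>

lemma sum_fun_apply: "(\<Sum>i\<in>I. f i) x = (\<Sum>i\<in>I. f i x :: 'b :: comm_monoid_add)"
  by (induction I rule: infinite_finite_induct) auto

text \<open>A nonzero polynomial has finitely many roots. The value t = 0 is left out because
  weights of contractions are computed by dividing by t.\<close>

lemma polynomial_coeffs_eq:
  fixes a b :: "nat \<Rightarrow> complex"
  assumes "\<And>t. t \<noteq> 0 \<Longrightarrow> (\<Sum>p\<le>m. t ^ p * a p) = (\<Sum>p\<le>m. t ^ p * b p)" "p \<le> m"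
  shows "a p = b p"
proof (rule ccontr)
  assume "a p \<noteq> b p"
  then have "finite {z. (\<Sum>i\<le>m. (a i - b i) * z ^ i) = 0}"
    by (intro polyfun_roots_finite[of _ p]) (use assms(2) in auto)
  moreover have "(\<Sum>i\<le>m. (a i - b i) * z ^ i) = (\<Sum>p\<le>m. z ^ p * a p) - (\<Sum>p\<le>m. z ^ p * b p)" for z
    by (simp add: right_diff_distrib sum_subtractf mult.commute)
  then have "- {0} \<subseteq> {z. (\<Sum>i\<le>m. (a i - b i) * z ^ i) = 0}"
    using assms(1) by simp blast
  ultimately have "finite (- {0 :: complex})" by (rule rev_finite_subset)
  then show False by (simp add: infinite_UNIV_char_0)
qed

text \<open>The subset S records the slots that receive \<open>a i\<close>, so the power of t counts
  them. The induction splits off the last slot and puts its vector in front of Ys.\<close>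

lemma alternating_expand:
  assumes "alternating V \<alpha>" "cvec.subspace V"
    and "\<And>i. i < n \<Longrightarrow> a i \<in> V" "\<And>i. i < n \<Longrightarrow> b i \<in> V"
  shows "\<alpha> (map (\<lambda>i. cscale t (a i) + b i) [0..<n] @ Ys) x =
    (\<Sum>S\<in>Pow {..<n}. t ^ card S * \<alpha> (map (\<lambda>i. if i \<in> S then a i else b i) [0..<n] @ Ys) x)"
  using assms(3,4)
proof (induction n arbitrary: Ys)
  case 0
  then show ?case by simp
next
  case (Suc n)
  let ?m = "\<lambda>S n. map (\<lambda>i. if i \<in> S then a i else b i) [0..<n]"
  let ?w = "map (\<lambda>i. cscale t (a i) + b i) [0..<n]"
  have V: "a n \<in> V" "b n \<in> V" "cscale t (a n) \<in> V"
    using Suc.prems cvec.subspace_scale[OF assms(2)] by simp_all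
  have "\<alpha> (map (\<lambda>i. cscale t (a i) + b i) [0..<Suc n] @ Ys) x = \<alpha> (?w @ (cscale t (a n) + b n) # Ys) x"
    by simp
  also have "\<dots> = t * \<alpha> (?w @ a n # Ys) x + \<alpha> (?w @ b n # Ys) x"
    unfolding alternatingD(2)[OF assms(1) V(3,2)] alternatingD(3)[OF assms(1) V(1)] plus_fun_apply ..
  also have "\<alpha> (?w @ a n # Ys) x = (\<Sum>S\<in>Pow {..<n}. t ^ card S * \<alpha> (?m S n @ a n # Ys) x)"
    by (rule Suc.IH) (use Suc.prems in auto)
  also have "\<alpha> (?w @ b n # Ys) x = (\<Sum>S\<in>Pow {..<n}. t ^ card S * \<alpha> (?m S n @ b n # Ys) x)"
    by (rule Suc.IH) (use Suc.prems in auto)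
  \<comment> \<open>These are the subsets containing n: the extra factor t is absorbed by the larger
    cardinality.\<close>
  also have "t * (\<Sum>S\<in>Pow {..<n}. t ^ card S * \<alpha> (?m S n @ a n # Ys) x) =
      (\<Sum>S\<in>Pow {..<n}. t ^ card (insert n S) * \<alpha> (?m (insert n S) (Suc n) @ Ys) x)"
    unfolding sum_distrib_left
  proof (rule sum.cong[OF refl])
    fix S assume S: "S \<in> Pow {..<n}"
    then have "card (insert n S) = Suc (card S)"
      by (subst card_insert_disjoint) (auto intro: finite_subset)
    moreover have "?m (insert n S) n = ?m S n" by (rule map_cong) auto
    then have "?m (insert n S) (Suc n) @ Ys = ?m S n @ a n # Ys"
      by (simp del: map_eq_conv)
    ultimately show "t * (t ^ card S * \<alpha> (?m S n @ a n # Ys) x) =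
        t ^ card (insert n S) * \<alpha> (?m (insert n S) (Suc n) @ Ys) x"
      by (simp only: power_Suc mult.assoc)
  qed
  also have "(\<Sum>S\<in>Pow {..<n}. t ^ card S * \<alpha> (?m S n @ b n # Ys) x) =
      (\<Sum>S\<in>Pow {..<n}. t ^ card S * \<alpha> (?m S (Suc n) @ Ys) x)"
    by (rule sum.cong) auto
  also have "(\<Sum>S\<in>Pow {..<n}. t ^ card (insert n S) * \<alpha> (?m (insert n S) (Suc n) @ Ys) x) =
      (\<Sum>S\<in>insert n ` Pow {..<n}. t ^ card S * \<alpha> (?m S (Suc n) @ Ys) x)"
  proof (subst sum.reindex)
    show "inj_on (insert n) (Pow {..<n})"
      by (rule inj_onI) (metis Diff_insert_absorb PowD lessThan_iff less_irrefl subsetD)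
  qed simp
  also have "\<dots> + (\<Sum>S\<in>Pow {..<n}. t ^ card S * \<alpha> (?m S (Suc n) @ Ys) x) =
      (\<Sum>S\<in>Pow {..<Suc n}. t ^ card S * \<alpha> (?m S (Suc n) @ Ys) x)"
    unfolding lessThan_Suc Pow_insert
    by (subst sum.union_disjoint) (auto simp: add.commute)
  finally show ?case .
qed

locale complex_lie_group_forms = lie_group_forms +
  fixes J :: "'a vfield \<Rightarrow> 'a vfield"
  assumes acs: "almost_complex_structure G J"
begin

section \<open>The complex structure, types of fields and types of forms\<close>

lemma J_closed: "Z \<in> V \<Longrightarrow> J Z \<in> V"
  and J_add: "Z \<in> V \<Longrightarrow> W \<in> V \<Longrightarrow> J (Z + W) = J Z + J W"
  and J_scale: "Z \<in> V \<Longrightarrow> J (cscale c Z) = cscale c (J Z)"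
  and J_vconj: "Z \<in> V \<Longrightarrow> J (vconj Z) = vconj (J Z)"
  and J_J: "Z \<in> V \<Longrightarrow> J (J Z) = - Z"
  using acs unfolding almost_complex_structure_def by blast+

lemma V_add: "Z \<in> V \<Longrightarrow> W \<in> V \<Longrightarrow> Z + W \<in> V"
  and V_diff: "Z \<in> V \<Longrightarrow> W \<in> V \<Longrightarrow> Z - W \<in> V"
  and V_scale: "Z \<in> V \<Longrightarrow> cscale c Z \<in> V"
  using lie_algebra_C_subspace cvec.subspace_add cvec.subspace_diff cvec.subspace_scale by blast+

lemma J_diff: "Z \<in> V \<Longrightarrow> W \<in> V \<Longrightarrow> J (Z - W) = J Z - J W"
  using J_add[of Z "cscale (-1) W"] J_scale[of W "-1"] V_scale[of W "-1"] by simp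

lemma proj_closed: "Z \<in> V \<Longrightarrow> proj_10 J Z \<in> V" "Z \<in> V \<Longrightarrow> proj_01 J Z \<in> V"
  by (simp_all add: proj_10_def proj_01_def V_add V_diff V_scale J_closed del: cvec.scale_minus_left)

lemma proj_sum: "proj_10 J Z + proj_01 J Z = Z"
  by (simp add: proj_10_def proj_01_def cscale_def fun_eq_iff field_simps)

lemma J_proj:
  assumes "Z \<in> V"
  shows "J (proj_10 J Z) = cscale \<i> (proj_10 J Z)" "J (proj_01 J Z) = cscale (- \<i>) (proj_01 J Z)"
proof -
  have "J (proj_10 J Z) = cscale (1/2) (J Z - cscale \<i> (J (J Z)))"
    "J (proj_01 J Z) = cscale (1/2) (J Z + cscale \<i> (J (J Z)))"
    using assms by (simp_all only: proj_10_def proj_01_def J_scale J_diff J_add V_add V_diff V_scale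
        J_closed)
  then show "J (proj_10 J Z) = cscale \<i> (proj_10 J Z)"
    "J (proj_01 J Z) = cscale (- \<i>) (proj_01 J Z)"
    by (simp_all add: J_J[OF assms] proj_10_def proj_01_def cscale_def fun_eq_iff field_simps)
qed

lemma proj_fields: "Z \<in> V \<Longrightarrow> proj_10 J Z \<in> fields_10 G J" "Z \<in> V \<Longrightarrow> proj_01 J Z \<in> fields_01 G J"
  unfolding fields_10_def fields_01_def using proj_closed J_proj by blast+

lemma proj_of_fields:
  shows "Z \<in> fields_10 G J \<Longrightarrow> proj_10 J Z = Z" "Z \<in> fields_10 G J \<Longrightarrow> proj_01 J Z = 0"
    and "Z \<in> fields_01 G J \<Longrightarrow> proj_10 J Z = 0" "Z \<in> fields_01 G J \<Longrightarrow> proj_01 J Z = Z"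
  by (simp_all add: fields_10_def fields_01_def proj_10_def proj_01_def)
    (simp_all add: cscale_def fun_eq_iff field_simps)

lemma fields_V: "Z \<in> fields_10 G J \<Longrightarrow> Z \<in> V" "Z \<in> fields_01 G J \<Longrightarrow> Z \<in> V"
  by (auto simp: fields_10_def fields_01_def)

lemma proj_add:
  assumes "Z \<in> V" "W \<in> V"
  shows "proj_10 J (Z + W) = proj_10 J Z + proj_10 J W"
    and "proj_01 J (Z + W) = proj_01 J Z + proj_01 J W"
  unfolding proj_10_def proj_01_def J_add[OF assms]
  by (simp_all add: cscale_def fun_eq_iff field_simps)

lemma proj_scale:
  assumes "Z \<in> V"
  shows "proj_10 J (cscale c Z) = cscale c (proj_10 J Z)"
    and "proj_01 J (cscale c Z) = cscale c (proj_01 J Z)"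
  unfolding proj_10_def proj_01_def J_scale[OF assms]
  by (simp_all add: cscale_def fun_eq_iff field_simps)

lemma vconj_fields:
  "Z \<in> fields_10 G J \<Longrightarrow> vconj Z \<in> fields_01 G J"
  "Z \<in> fields_01 G J \<Longrightarrow> vconj Z \<in> fields_10 G J"
  by (auto simp: fields_10_def fields_01_def vconj_closed J_vconj)
    (auto simp: vconj_def cscale_def fun_eq_iff)

text \<open>The scaling action with weight 1 on (1, 0)-fields and weight 0 on (0, 1)-fields.\<close>

definition twist :: "complex \<Rightarrow> 'a vfield \<Rightarrow> 'a vfield" where
  "twist t Z = cscale t (proj_10 J Z) + proj_01 J Z"

lemma twist_closed: "Z \<in> V \<Longrightarrow> twist t Z \<in> V"
  by (simp only: twist_def V_add V_scale proj_closed)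

lemma twist_add: "Z \<in> V \<Longrightarrow> W \<in> V \<Longrightarrow> twist t (Z + W) = twist t Z + twist t W"
  by (simp only: twist_def proj_add cvec.scale_right_distrib ac_simps)

lemma twist_scale: "Z \<in> V \<Longrightarrow> twist t (cscale c Z) = cscale c (twist t Z)"
  by (simp only: twist_def proj_scale) (simp add: cscale_def fun_eq_iff algebra_simps)

lemma twist_fields:
  "Z \<in> fields_10 G J \<Longrightarrow> twist t Z = cscale t Z"
  "Z \<in> fields_01 G J \<Longrightarrow> twist t Z = Z"
  by (simp_all only: twist_def proj_of_fields cvec.scale_zero_right add_0_left add_0_right)

lemma twist_twist: "Z \<in> V \<Longrightarrow> twist s (twist t Z) = twist (s * t) Z"
  using proj_closed[of Z] proj_fields[of Z]
  by (simp only: twist_def[of t] twist_add twist_scale V_scale twist_fields)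
    (simp add: twist_def cscale_def fun_eq_iff algebra_simps)

text \<open>A form of type \<open>(p, q)\<close> is an eigenvector of \<open>pull t\<close> for the eigenvalue \<open>t\<^sup>p\<close>, so the
  bidegree components are read off as coefficients of powers of \<open>t\<close>.\<close>

definition pull :: "complex \<Rightarrow> 'a dform \<Rightarrow> 'a dform" where
  "pull t \<alpha> = (\<lambda>Zs. if set Zs \<subseteq> V then \<alpha> (map (twist t) Zs) else 0)"

lemma pull_add: "pull t (\<alpha> + \<beta>) = pull t \<alpha> + pull t \<beta>"
  and pull_scale: "pull t (cscale c \<alpha>) = cscale c (pull t \<alpha>)"
  by (simp_all add: pull_def cscale_def fun_eq_iff)

lemma pull_contr: "Z \<in> V \<Longrightarrow> contr Z (pull t \<alpha>) = pull t (contr (twist t Z) \<alpha>)"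
  by (simp add: pull_def contr_def fun_eq_iff)

lemma pull_pull: "pull s (pull t \<alpha>) = pull (t * s) \<alpha>"
proof
  fix Zs
  have "map (twist t) (map (twist s) Zs) = map (twist (t * s)) Zs" if "set Zs \<subseteq> V"
    using that by (induction Zs) (auto simp: twist_twist)
  moreover have "set (map (twist s) Zs) \<subseteq> V" if "set Zs \<subseteq> V"
    using that twist_closed by auto
  ultimately show "pull s (pull t \<alpha>) Zs = pull (t * s) \<alpha> Zs"
    unfolding pull_def by presburger
qed

lemma pull_wedge: "pull t (\<alpha> \<and>\<^sub>d \<beta>) = pull t \<alpha> \<and>\<^sub>d pull t \<beta>"
proof (intro ext)
  fix Zs x
  show "pull t (\<alpha> \<and>\<^sub>d \<beta>) Zs x = (pull t \<alpha> \<and>\<^sub>d pull t \<beta>) Zs x"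
  proof (cases "set Zs \<subseteq> V")
    case True
    then have "set (nths Zs S) \<subseteq> V" for S using set_nths_subset by fastforce
    with True show ?thesis by (simp add: pull_def wedge_def nths_map)
  next
    case False
    have "pull t \<alpha> (nths Zs S) x * pull t \<beta> (nths Zs (- S)) x = 0" for S
    proof -
      have "set Zs \<subseteq> set (nths Zs S) \<union> set (nths Zs (- S))"
      proof
        fix Z assume "Z \<in> set Zs"
        then obtain i where "i < length Zs" "Z = Zs ! i" by (metis in_set_conv_nth)
        then show "Z \<in> set (nths Zs S) \<union> set (nths Zs (- S))"
          by (cases "i \<in> S") (auto simp: set_nths)
      qed
      with False have "\<not> set (nths Zs S) \<subseteq> V \<or> \<not> set (nths Zs (- S)) \<subseteq> V" by blast
      then show ?thesis by (auto simp: pull_def)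
    qed
    then show ?thesis using False by (auto simp: pull_def wedge_def mult.assoc intro!: sum.neutral)
  qed
qed

lemma pull_alternating:
  assumes "alternating V \<alpha>"
  shows "alternating V (pull t \<alpha>)"
proof (rule alternatingI)
  fix Xs Z Ys assume "Z \<notin> V"
  then show "pull t \<alpha> (Xs @ Z # Ys) = 0" by (simp add: pull_def)
next
  fix Xs Ys Z W
  show "pull t \<alpha> (Xs @ Z # W # Ys) = (\<lambda>x. - pull t \<alpha> (Xs @ W # Z # Ys) x)"
    using alternatingD(4)[OF assms, of "map (twist t) Xs" "twist t Z" "twist t W" "map (twist t) Ys"]
    by (auto simp: pull_def fun_eq_iff)
  assume ZW: "Z \<in> V" "W \<in> V"
  then show "pull t \<alpha> (Xs @ (Z + W) # Ys) = pull t \<alpha> (Xs @ Z # Ys) + pull t \<alpha> (Xs @ W # Ys)"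
    using alternatingD(2)[OF assms twist_closed[OF ZW(1)] twist_closed[OF ZW(2)],
        of "map (twist t) Xs" t t "map (twist t) Ys"]
    by (cases "set Xs \<subseteq> V \<and> set Ys \<subseteq> V")
      (auto simp: pull_def twist_add V_add simp del: plus_fun_apply)
next
  fix Xs Ys Z c assume Z: "Z \<in> V"
  then show "pull t \<alpha> (Xs @ cscale c Z # Ys) = (\<lambda>x. c * pull t \<alpha> (Xs @ Z # Ys) x)"
    using alternatingD(3)[OF assms twist_closed[OF Z], of "map (twist t) Xs" c t "map (twist t) Ys"]
    by (auto simp: pull_def twist_scale V_scale fun_eq_iff)
qed

text \<open>Expanding \<alpha> on twisted arguments and grouping the terms by the number of (1,
  0)-parts produces the sums in \<open>pq_component\<close> as coefficients of the powers of
  t.\<close>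

lemma pull_expand:
  assumes "alternating V \<alpha>" "homogeneous n \<alpha>"
  shows "pull t \<alpha> Zs x = (\<Sum>p\<le>n. t ^ p * pq_component G J p (n - p) \<alpha> Zs x)"
proof (cases "length Zs = n \<and> set Zs \<subseteq> V")
  case False
  then have "pull t \<alpha> Zs x = 0"
    using assms(2) by (auto simp: pull_def homogeneous_def)
  moreover have "pq_component G J p (n - p) \<alpha> Zs x = 0" if "p \<le> n" for p
    using False that by (auto simp: pq_component_def)
  ultimately show ?thesis by simp
next
  case True
  have V: "proj_10 J (Zs ! i) \<in> V" "proj_01 J (Zs ! i) \<in> V" if "i < n" for i
    using that True proj_closed by (meson nth_mem subsetD)+
  let ?f = "\<lambda>S. \<alpha> (map (\<lambda>i. if i \<in> S then proj_10 J (Zs ! i) else proj_01 J (Zs ! i)) [0..<n]) x"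
  have "map (twist t) Zs = map (\<lambda>i. cscale t (proj_10 J (Zs ! i)) + proj_01 J (Zs ! i)) [0..<n]"
    using True by (intro nth_equalityI) (auto simp: twist_def)
  then have "pull t \<alpha> Zs x =
      \<alpha> (map (\<lambda>i. cscale t (proj_10 J (Zs ! i)) + proj_01 J (Zs ! i)) [0..<n] @ []) x"
    using True by (simp only: pull_def if_True append_Nil2)
  also have "\<dots> = (\<Sum>S\<in>Pow {..<n}. t ^ card S * ?f S)"
    using alternating_expand[OF assms(1) lie_algebra_C_subspace,
        where a = "\<lambda>i. proj_10 J (Zs ! i)" and b = "\<lambda>i. proj_01 J (Zs ! i)" and Ys = "[]"] V
    by simp
  also have "\<dots> = (\<Sum>p\<le>n. \<Sum>S\<in>{S \<in> Pow {..<n}. card S = p}. t ^ card S * ?f S)"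
  proof (rule sum.group[symmetric])
    have "card S \<le> n" if "S \<subseteq> {..<n}" for S using card_mono[OF _ that] by simp
    then show "card ` Pow {..<n} \<subseteq> {..n}" by auto
  qed auto
  also have "\<dots> = (\<Sum>p\<le>n. t ^ p * pq_component G J p (n - p) \<alpha> Zs x)"
  proof (rule sum.cong[OF refl])
    fix p assume "p \<in> {..n}"
    then have "pq_component G J p (n - p) \<alpha> Zs x = (\<Sum>S\<in>{S \<in> Pow {..<n}. card S = p}. ?f S)"
      using True by (simp add: pq_component_def sum_fun_apply)
    then show "(\<Sum>S\<in>{S \<in> Pow {..<n}. card S = p}. t ^ card S * ?f S) =
        t ^ p * pq_component G J p (n - p) \<alpha> Zs x"
      by (simp add: sum_distrib_left)
  qed
  finally show ?thesis .
qed

text \<open>The expansion at t = 1, where \<open>twist\<close> is the identity.\<close>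

lemma pq_component_sum:
  assumes "alternating V \<alpha>" "homogeneous n \<alpha>"
  shows "(\<Sum>p\<le>n. pq_component G J p (n - p) \<alpha> Zs x) = \<alpha> Zs x"
proof -
  have "map (twist 1) Zs = Zs" for Zs
    by (rule map_idI) (simp add: twist_def proj_sum del: plus_fun_apply)
  then have "pull 1 \<alpha> Zs x = \<alpha> Zs x"
    using alternating_outside[OF assms(1), of Zs] by (auto simp: pull_def)
  then show ?thesis using pull_expand[OF assms, of 1 Zs x] by simp
qed

text \<open>Comparison of the coefficients of t in \<open>pull s (pull t \<alpha>)\<close> and
  \<open>pull (t * s) \<alpha>\<close>.\<close>

lemma pull_pq_component:
  assumes "alternating V \<alpha>" "homogeneous n \<alpha>" "p \<le> n"
  shows "pull s (pq_component G J p (n - p) \<alpha>) = cscale (s ^ p) (pq_component G J p (n - p) \<alpha>)"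
proof (intro ext)
  fix Zs x
  let ?c = "\<lambda>p. pq_component G J p (n - p) \<alpha>"
  show "pull s (?c p) Zs x = cscale (s ^ p) (?c p) Zs x"
  proof (rule polynomial_coeffs_eq[OF _ assms(3), where b = "\<lambda>p. cscale (s ^ p) (?c p) Zs x"])
    fix t :: complex
    have "pull s (pull t \<alpha>) Zs x = (\<Sum>p\<le>n. t ^ p * pull s (?c p) Zs x)"
      by (subst pull_def) (simp add: pull_def[of s "?c _"] pull_expand[OF assms(1,2)])
    moreover have "pull s (pull t \<alpha>) Zs x = (\<Sum>p\<le>n. t ^ p * cscale (s ^ p) (?c p) Zs x)"
      unfolding pull_pull pull_expand[OF assms(1,2)]
      by (simp add: cscale_def power_mult_distrib mult.assoc)
    ultimately show "(\<Sum>p\<le>n. t ^ p * pull s (?c p) Zs x) =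
        (\<Sum>p\<le>n. t ^ p * cscale (s ^ p) (?c p) Zs x)" by simp
  qed
qed

text \<open>Each law holds for \<open>pull t \<alpha>\<close> and every t, hence for the
  coefficients of the powers of t; the sum over subsets is never manipulated.\<close>

lemma alternating_pq_component:
  assumes "alternating V \<alpha>" "homogeneous n \<alpha>" "p \<le> n"
  shows "alternating V (pq_component G J p (n - p) \<alpha>)"
proof -
  let ?c = "\<lambda>p. pq_component G J p (n - p) \<alpha>"
  note alt = pull_alternating[OF assms(1)] and exp = pull_expand[OF assms(1,2)]
  show ?thesis
  proof (rule alternatingI)
    fix Xs Z Ys assume "Z \<notin> V"
    then show "?c p (Xs @ Z # Ys) = 0" by (simp add: pq_component_def)
  next
    fix Xs Ys Z W assume ZW: "Z \<in> V" "W \<in> V"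
    show "?c p (Xs @ (Z + W) # Ys) = ?c p (Xs @ Z # Ys) + ?c p (Xs @ W # Ys)"
    proof
      fix x
      have "?c p (Xs @ (Z + W) # Ys) x = ?c p (Xs @ Z # Ys) x + ?c p (Xs @ W # Ys) x"
      proof (rule polynomial_coeffs_eq[OF _ assms(3), where a = "\<lambda>p. ?c p (Xs @ (Z + W) # Ys) x"
            and b = "\<lambda>p. ?c p (Xs @ Z # Ys) x + ?c p (Xs @ W # Ys) x"])
        fix t :: complex
        show "(\<Sum>p\<le>n. t ^ p * ?c p (Xs @ (Z + W) # Ys) x) =
            (\<Sum>p\<le>n. t ^ p * (?c p (Xs @ Z # Ys) x + ?c p (Xs @ W # Ys) x))"
          using fun_cong[OF alternatingD(2)[OF alt ZW, of t Xs Ys], of x]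
          unfolding plus_fun_apply exp distrib_left sum.distrib .
      qed
      then show "?c p (Xs @ (Z + W) # Ys) x = (?c p (Xs @ Z # Ys) + ?c p (Xs @ W # Ys)) x"
        unfolding plus_fun_apply .
    qed
  next
    fix Xs Ys c Z assume Z: "Z \<in> V"
    show "?c p (Xs @ cscale c Z # Ys) = (\<lambda>x. c * ?c p (Xs @ Z # Ys) x)"
    proof
      fix x
      show "?c p (Xs @ cscale c Z # Ys) x = c * ?c p (Xs @ Z # Ys) x"
      proof (rule polynomial_coeffs_eq[OF _ assms(3), where a = "\<lambda>p. ?c p (Xs @ cscale c Z # Ys) x"
            and b = "\<lambda>p. c * ?c p (Xs @ Z # Ys) x"])
        fix t :: complex
        show "(\<Sum>p\<le>n. t ^ p * ?c p (Xs @ cscale c Z # Ys) x) =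
            (\<Sum>p\<le>n. t ^ p * (c * ?c p (Xs @ Z # Ys) x))"
          using fun_cong[OF alternatingD(3)[OF alt Z, of t Xs c Ys], of x]
          unfolding exp sum_distrib_left mult.left_commute[of c] .
      qed
    qed
  next
    fix Xs Ys Z W
    show "?c p (Xs @ Z # W # Ys) = (\<lambda>x. - ?c p (Xs @ W # Z # Ys) x)"
    proof
      fix x
      show "?c p (Xs @ Z # W # Ys) x = - ?c p (Xs @ W # Z # Ys) x"
      proof (rule polynomial_coeffs_eq[OF _ assms(3), where a = "\<lambda>p. ?c p (Xs @ Z # W # Ys) x"
            and b = "\<lambda>p. - ?c p (Xs @ W # Z # Ys) x"])
        fix t :: complex
        show "(\<Sum>p\<le>n. t ^ p * ?c p (Xs @ Z # W # Ys) x) =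
            (\<Sum>p\<le>n. t ^ p * (- ?c p (Xs @ W # Z # Ys) x))"
          using fun_cong[OF alternatingD(4)[OF alt, of t Xs Z W Ys], of x]
          unfolding exp mult_minus_right sum_negf .
      qed
    qed
  qed
qed

lemma pq_component_invariant:
  assumes "\<alpha> \<in> invariant_dforms n" "p \<le> n"
  shows "pq_component G J p (n - p) \<alpha> \<in> invariant_dforms n"
proof -
  have "homogeneous n (pq_component G J p (n - p) \<alpha>)"
    using assms(2) by (simp add: homogeneous_def pq_component_def)
  moreover have "constant_form (pq_component G J p (n - p) \<alpha>)"
    unfolding constant_form_def
  proof (intro allI)
    fix Zs x y
    have "\<alpha> Ys x = \<alpha> Ys y" for Ys
      using invariant_dformsD(3)[OF assms(1)] unfolding constant_form_def by blast
    then show "pq_component G J p (n - p) \<alpha> Zs x = pq_component G J p (n - p) \<alpha> Zs y"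
      by (simp add: pq_component_def sum_fun_apply)
  qed
  ultimately show ?thesis
    using alternating_pq_component[OF invariant_dformsD(1,2)[OF assms(1)] assms(2)]
    by (simp add: invariant_dforms_def)
qed

text \<open>Uniqueness of coefficients. Two consecutive powers are what the differential of a form
  of type (p, q) will show: its parts have type (p + 1, q) and (p, q + 1).\<close>

lemma pq_component_eqI:
  assumes "alternating V \<alpha>" "homogeneous n \<alpha>"
    and "\<And>t. t \<noteq> 0 \<Longrightarrow> pull t \<alpha> = cscale (t ^ Suc p) \<beta> + cscale (t ^ p) \<gamma>"
    and "Suc p \<le> n"
  shows "pq_component G J (Suc p) (n - Suc p) \<alpha> = \<beta>" "pq_component G J p (n - p) \<alpha> = \<gamma>"
proof -
  have *: "pq_component G J q (n - q) \<alpha> Zs x = (if q = Suc p then \<beta> Zs x else if q = p then \<gamma> Zs x else 0)"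
    if "q \<le> n" for q Zs x
  proof (rule polynomial_coeffs_eq[OF _ that, where a = "\<lambda>q. pq_component G J q (n - q) \<alpha> Zs x"
        and b = "\<lambda>q. if q = Suc p then \<beta> Zs x else if q = p then \<gamma> Zs x else 0"])
    fix t :: complex assume "t \<noteq> 0"
    have "(\<Sum>q\<le>n. t ^ q * pq_component G J q (n - q) \<alpha> Zs x) = t ^ Suc p * \<beta> Zs x + t ^ p * \<gamma> Zs x"
      unfolding pull_expand[OF assms(1,2), symmetric] assms(3)[OF \<open>t \<noteq> 0\<close>]
      by (simp add: cscale_def)
    also have "\<dots> = (\<Sum>q\<in>{p, Suc p}. t ^ q * (if q = Suc p then \<beta> Zs x else if q = p then \<gamma> Zs x else 0))"
      by simp
    also have "\<dots> = (\<Sum>q\<le>n. t ^ q * (if q = Suc p then \<beta> Zs x else if q = p then \<gamma> Zs x else 0))"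
      using assms(4) by (intro sum.mono_neutral_left) auto
    finally show "(\<Sum>q\<le>n. t ^ q * pq_component G J q (n - q) \<alpha> Zs x) = \<dots>" .
  qed
  show "pq_component G J (Suc p) (n - Suc p) \<alpha> = \<beta>" "pq_component G J p (n - p) \<alpha> = \<gamma>"
    using *[of "Suc p"] *[of p] assms(4) by (auto simp: fun_eq_iff)
qed

end

text \<open>The data of the structure equations: \<open>u\<close> and \<open>v\<close> span the center containing all brackets, and
  the differential of the last coframe element is \<open>A + B\<close> with \<open>A\<close> of type \<open>(2, 0)\<close> and \<open>B\<close> of type
  \<open>(1, 1)\<close>; \<open>A'\<close> and \<open>B'\<close> are the conjugates.\<close>

locale special_structure = complex_lie_group_forms +
  fixes u v :: "'a vfield" and A B A' B' :: "'a dform"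
  assumes u: "u \<in> fields_10 G J" and v: "v \<in> fields_01 G J"
    and forms: "A \<in> invariant_dforms 2" "B \<in> invariant_dforms 2"
      "A' \<in> invariant_dforms 2" "B' \<in> invariant_dforms 2"
    and types: "\<And>t. pull t A = cscale (t\<^sup>2) A" "\<And>t. pull t B = cscale t B"
      "\<And>t. pull t A' = A'" "\<And>t. pull t B' = cscale t B'"
    and contr_u: "contr u A = 0" "contr u B = 0" "contr u A' = 0" "contr u B' = 0"
    and contr_v: "contr v A = 0" "contr v B = 0" "contr v A' = 0" "contr v B' = 0"
    and ext_d_eq: "\<And>n \<alpha>. \<alpha> \<in> invariant_dforms n \<Longrightarrow>
      ext_d G \<alpha> = (A + B) \<and>\<^sub>d contr u \<alpha> + (A' + B') \<and>\<^sub>d contr v \<alpha>"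
begin

text \<open>These are \<open>del\<close> and \<open>delbar\<close> on invariant forms, as
  \<open>del_eq\<close> and \<open>delbar_eq\<close> show. Contraction with \<open>u\<close> lowers
  the type by (1, 0) and contraction with \<open>v\<close> by (0, 1); so \<open>A\<close> with
  \<open>u\<close> and \<open>B'\<close> with \<open>v\<close> raise it by (1, 0), the other two
  terms by (0, 1).\<close>

definition "D1 \<alpha> = A \<and>\<^sub>d contr u \<alpha> + B' \<and>\<^sub>d contr v \<alpha>"
definition "D2 \<alpha> = B \<and>\<^sub>d contr u \<alpha> + A' \<and>\<^sub>d contr v \<alpha>"

lemma wedge_contr_invariant:
  assumes "F \<in> invariant_dforms 2" "\<alpha> \<in> invariant_dforms n"
  shows "F \<and>\<^sub>d contr Z \<alpha> \<in> invariant_dforms (Suc n)"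
proof (cases n)
  case 0
  then have "contr Z \<alpha> = 0"
    using invariant_dformsD(2)[OF assms(2)] contr_homogeneous_0 by blast
  then show ?thesis by (simp only: wedge_zero_right invariant_dforms_zero)
next
  case (Suc m)
  then show ?thesis
    using invariant_dforms_wedge[OF assms(1) invariant_dforms_contr[OF assms(2), of Z]] by simp
qed

lemma D1_invariant: "\<alpha> \<in> invariant_dforms n \<Longrightarrow> D1 \<alpha> \<in> invariant_dforms (Suc n)"
  and D2_invariant: "\<alpha> \<in> invariant_dforms n \<Longrightarrow> D2 \<alpha> \<in> invariant_dforms (Suc n)"
  unfolding D1_def D2_def by (intro invariant_dforms_add wedge_contr_invariant forms; assumption)+

lemma ext_d_D: "\<alpha> \<in> invariant_dforms n \<Longrightarrow> ext_d G \<alpha> = D1 \<alpha> + D2 \<alpha>"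
  by (simp only: ext_d_eq D1_def D2_def wedge_add_left ac_simps)

text \<open>The contraction is compared through \<open>twist t u\<close>, which is u scaled by t.
  Writing the weight as \<open>t ^ p / t\<close> covers p = 0 without a separate case.\<close>

lemma pull_contr_uv:
  assumes "pull t \<alpha> = cscale (t ^ p) \<alpha>" "alternating V \<alpha>" "t \<noteq> 0"
  shows "pull t (contr u \<alpha>) = cscale (t ^ p / t) (contr u \<alpha>)"
    and "pull t (contr v \<alpha>) = cscale (t ^ p) (contr v \<alpha>)"
proof -
  note uv = fields_V(1)[OF u] fields_V(2)[OF v]
  have "cscale t (pull t (contr u \<alpha>)) = cscale (t ^ p) (contr u \<alpha>)"
    using pull_contr[OF uv(1), of t \<alpha>] alternating_contr_scale[OF assms(2) uv(1), of t]
    by (simp only: assms(1) twist_fields(1)[OF u] contr_scale pull_scale)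
  then have "cscale (inverse t) (cscale t (pull t (contr u \<alpha>))) =
      cscale (inverse t) (cscale (t ^ p) (contr u \<alpha>))"
    by (simp only:)
  then show "pull t (contr u \<alpha>) = cscale (t ^ p / t) (contr u \<alpha>)"
    using assms(3) by (simp add: divide_inverse mult.commute)
  show "pull t (contr v \<alpha>) = cscale (t ^ p) (contr v \<alpha>)"
    using pull_contr[OF uv(2), of t \<alpha>] by (simp only: assms(1) twist_fields(2)[OF v] contr_scale)
qed

lemma pull_D:
  assumes "pull t \<alpha> = cscale (t ^ p) \<alpha>" "alternating V \<alpha>" "t \<noteq> 0"
  shows "pull t (D1 \<alpha>) = cscale (t ^ Suc p) (D1 \<alpha>)" "pull t (D2 \<alpha>) = cscale (t ^ p) (D2 \<alpha>)"
  unfolding D1_def D2_def pull_add pull_wedge types pull_contr_uv[OF assms]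
    wedge_scale_left wedge_scale_right cvec.scale_right_distrib cvec.scale_scale
  using assms(3) by (simp_all add: power2_eq_square mult_ac)

lemma pq_component_ext_d:
  assumes "\<alpha> \<in> invariant_dforms n" "p \<le> n" "\<And>t. pull t \<alpha> = cscale (t ^ p) \<alpha>"
  shows "pq_component G J (Suc p) (n - p) (ext_d G \<alpha>) = D1 \<alpha>"
    and "pq_component G J p (Suc (n - p)) (ext_d G \<alpha>) = D2 \<alpha>"
proof -
  have e: "ext_d G \<alpha> = D1 \<alpha> + D2 \<alpha>" by (rule ext_d_D[OF assms(1)])
  have inv: "D1 \<alpha> + D2 \<alpha> \<in> invariant_dforms (Suc n)"
    by (intro invariant_dforms_add D1_invariant D2_invariant assms(1))
  have "pull t (D1 \<alpha> + D2 \<alpha>) = cscale (t ^ Suc p) (D1 \<alpha>) + cscale (t ^ p) (D2 \<alpha>)" if "t \<noteq> 0" for t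
    unfolding pull_add pull_D[OF assms(3) invariant_dformsD(1)[OF assms(1)] that] ..
  from pq_component_eqI[OF invariant_dformsD(1,2)[OF inv] this] assms(2)
  show "pq_component G J (Suc p) (n - p) (ext_d G \<alpha>) = D1 \<alpha>"
    "pq_component G J p (Suc (n - p)) (ext_d G \<alpha>) = D2 \<alpha>"
    by (simp_all add: e Suc_diff_le)
qed

lemma ext_d_zero: "ext_d G 0 = 0"
  using ext_d_D[OF invariant_dforms_zero]
  by (simp only: D1_def D2_def contr_zero wedge_zero_right add_0_left)

lemma pq_component_wrong_degree:
  assumes "homogeneous n \<alpha>" "p + q \<noteq> n"
  shows "pq_component G J p q \<alpha> = 0"
  using assms by (auto simp: pq_component_def homogeneous_def fun_eq_iff sum_fun_apply)

lemma pq_component_zero: "pq_component G J p q 0 = 0"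
  by (auto simp: pq_component_def fun_eq_iff sum_fun_apply)

lemma D_sum:
  assumes "\<alpha> \<in> invariant_dforms n"
  shows "(\<Sum>p\<le>n. D1 (pq_component G J p (n - p) \<alpha>) Zs x) = D1 \<alpha> Zs x"
    and "(\<Sum>p\<le>n. D2 (pq_component G J p (n - p) \<alpha>) Zs x) = D2 \<alpha> Zs x"
proof -
  have sum_forms: "(\<Sum>p\<le>n. pq_component G J p (n - p) \<alpha>) = \<alpha>"
    using pq_component_sum[OF invariant_dformsD(1,2)[OF assms]]
    by (simp add: fun_eq_iff sum_fun_apply)
  have add: "D1 (\<beta> + \<gamma>) = D1 \<beta> + D1 \<gamma>" "D2 (\<beta> + \<gamma>) = D2 \<beta> + D2 \<gamma>" for \<beta> \<gamma>
    by (simp_all only: D1_def D2_def contr_add wedge_add_right ac_simps)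
  have zero: "D1 0 = 0" "D2 0 = 0"
    by (simp_all only: D1_def D2_def contr_zero wedge_zero_right add_0_left)
  have "D1 (sum f I) = (\<Sum>i\<in>I. D1 (f i))" "D2 (sum f I) = (\<Sum>i\<in>I. D2 (f i))"
    for f :: "nat \<Rightarrow> 'a dform" and I
    by (induction I rule: infinite_finite_induct) (simp_all add: add zero del: plus_fun_apply zero_fun_apply)
  from this[of "\<lambda>p. pq_component G J p (n - p) \<alpha>" "{..n}"]
  show "(\<Sum>p\<le>n. D1 (pq_component G J p (n - p) \<alpha>) Zs x) = D1 \<alpha> Zs x"
    "(\<Sum>p\<le>n. D2 (pq_component G J p (n - p) \<alpha>) Zs x) = D2 \<alpha> Zs x"
    unfolding sum_forms by (simp_all add: sum_fun_apply)
qed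

text \<open>On the component of type (p, n - p) the two types occurring in \<open>ext_d\<close> are
  separated by \<open>pq_component_eqI\<close>; summing over p recovers \<alpha> because
  \<open>D1\<close> and \<open>D2\<close> are additive.\<close>

lemma
  assumes \<alpha>: "\<alpha> \<in> invariant_dforms n"
  shows del_eq: "del G J \<alpha> = D1 \<alpha>" and delbar_eq: "delbar G J \<alpha> = D2 \<alpha>"
proof -
  note d = invariant_dformsD[OF \<alpha>]
  have *: "del G J \<alpha> Zs x = D1 \<alpha> Zs x \<and> delbar G J \<alpha> Zs x = D2 \<alpha> Zs x" for Zs x
  proof (cases "length Zs = Suc n")
    case True
    have 1: "p \<le> n \<Longrightarrow> pq_component G J (p + 1) (n - p) (ext_d G (pq_component G J p (n - p) \<alpha>)) =
        D1 (pq_component G J p (n - p) \<alpha>)" for p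
      using pq_component_ext_d(1)[OF pq_component_invariant[OF \<alpha>] _ pull_pq_component[OF d(1,2)]]
      by simp
    have 2: "p \<le> n \<Longrightarrow> pq_component G J p (n - p + 1) (ext_d G (pq_component G J p (n - p) \<alpha>)) =
        D2 (pq_component G J p (n - p) \<alpha>)" for p
      using pq_component_ext_d(2)[OF pq_component_invariant[OF \<alpha>] _ pull_pq_component[OF d(1,2)]]
      by simp
    have "del G J \<alpha> Zs x = (\<Sum>p\<le>n. D1 (pq_component G J p (n - p) \<alpha>) Zs x)"
      "delbar G J \<alpha> Zs x = (\<Sum>p\<le>n. D2 (pq_component G J p (n - p) \<alpha>) Zs x)"
      unfolding del_def delbar_def Let_def True lessThan_Suc_atMost diff_Suc_1 sum_fun_apply
      by (rule sum.cong[OF refl], simp only: 1 2 atMost_iff)+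
    then show ?thesis by (simp only: D_sum[OF \<alpha>])
  next
    \<comment> \<open>On lists of any other length each summand starts from a component of \<alpha>
      in a degree different from n, which is zero.\<close>
    case False
    have "pq_component G J p (length Zs - 1 - p) \<alpha> = 0" if "p < length Zs" for p
      using that False by (intro pq_component_wrong_degree[OF d(2)]) auto
    then have "del G J \<alpha> Zs x = 0" "delbar G J \<alpha> Zs x = 0"
      unfolding del_def delbar_def Let_def sum_fun_apply
      by (simp_all add: ext_d_zero pq_component_zero)
    moreover have "D1 \<alpha> Zs = 0" "D2 \<alpha> Zs = 0"
      using False invariant_dformsD(2)[OF D1_invariant[OF \<alpha>]]
        invariant_dformsD(2)[OF D2_invariant[OF \<alpha>]] by (auto simp: homogeneous_def)
    ultimately show ?thesis by simp
  qed
  then show "del G J \<alpha> = D1 \<alpha>" "delbar G J \<alpha> = D2 \<alpha>" by (auto simp: fun_eq_iff)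
qed

end

section \<open>Hermitian metrics and the Hodge star\<close>

lemma wedge_sum_right: "\<alpha> \<and>\<^sub>d (\<Sum>i\<in>I. f i) = (\<Sum>i\<in>I. \<alpha> \<and>\<^sub>d f i)"
  by (induction I rule: infinite_finite_induct)
    (simp_all add: wedge_add_right wedge_zero_right del: plus_fun_apply zero_fun_apply)

text \<open>In every shuffle the factor \<theta> sees either one of the listed arguments or a list
  of the wrong length.\<close>

lemma wedge_1_vanish:
  assumes "homogeneous 1 \<theta>" "\<And>W. W \<in> set Zs \<Longrightarrow> \<theta> [W] x = 0"
  shows "(\<theta> \<and>\<^sub>d \<beta>) Zs x = 0"
proof -
  have "\<theta> (nths Zs S) x = 0" for S
  proof (cases "length (nths Zs S) = 1")
    case True
    then obtain W where W: "nths Zs S = [W]" by (auto simp: length_Suc_conv)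
    then have "W \<in> set Zs" using set_nths_subset[of Zs S] by auto
    then show ?thesis using assms(2) W by simp
  next
    case False
    then show ?thesis using assms(1) by (simp add: homogeneous_def)
  qed
  then show ?thesis by (simp add: wedge_def)
qed

lemma wedge_cong_right:
  assumes "\<And>Ys. set Ys \<subseteq> set Zs \<Longrightarrow> \<beta> Ys x = \<gamma> Ys x"
  shows "(\<alpha> \<and>\<^sub>d \<beta>) Zs x = (\<alpha> \<and>\<^sub>d \<gamma>) Zs x"
  unfolding wedge_def by (intro sum.cong refl) (simp add: assms set_nths_subset)

lemma vconj_linear:
  "vconj (Z + W) = vconj Z + vconj W" "vconj (cscale c Z) = cscale (cnj c) (vconj Z)"
  "vconj (Z - W) = vconj Z - vconj W" "vconj (vconj Z) = Z"
  by (simp_all add: vconj_def cscale_def fun_eq_iff)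

lemma vconj_sum: "vconj (\<Sum>i\<in>I. f i) = (\<Sum>i\<in>I. vconj (f i))"
  by (simp add: vconj_def fun_eq_iff sum_fun_apply)

locale metric_forms = complex_lie_group_forms +
  fixes E :: "'a vfield set" and g :: "'a metric_tensor"
  assumes E: "cvec.span E = V" "finite E" "cvec.independent E" "card E = DIM('b)"
    and herm: "hermitian_metric G \<Gamma> J g" and inv_g: "invariant_metric G g"
begin

text \<open>By invariance the components of \<open>g\<close> do not depend on the point, so
  \<open>undefined\<close> may serve as base point.\<close>

definition h :: "'a vfield \<Rightarrow> 'a vfield \<Rightarrow> complex" where
  "h Z W = g Z W undefined"

lemma g_eq_h: "Z \<in> V \<Longrightarrow> W \<in> V \<Longrightarrow> g Z W x = h Z W"
proof -
  assume "Z \<in> V" "W \<in> V"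
  moreover obtain a where "x = a \<otimes>\<^bsub>G\<^esub> undefined" using translation_transitive by blast
  moreover have "carrier G = UNIV" using lie_group by (simp add: lie_group_def)
  ultimately show ?thesis using inv_g by (simp add: h_def invariant_metric_def)
qed

lemma
  assumes "Z \<in> V" "W \<in> V"
  shows h_sym: "h Z W = h W Z"
    and h_vconj: "h (vconj Z) (vconj W) = cnj (h Z W)"
    and h_J: "h (J Z) (J W) = h Z W"
    and h_scale: "h (cscale c Z) W = c * h Z W"
    and h_add: "X \<in> V \<Longrightarrow> h (Z + X) W = h Z W + h X W"
  using herm assms unfolding hermitian_metric_def h_def by simp_all

lemma h_pos: "Z \<in> lie_algebra G \<Longrightarrow> Z \<noteq> 0 \<Longrightarrow> Re (h Z Z) > 0"
  using herm by (simp add: hermitian_metric_def h_def)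

lemma h_zero: "W \<in> V \<Longrightarrow> h 0 W = 0"
  using h_scale[of 0 W 0] cvec.subspace_0[OF lie_algebra_C_subspace] by simp

lemma h_sum:
  assumes "W \<in> V" "\<And>i. i \<in> I \<Longrightarrow> f i \<in> V"
  shows "(\<Sum>i\<in>I. f i) \<in> V" "h (\<Sum>i\<in>I. f i) W = (\<Sum>i\<in>I. h (f i) W)"
  using assms(2)
  by (induction I rule: infinite_finite_induct)
    (simp_all add: assms(1) h_add h_zero V_add cvec.subspace_0[OF lie_algebra_C_subspace]
      del: plus_fun_apply zero_fun_apply)

lemma h_diff: "Z \<in> V \<Longrightarrow> X \<in> V \<Longrightarrow> W \<in> V \<Longrightarrow> h (Z - X) W = h Z W - h X W"
  using h_add[of Z W "cscale (-1) X"] h_scale[of X W "-1"] V_scale[of X "-1"] by simp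

lemma h_minus: "Z \<in> V \<Longrightarrow> W \<in> V \<Longrightarrow> h (- Z) W = - h Z W"
  using h_scale[of Z W "-1"] by simp

lemma h_J_swap: "Z \<in> V \<Longrightarrow> W \<in> V \<Longrightarrow> h (J Z) W = - h (J W) Z"
  using h_J[of "J Z" W] h_minus[of Z "J W"] h_sym[of Z "J W"] by (simp add: J_J J_closed)

lemma h_J_self: "Z \<in> V \<Longrightarrow> h (J Z) Z = 0"
  using h_J_swap[of Z Z] by simp

section \<open>Orthonormal bases adapted to the complex structure\<close>

lemma lie_algebra_V: "Z \<in> lie_algebra G \<Longrightarrow> Z \<in> V"
  by (simp add: lie_algebra_def)

lemma J_real: "Z \<in> lie_algebra G \<Longrightarrow> J Z \<in> lie_algebra G"
  by (simp add: lie_algebra_def J_closed flip: J_vconj)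

lemma h_real: "Z \<in> lie_algebra G \<Longrightarrow> W \<in> lie_algebra G \<Longrightarrow> cnj (h Z W) = h Z W"
  using h_vconj[of Z W] by (simp add: lie_algebra_def)

text \<open>Half of an orthonormal basis: its image under \<open>J\<close> is the other half. The
  pairs X, \<open>J X\<close> are what the evaluation of powers of \<omega> needs.\<close>

definition J_orthonormal :: "'a vfield set \<Rightarrow> bool" where
  "J_orthonormal Y \<longleftrightarrow> finite Y \<and> Y \<subseteq> lie_algebra G \<and>
     (\<forall>Z\<in>Y. \<forall>W\<in>Y. h Z W = (if Z = W then 1 else 0) \<and> h (J Z) W = 0)"

lemma orthonormal_independent:
  assumes "B \<subseteq> V" "\<And>Z W. Z \<in> B \<Longrightarrow> W \<in> B \<Longrightarrow> h Z W = (if Z = W then 1 else 0)"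
  shows "cvec.independent B"
  unfolding cvec.dependent_def
proof
  assume "\<exists>a\<in>B. a \<in> cvec.span (B - {a})"
  then obtain a where a: "a \<in> B" "a \<in> cvec.span (B - {a})" by blast
  then have aV: "a \<in> V" using assms(1) by blast
  have "w \<in> V \<and> h w a = 0" if "w \<in> cvec.span (B - {a})" for w
    using that
  proof (induction rule: cvec.span_induct_alt)
    case base
    show ?case using aV h_zero cvec.subspace_0[OF lie_algebra_C_subspace] by blast
  next
    case (step c x y)
    then have x: "x \<in> V" "h x a = 0" using assms a by auto
    with step.IH aV show ?case
      by (metis h_add h_scale V_add V_scale add_0 mult_zero_right)
  qed
  with a assms(2)[OF a(1) a(1)] show False by simp
qed

lemma J_orthonormal_union:
  assumes "J_orthonormal Y"
  shows "finite (Y \<union> J ` Y)" "Y \<union> J ` Y \<subseteq> lie_algebra G" "card (Y \<union> J ` Y) = 2 * card Y"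
    and "\<And>Z W. Z \<in> Y \<union> J ` Y \<Longrightarrow> W \<in> Y \<union> J ` Y \<Longrightarrow> h Z W = (if Z = W then 1 else 0)"
    and "cvec.independent (Y \<union> J ` Y)"
proof -
  have Y: "finite Y" "Y \<subseteq> lie_algebra G" "Y \<subseteq> V"
    and o: "\<And>Z W. Z \<in> Y \<Longrightarrow> W \<in> Y \<Longrightarrow> h Z W = (if Z = W then 1 else 0)"
      "\<And>Z W. Z \<in> Y \<Longrightarrow> W \<in> Y \<Longrightarrow> h (J Z) W = 0"
    using assms lie_algebra_V unfolding J_orthonormal_def by blast+
  show "finite (Y \<union> J ` Y)" using Y by simp
  show sub: "Y \<union> J ` Y \<subseteq> lie_algebra G" using Y J_real by auto
  have oJ: "h (J Z) (J W) = (if Z = W then 1 else 0)" "h Z (J W) = 0" if "Z \<in> Y" "W \<in> Y" for Z W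
  proof -
    have "Z \<in> V" "W \<in> V" "J W \<in> V" using that Y J_closed by auto
    then show "h (J Z) (J W) = (if Z = W then 1 else 0)" "h Z (J W) = 0"
      using o that h_J h_sym by metis+
  qed
  have inj: "inj_on J Y" by (rule inj_onI) (metis o(1) oJ(1) zero_neq_one)
  have disj: "J Z \<noteq> W" if "Z \<in> Y" "W \<in> Y" for Z W
    using o(2)[OF that] o(1)[OF that(2,2)] by auto
  show "card (Y \<union> J ` Y) = 2 * card Y"
    using Y inj disj by (subst card_Un_disjoint) (auto simp: card_image)
  show ortho: "h Z W = (if Z = W then 1 else 0)" if ZW: "Z \<in> Y \<union> J ` Y" "W \<in> Y \<union> J ` Y" for Z W
  proof -
    consider "Z \<in> Y" "W \<in> Y" | X where "X \<in> Y" "Z = J X" "W \<in> Y"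
      | X where "X \<in> Y" "Z \<in> Y" "W = J X" | X X' where "X \<in> Y" "Z = J X" "X' \<in> Y" "W = J X'"
      using ZW by blast
    then show ?thesis
    proof cases
      case 1
      then show ?thesis by (rule o)
    next
      case 2
      then show ?thesis using o(2) disj by simp
    next
      case 3
      then show ?thesis using oJ(2) disj by (metis (full_types))
    next
      case 4
      then show ?thesis using oJ(1) inj by (auto dest: inj_onD)
    qed
  qed
  show "cvec.independent (Y \<union> J ` Y)"
    using sub lie_algebra_V ortho by (intro orthonormal_independent) blast+
qed

text \<open>Gram-Schmidt over the real fields: a field outside the span is made orthogonal to Y and
  to its image under \<open>J\<close>, then normalised.\<close>

lemma J_orthonormal_extend:
  assumes "J_orthonormal Y" "cvec.span (Y \<union> J ` Y) \<noteq> V"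
  shows "\<exists>Y'. J_orthonormal Y' \<and> card Y' > card Y"
proof -
  let ?B = "Y \<union> J ` Y"
  note B = J_orthonormal_union[OF assms(1)]
  have BV: "?B \<subseteq> V" using B(2) lie_algebra_V by blast
  then have "cvec.span ?B \<subseteq> V" using cvec.span_minimal lie_algebra_C_subspace by blast
  then obtain Z where Z: "Z \<in> V" "Z \<notin> cvec.span ?B" using assms(2) by blast
  \<comment> \<open>Twice the real part and minus twice the imaginary part of Z; both are real
    fields, and one of them lies outside the span.\<close>
  let ?X1 = "Z + vconj Z" and ?X2 = "cscale \<i> (Z - vconj Z)"
  have "Z = cscale (1/2) ?X1 + cscale (- \<i>/2) ?X2"
    by (simp add: cscale_def fun_eq_iff field_simps)
  then have "?X1 \<notin> cvec.span ?B \<or> ?X2 \<notin> cvec.span ?B"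
    using Z(2) cvec.span_add cvec.span_scale by metis
  moreover have "?X1 \<in> lie_algebra G"
    unfolding lie_algebra_def mem_Collect_eq vconj_linear
    using Z(1) vconj_closed V_add by (simp add: add.commute del: plus_fun_apply)
  moreover have "vconj ?X2 = ?X2"
    by (simp add: vconj_def cscale_def fun_eq_iff algebra_simps)
  then have "?X2 \<in> lie_algebra G"
    unfolding lie_algebra_def mem_Collect_eq using Z(1) vconj_closed V_diff V_scale by blast
  ultimately obtain X where X: "X \<in> lie_algebra G" "X \<notin> cvec.span ?B" by blast
  define P where "P = (\<Sum>b\<in>?B. cscale (h X b) b)"
  define X' where "X' = X - P"
  have XV: "X \<in> V" using X(1) by (rule lie_algebra_V)
  have PV: "P \<in> V" and hP: "h P b = h X b" if "b \<in> ?B" for b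
  proof -
    have bV: "b \<in> V" using that BV by blast
    have c: "cscale (h X d) d \<in> V" if "d \<in> ?B" for d using that BV V_scale by blast
    show "P \<in> V" unfolding P_def by (rule h_sum(1)[OF bV c])
    have "h P b = (\<Sum>d\<in>?B. h (cscale (h X d) d) b)" unfolding P_def by (rule h_sum(2)[OF bV c])
    also have "\<dots> = (\<Sum>d\<in>?B. if d = b then h X d else 0)"
      using BV bV B(4)[OF _ that] by (intro sum.cong) (auto simp: h_scale)
    also have "\<dots> = h X b" using B(1) that by simp
    finally show "h P b = h X b" .
  qed
  \<comment> \<open>Membership of P was shown in the presence of some b; without one, P is the empty
    sum.\<close>
  have PV: "P \<in> V"
    using PV cvec.subspace_0[OF lie_algebra_C_subspace] by (cases "?B = {}") (auto simp: P_def)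
  have X'V: "X' \<in> V" unfolding X'_def using XV PV by (rule V_diff)
  have "vconj P = P"
    unfolding P_def vconj_sum vconj_linear
  proof (rule sum.cong[OF refl])
    fix b assume "b \<in> ?B"
    then have "b \<in> lie_algebra G" using B(2) by blast
    then show "cscale (cnj (h X b)) (vconj b) = cscale (h X b) b"
      using h_real[OF X(1)] by (simp add: lie_algebra_def)
  qed
  then have X'real: "X' \<in> lie_algebra G"
    using X(1) X'V unfolding lie_algebra_def X'_def by (simp add: vconj_linear)
  have "P \<in> cvec.span ?B"
    unfolding P_def by (intro cvec.span_sum cvec.span_scale cvec.span_base)
  then have "X' \<noteq> 0" using X(2) unfolding X'_def by auto
  define r where "r = Re (h X' X')"
  have r: "r > 0" unfolding r_def using h_pos[OF X'real \<open>X' \<noteq> 0\<close>] .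
  \<comment> \<open>Positivity speaks of the real part only, so the value is first shown to be
    real.\<close>
  have hr: "h X' X' = of_real r"
    using h_real[OF X'real X'real] unfolding r_def by (simp add: complex_eq_iff)
  define N where "N = cscale (of_real (1 / sqrt r)) X'"
  have NV: "N \<in> V" unfolding N_def using X'V by (rule V_scale)
  have Nreal: "N \<in> lie_algebra G"
    using X'real NV by (simp add: N_def lie_algebra_def vconj_linear)
  have hNb: "h N b = 0" if "b \<in> ?B" for b
  proof -
    have "b \<in> V" using that BV by blast
    then show ?thesis
      unfolding N_def X'_def using XV PV V_diff hP[OF that] by (simp add: h_scale h_diff)
  qed
  have hNN: "h N N = 1"
  proof -
    have "h N N = of_real (1 / sqrt r) * (of_real (1 / sqrt r) * h X' X')"
      unfolding N_def using h_scale X'V V_scale h_sym by metis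
    also have "\<dots> = of_real (1 / sqrt r * (1 / sqrt r) * r)"
      by (simp only: hr of_real_mult mult.assoc)
    also have "1 / sqrt r * (1 / sqrt r) * r = 1" using r by (simp add: field_simps)
    finally show ?thesis by simp
  qed
  have "N \<notin> Y" using hNb[of N] hNN by auto
  have Y: "finite Y" "Y \<subseteq> lie_algebra G" "Y \<subseteq> V"
    "\<forall>Z\<in>Y. \<forall>W\<in>Y. h Z W = (if Z = W then 1 else 0) \<and> h (J Z) W = 0"
    using assms(1) lie_algebra_V unfolding J_orthonormal_def by blast+
  have cross: "h N b = 0" "h b N = 0" "h (J N) b = 0" "h (J b) N = 0" if "b \<in> Y" for b
  proof -
    have bV: "b \<in> V" "J b \<in> V" using that Y J_closed by blast+
    show 1: "h N b = 0" using hNb that by blast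
    then show "h b N = 0" using h_sym[OF NV bV(1)] by simp
    have "h N (J b) = 0" using hNb that by blast
    then show 2: "h (J b) N = 0" using h_sym[OF NV bV(2)] by simp
    \<comment> \<open>Orthogonality of N to the images under \<open>J\<close> is used here:
      \<open>J\<close> is skew for \<open>h\<close>.\<close>
    then show "h (J N) b = 0" using h_J_swap[OF NV bV(1)] by simp
  qed
  have "J_orthonormal (insert N Y)"
    unfolding J_orthonormal_def
    using Y Nreal hNN h_J_self[OF NV] cross \<open>N \<notin> Y\<close> by auto
  moreover have "card (insert N Y) > card Y" using Y(1) \<open>N \<notin> Y\<close> by simp
  ultimately show ?thesis by blast
qed

text \<open>A J-orthonormal set of largest cardinality exists, since independence bounds it by
  \<open>E\<close>; by maximality it spans. Comparison with \<open>E\<close> gives the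
  count.\<close>

lemma J_orthonormal_basis:
  obtains Y where "J_orthonormal Y" "cvec.span (Y \<union> J ` Y) = V" "2 * card Y = DIM('b)"
proof -
  have bound: "2 * card Y \<le> card E" if "J_orthonormal Y" for Y
  proof -
    have "Y \<union> J ` Y \<subseteq> cvec.span E"
      using J_orthonormal_union(2)[OF that] lie_algebra_V E(1) by blast
    then show ?thesis
      using cvec.independent_span_bound[OF E(2) J_orthonormal_union(5)[OF that]]
        J_orthonormal_union(3)[OF that] by simp
  qed
  have "J_orthonormal {}" by (simp add: J_orthonormal_def)
  moreover have "\<forall>Y. J_orthonormal Y \<longrightarrow> card Y < Suc (card E)" using bound by fastforce
  ultimately obtain Y where Y: "J_orthonormal Y" "\<forall>Y'. J_orthonormal Y' \<longrightarrow> card Y' \<le> card Y"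
    using ex_has_greatest_nat[of J_orthonormal "{}" card "Suc (card E)"] by blast
  have span: "cvec.span (Y \<union> J ` Y) = V"
  proof (rule ccontr)
    assume "cvec.span (Y \<union> J ` Y) \<noteq> V"
    from J_orthonormal_extend[OF Y(1) this] Y(2) show False using leD by blast
  qed
  have "E \<subseteq> cvec.span (Y \<union> J ` Y)" using cvec.span_superset[of E] E(1) span by simp
  from cvec.independent_span_bound[OF J_orthonormal_union(1)[OF Y(1)] E(3) this]
  have "2 * card Y = DIM('b)"
    using bound[OF Y(1)] J_orthonormal_union(3)[OF Y(1)] E(4) by simp
  with Y(1) span show ?thesis by (rule that)
qed

definition basis :: "'a vfield set" where
  "basis = (SOME B. orthonormal_basis_at G g undefined B)"

text \<open>The choice in \<open>form_inner\<close> is made anew at each point. The predicate does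
  not depend on the point, so the same \<open>basis\<close> is chosen everywhere.\<close>

lemma orthonormal_basis_at_const:
  "orthonormal_basis_at G g x B \<longleftrightarrow> orthonormal_basis_at G g undefined B"
proof -
  have "(\<forall>Z\<in>B. \<forall>W\<in>B. g Z W x = (if Z = W then 1 else 0)) \<longleftrightarrow>
      (\<forall>Z\<in>B. \<forall>W\<in>B. g Z W undefined = (if Z = W then 1 else 0))" if "B \<subseteq> lie_algebra G"
  proof -
    have "g Z W x = g Z W undefined" if "Z \<in> B" "W \<in> B" for Z W
    proof -
      have "Z \<in> V" "W \<in> V" using that \<open>B \<subseteq> lie_algebra G\<close> lie_algebra_V by blast+
      then show ?thesis by (simp only: g_eq_h)
    qed
    then show ?thesis by simp
  qed
  then show ?thesis unfolding orthonormal_basis_at_def by blast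
qed

lemma basis: "finite basis" "basis \<subseteq> V" "cvec.span basis = V"
proof -
  obtain Y where Y: "J_orthonormal Y" "cvec.span (Y \<union> J ` Y) = V" by (rule J_orthonormal_basis)
  have "orthonormal_basis_at G g undefined (Y \<union> J ` Y)"
    unfolding orthonormal_basis_at_def h_def[symmetric]
    using J_orthonormal_union[OF Y(1)] Y(2) by blast
  then have "orthonormal_basis_at G g undefined basis" unfolding basis_def by (rule someI)
  then show "finite basis" "basis \<subseteq> V" "cvec.span basis = V"
    unfolding orthonormal_basis_at_def using lie_algebra_V by blast+
qed

lemma form_inner_eq:
  "form_inner G g r \<alpha> \<beta> x =
    (\<Sum>Zs | length Zs = r \<and> set Zs \<subseteq> basis. \<alpha> Zs x * cnj (\<beta> Zs x)) / fact r"
proof -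
  have "orthonormal_basis_at G g x = orthonormal_basis_at G g undefined"
    by (rule ext) (rule orthonormal_basis_at_const)
  then show ?thesis by (simp only: form_inner_def basis_def Let_def)
qed

section \<open>The fundamental form, its powers and the volume form\<close>

abbreviation "\<omega> \<equiv> fundamental_form G J g"

lemma fundamental_form_simps:
  "Z \<in> V \<Longrightarrow> W \<in> V \<Longrightarrow> \<omega> [Z, W] x = h (J Z) W"
  "Z \<notin> V \<or> W \<notin> V \<Longrightarrow> \<omega> [Z, W] = 0"
  by (auto simp: fundamental_form_def J_closed g_eq_h)

lemma fundamental_form_homogeneous: "homogeneous 2 \<omega>"
  unfolding homogeneous_def fundamental_form_def
  by (auto split: list.splits)

lemma fundamental_form_invariant: "\<omega> \<in> invariant_dforms 2"
proof -
  have two: "(\<exists>Z W. Zs = [Z, W]) \<or> \<omega> Zs = 0" for Zs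
    unfolding fundamental_form_def by (auto split: list.splits)
  have len: "\<omega> Zs x = 0" if "length Zs \<noteq> 2" for Zs x
    using fundamental_form_homogeneous that by (simp add: homogeneous_def)
  \<comment> \<open>Only the first and the second slot of a list of length two matter; elsewhere
    \<omega> vanishes by degree.\<close>
  have slot: "Xs = [] \<and> (\<exists>Y. Ys = [Y]) \<or> (\<exists>X. Xs = [X]) \<and> Ys = [] \<or> length (Xs @ Z # Ys) \<noteq> 2"
    for Xs Ys and Z :: "'a vfield"
    by (cases Xs; cases Ys) (auto simp: numeral_2_eq_2)
  have "alternating V \<omega>"
  proof (rule alternatingI)
    fix Xs Z Ys assume "Z \<notin> V"
    then show "\<omega> (Xs @ Z # Ys) = 0"
      using slot[of Xs Ys Z] len[of "Xs @ Z # Ys"] fundamental_form_simps(2)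
      by (auto simp: fun_eq_iff)
  next
    fix Xs Ys Z W assume ZW: "Z \<in> V" "W \<in> V"
    show "\<omega> (Xs @ (Z + W) # Ys) = \<omega> (Xs @ Z # Ys) + \<omega> (Xs @ W # Ys)"
    proof
      fix x
      have "\<omega> [Z + W, Y] x = \<omega> [Z, Y] x + \<omega> [W, Y] x" "\<omega> [Y, Z + W] x = \<omega> [Y, Z] x + \<omega> [Y, W] x" for Y
      proof -
        have s: "h X (Z + W) = h X Z + h X W" if "X \<in> V" for X
          using h_sym h_add ZW V_add that by metis
        show "\<omega> [Z + W, Y] x = \<omega> [Z, Y] x + \<omega> [W, Y] x" "\<omega> [Y, Z + W] x = \<omega> [Y, Z] x + \<omega> [Y, W] x"
          by (cases "Y \<in> V"; simp add: fundamental_form_simps ZW V_add J_add h_add J_closed s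
              del: plus_fun_apply; fail)+
      qed
      then have "\<omega> (Xs @ (Z + W) # Ys) x = \<omega> (Xs @ Z # Ys) x + \<omega> (Xs @ W # Ys) x"
        using slot[of Xs Ys Z] len[of "Xs @ (Z + W) # Ys"] len[of "Xs @ Z # Ys"] len[of "Xs @ W # Ys"]
        by (elim disjE conjE exE) (simp_all del: plus_fun_apply)
      then show "\<omega> (Xs @ (Z + W) # Ys) x = (\<omega> (Xs @ Z # Ys) + \<omega> (Xs @ W # Ys)) x"
        by (simp only: plus_fun_apply)
    qed
  next
    fix Xs Ys c Z assume Z: "Z \<in> V"
    show "\<omega> (Xs @ cscale c Z # Ys) = (\<lambda>x. c * \<omega> (Xs @ Z # Ys) x)"
    proof
      fix x
      have "\<omega> [cscale c Z, Y] x = c * \<omega> [Z, Y] x" "\<omega> [Y, cscale c Z] x = c * \<omega> [Y, Z] x" for Y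
      proof -
        have s: "h X (cscale c Z) = c * h X Z" if "X \<in> V" for X
          using h_sym h_scale Z V_scale that by metis
        show "\<omega> [cscale c Z, Y] x = c * \<omega> [Z, Y] x" "\<omega> [Y, cscale c Z] x = c * \<omega> [Y, Z] x"
          by (cases "Y \<in> V"; simp add: fundamental_form_simps Z V_scale J_scale h_scale J_closed s; fail)+
      qed
      then show "\<omega> (Xs @ cscale c Z # Ys) x = c * \<omega> (Xs @ Z # Ys) x"
        using slot[of Xs Ys Z] len[of "Xs @ cscale c Z # Ys"] len[of "Xs @ Z # Ys"]
        by (elim disjE conjE exE) simp_all
    qed
  next
    fix Xs Ys Z W
    show "\<omega> (Xs @ Z # W # Ys) = (\<lambda>x. - \<omega> (Xs @ W # Z # Ys) x)"
    proof
      fix x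
      have "\<omega> [Z, W] x = - \<omega> [W, Z] x"
        by (cases "Z \<in> V \<and> W \<in> V") (auto simp: fundamental_form_simps h_J_swap[of Z W])
      then show "\<omega> (Xs @ Z # W # Ys) x = - \<omega> (Xs @ W # Z # Ys) x"
        using len[of "Xs @ Z # W # Ys"] len[of "Xs @ W # Z # Ys"]
        by (cases "Xs = [] \<and> Ys = []") auto
    qed
  qed
  moreover have "constant_form \<omega>"
    unfolding constant_form_def
  proof (intro allI)
    fix Zs x y
    show "\<omega> Zs x = \<omega> Zs y"
      using two[of Zs]
    proof (elim disjE exE)
      fix Z W assume "Zs = [Z, W]"
      then show ?thesis
        by (cases "Z \<in> V \<and> W \<in> V") (auto simp: fundamental_form_simps)
    qed simp
  qed
  ultimately show ?thesis
    using fundamental_form_homogeneous by (simp add: invariant_dforms_def)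
qed

definition omega_power :: "nat \<Rightarrow> 'a dform" where
  "omega_power m = ((\<lambda>\<beta>. \<omega> \<and>\<^sub>d \<beta>) ^^ m) one_form"

lemma omega_power_simps: "omega_power 0 = one_form" "omega_power (Suc m) = \<omega> \<and>\<^sub>d omega_power m"
  by (simp_all add: omega_power_def)

lemma omega_power_invariant: "omega_power m \<in> invariant_dforms (2 * m)"
proof (induction m)
  case 0
  have "alternating V one_form"
    by (rule alternatingI) (auto simp: one_form_def fun_eq_iff)
  then show ?case
    by (auto simp: omega_power_simps invariant_dforms_def homogeneous_def constant_form_def
        one_form_def fun_eq_iff)
next
  case (Suc m)
  then show ?case
    using invariant_dforms_wedge[OF fundamental_form_invariant Suc] by (simp add: omega_power_simps)
qed

text \<open>Of the four terms of the double contraction, two contain \<open>contr X \<omega>\<close>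
  or \<open>contr (J X) \<omega>\<close> as a factor; these receive an argument from L and vanish.
  The scalar \<omega>(X, J X) = 1 gives one copy of the lower power, and the term in which both
  contractions hit the power gives the rest.\<close>

lemma omega_power_contr:
  assumes "X \<in> V" "h X X = 1"
    and "\<And>W. W \<in> set L \<Longrightarrow> \<omega> [X, W] x = 0 \<and> \<omega> [J X, W] x = 0"
  shows "contr (J X) (contr X (omega_power m)) L x = of_nat m * omega_power (m - 1) L x"
  using assms(3)
proof (induction m arbitrary: L)
  case 0
  then show ?case by (simp add: omega_power_simps contr_def one_form_def)
next
  case (Suc m)
  let ?t = "omega_power m"
  note hom = fundamental_form_homogeneous
  have hom1: "homogeneous 1 (contr Z \<omega>)" for Z
    using homogeneous_contr[of 1 \<omega> Z] hom by (simp add: numeral_2_eq_2)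
  have p: "parity \<omega> = \<omega>" "parity (contr X \<omega>) = - contr X \<omega>"
    using parity_homogeneous[OF hom] parity_homogeneous[OF hom1[of X]] by simp_all
  have expand: "contr (J X) (contr X (\<omega> \<and>\<^sub>d ?t)) =
      (contr (J X) (contr X \<omega>) \<and>\<^sub>d ?t + - (contr X \<omega> \<and>\<^sub>d contr (J X) ?t)) +
      (contr (J X) \<omega> \<and>\<^sub>d contr X ?t + \<omega> \<and>\<^sub>d contr (J X) (contr X ?t))"
    by (simp only: contr_wedge contr_add p wedge_minus_left)
  have v: "(contr X \<omega> \<and>\<^sub>d \<beta>) L x = 0" "(contr (J X) \<omega> \<and>\<^sub>d \<beta>) L x = 0" for \<beta>
    by (rule wedge_1_vanish[OF hom1]; simp add: contr_def Suc.prems)+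
  have "homogeneous 0 (contr (J X) (contr X \<omega>))"
    by (rule homogeneous_contr[OF hom1[unfolded One_nat_def]])
  then have "(contr (J X) (contr X \<omega>) \<and>\<^sub>d ?t) L x = \<omega> [X, J X] x * ?t L x"
    by (subst wedge_homogeneous_0) (auto simp: contr_def)
  also have "\<omega> [X, J X] x = 1"
    using assms(1,2) by (simp add: fundamental_form_simps J_closed h_J)
  finally have 1: "(contr (J X) (contr X \<omega>) \<and>\<^sub>d ?t) L x = ?t L x" by simp
  have "(\<omega> \<and>\<^sub>d contr (J X) (contr X ?t)) L x = (\<omega> \<and>\<^sub>d cscale (of_nat m) (omega_power (m - 1))) L x"
    using Suc by (intro wedge_cong_right) (auto simp: cscale_def)
  also have "\<dots> = of_nat m * (\<omega> \<and>\<^sub>d omega_power (m - 1)) L x"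
    unfolding wedge_scale_right by (simp add: cscale_def)
  \<comment> \<open>For m = 0 the truncated index m - 1 does no harm, the factor being 0.\<close>
  also have "\<dots> = of_nat m * ?t L x"
    by (cases m) (simp_all add: omega_power_simps)
  finally have 2: "(\<omega> \<and>\<^sub>d contr (J X) (contr X ?t)) L x = of_nat m * ?t L x" .
  show ?case
    unfolding omega_power_simps expand plus_fun_apply uminus_apply v 1 2
    by (simp add: algebra_simps)
qed

text \<open>Each orthonormal pair splits off by \<open>omega_power_contr\<close> and contributes the
  current exponent as a factor.\<close>

lemma omega_power_J_orthonormal:
  assumes "J_orthonormal Y" "set Xs \<subseteq> Y" "distinct Xs"
  shows "omega_power (length Xs) (concat (map (\<lambda>X. [X, J X]) Xs)) x = fact (length Xs)"
  using assms(2,3)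
proof (induction Xs)
  case Nil
  then show ?case by (simp add: omega_power_simps one_form_def)
next
  case (Cons X Xs)
  have Y: "Y \<subseteq> V" "\<And>Z W. Z \<in> Y \<Longrightarrow> W \<in> Y \<Longrightarrow> h Z W = (if Z = W then 1 else 0)"
    "\<And>Z W. Z \<in> Y \<Longrightarrow> W \<in> Y \<Longrightarrow> h (J Z) W = 0"
    using assms(1) lie_algebra_V unfolding J_orthonormal_def by blast+
  let ?L = "concat (map (\<lambda>X. [X, J X]) Xs)"
  have X: "X \<in> V" "h X X = 1" using Cons.prems Y by auto
  have "\<omega> [X, W] x = 0 \<and> \<omega> [J X, W] x = 0" if W: "W \<in> set ?L" for W
  proof -
    obtain Z where Z: "Z \<in> Y" "Z \<noteq> X" "W = Z \<or> W = J Z"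
      using W Cons.prems by auto
    have V: "Z \<in> V" "J Z \<in> V" "J X \<in> V" using Z Y X J_closed by auto
    have "h (J X) Z = 0" "h X Z = 0" "h (J Z) X = 0" "h X (J Z) = 0"
      using Y(2,3) Z Cons.prems h_sym[OF X(1) V(2)] by auto
    then show ?thesis
      using Z(3) V X by (auto simp: fundamental_form_simps h_J J_J h_minus)
  qed
  then have "contr (J X) (contr X (omega_power (Suc (length Xs)))) ?L x =
      of_nat (Suc (length Xs)) * omega_power (Suc (length Xs) - 1) ?L x"
    by (rule omega_power_contr[OF X])
  then show ?case using Cons by (simp add: contr_def)
qed

abbreviation "vol \<equiv> volume_form G J g"

lemma volume_form_eq: "vol = cscale (1 / fact (DIM('b) div 2)) (omega_power (DIM('b) div 2))"
  by (simp add: volume_form_def omega_power_def Let_def)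

lemma volume_form_invariant: "vol \<in> invariant_dforms DIM('b)"
proof -
  obtain Y where "J_orthonormal Y" "cvec.span (Y \<union> J ` Y) = V" "2 * card Y = DIM('b)"
    by (rule J_orthonormal_basis)
  \<comment> \<open>The adapted basis shows that the dimension is even, so \<open>div\<close> loses
    nothing.\<close>
  then have "2 * (DIM('b) div 2) = DIM('b)" by presburger
  then show ?thesis
    unfolding volume_form_eq using invariant_dforms_scale[OF omega_power_invariant] by metis
qed

text \<open>A list on which the volume form is 1 allows it to be cancelled, both for uniqueness of
  the star and for reading off inner products.\<close>

lemma volume_form_nonzero: obtains Zs where "\<And>x. vol Zs x = 1"
proof -
  obtain Y where Y: "J_orthonormal Y" "cvec.span (Y \<union> J ` Y) = V" "2 * card Y = DIM('b)"
    by (rule J_orthonormal_basis)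
  from Y(1) have "finite Y" by (simp add: J_orthonormal_def)
  then obtain Xs where Xs: "set Xs = Y" "distinct Xs" using finite_distinct_list by blast
  then have "length Xs = DIM('b) div 2" using distinct_card[of Xs] Y(3) by simp
  then have "vol (concat (map (\<lambda>X. [X, J X]) Xs)) x = 1" for x
    unfolding volume_form_eq cscale_def
    using omega_power_J_orthonormal[OF Y(1) _ Xs(2), of x] Xs(1) by simp
  then show ?thesis by (rule that)
qed

text \<open>Existence: by \<open>wedge_contr_list\<close>, contracting the volume form along lists
  from the orthonormal basis, weighted by the conjugate values of \<beta>, reproduces
  \<open>form_inner\<close>. Uniqueness: wedging with \<open>contr_list Ys vol\<close> recovers the
  value at Ys. Competitors in the description may have nonconstant components, whereas the solution
  is invariant.\<close>

lemma hodge_star: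
  assumes \<beta>: "\<beta> \<in> invariant_dforms r" and r: "r \<le> DIM('b)"
  shows "hodge_star G \<Gamma> J g r \<beta> \<in> invariant_dforms (DIM('b) - r)"
    and "\<And>\<alpha> Zs x. \<alpha> \<in> dforms G \<Gamma> r \<Longrightarrow>
      (\<alpha> \<and>\<^sub>d hodge_star G \<Gamma> J g r \<beta>) Zs x = form_inner G g r \<alpha> \<beta> x * vol Zs x"
proof -
  note vol = invariant_dformsD[OF volume_form_invariant]
  let ?L = "{Zs. length Zs = r \<and> set Zs \<subseteq> basis}"
  let ?P = "\<lambda>\<gamma>. \<gamma> \<in> dforms G \<Gamma> (DIM('b) - r) \<and> (\<forall>\<alpha>\<in>dforms G \<Gamma> r. \<alpha> \<and>\<^sub>d \<gamma> =
             (\<lambda>Zs x. form_inner G g r \<alpha> \<beta> x * vol Zs x))"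
  have card_E: "card E \<le> DIM('b)" using E(4) by simp
  note wedge_list = wedge_contr_list[OF E(1,2) card_E vol(1,2)]
  define \<gamma> where "\<gamma> = (\<Sum>Zs\<in>?L. cscale (cnj (\<beta> Zs undefined) / fact r) (contr_list Zs vol))"
  have \<gamma>: "\<gamma> \<in> invariant_dforms (DIM('b) - r)"
    unfolding \<gamma>_def
  proof (intro cvec.subspace_sum[OF invariant_dforms_subspace] invariant_dforms_scale)
    fix Zs assume "Zs \<in> ?L"
    then show "contr_list Zs vol \<in> invariant_dforms (DIM('b) - r)"
      using invariant_dforms_contr_list[OF volume_form_invariant, of Zs] by simp
  qed
  have \<beta>_const: "\<beta> Zs x = \<beta> Zs undefined" for Zs x
    using invariant_dformsD(3)[OF \<beta>] unfolding constant_form_def by blast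
  have eq: "(\<alpha> \<and>\<^sub>d \<gamma>) Ys x = form_inner G g r \<alpha> \<beta> x * vol Ys x" if "\<alpha> \<in> dforms G \<Gamma> r" for \<alpha> Ys x
  proof -
    have "(\<alpha> \<and>\<^sub>d \<gamma>) Ys x =
        (\<Sum>Zs\<in>?L. cnj (\<beta> Zs undefined) / fact r * (\<alpha> \<and>\<^sub>d contr_list Zs vol) Ys x)"
      unfolding \<gamma>_def wedge_sum_right wedge_scale_right sum_fun_apply by (simp add: cscale_def)
    also have "\<dots> = (\<Sum>Zs\<in>?L. cnj (\<beta> Zs undefined) / fact r * (\<alpha> Zs x * vol Ys x))"
      by (rule sum.cong[OF refl]) (use dformsD[OF that] in \<open>simp add: wedge_list\<close>)
    also have "\<dots> = form_inner G g r \<alpha> \<beta> x * vol Ys x"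
      unfolding form_inner_eq \<beta>_const[of _ x] sum_distrib_right sum_divide_distrib
      by (rule sum.cong) (auto simp: field_simps)
    finally show ?thesis .
  qed
  have "?P \<gamma>"
    using \<gamma> eq by (auto simp: invariant_dforms_iff fun_eq_iff)
  moreover have "\<gamma>' = \<gamma>" if "?P \<gamma>'" for \<gamma>'
  proof -
    obtain Ws where Ws: "\<And>x. vol Ws x = 1" by (rule volume_form_nonzero) blast
    have \<gamma>': "\<gamma>' \<in> dforms G \<Gamma> (DIM('b) - r)" using that by blast
    define \<delta> where "\<delta> = \<gamma>' + cscale (-1) \<gamma>"
    have \<delta>: "alternating V \<delta>" "homogeneous (DIM('b) - r) \<delta>"
      unfolding \<delta>_def
      by (rule alternating_add[OF dformsD(1)[OF \<gamma>'] alternating_scale[OF invariant_dformsD(1)[OF \<gamma>]]])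
        (rule homogeneous_add[OF dformsD(2)[OF \<gamma>'] homogeneous_scale[OF invariant_dformsD(2)[OF \<gamma>]]])
    have "\<delta> Ys x = 0" for Ys x
    proof (cases "length Ys = DIM('b) - r")
      case True
      let ?\<alpha> = "contr_list Ys vol"
      have \<alpha>: "?\<alpha> \<in> invariant_dforms r"
        using invariant_dforms_contr_list[OF volume_form_invariant, of Ys] True r by simp
      then have "?\<alpha> \<and>\<^sub>d \<gamma>' = ?\<alpha> \<and>\<^sub>d \<gamma>"
        using that \<open>?P \<gamma>\<close> by (metis (no_types, lifting) invariant_dforms_iff)
      then have "?\<alpha> \<and>\<^sub>d \<delta> = 0"
        unfolding \<delta>_def wedge_add_right wedge_scale_right by simp
      moreover have "(\<delta> \<and>\<^sub>d ?\<alpha>) Ws x = ((parity ^^ (DIM('b) - r)) ?\<alpha> \<and>\<^sub>d \<delta>) Ws x"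
        using wedge_commute[OF \<delta>(2)] by simp
      \<comment> \<open>Only proportionality matters, as the product with \<delta> is zero for any
        factor.\<close>
      moreover have "\<exists>c. (parity ^^ m) ?\<alpha> = cscale c ?\<alpha>" for m
      proof (induction m)
        case 0
        show ?case by (rule exI[of _ 1]) (simp add: cscale_def)
      next
        case (Suc m)
        then obtain c where "(parity ^^ m) ?\<alpha> = cscale c ?\<alpha>" by blast
        then have "(parity ^^ Suc m) ?\<alpha> = cscale (c * (-1) ^ r) ?\<alpha>"
          using parity_homogeneous[OF invariant_dformsD(2)[OF \<alpha>]] by (simp add: parity_scale)
        then show ?case by blast
      qed
      ultimately have "(\<delta> \<and>\<^sub>d ?\<alpha>) Ws x = 0"
        by (metis wedge_scale_left cvec.scale_zero_right zero_fun_apply)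
      then show ?thesis using wedge_list[OF \<delta> True] Ws by simp
    next
      case False
      then show ?thesis using \<delta>(2) by (simp add: homogeneous_def)
    qed
    then show ?thesis by (simp add: \<delta>_def fun_eq_iff)
  qed
  ultimately have "(THE \<gamma>. ?P \<gamma>) = \<gamma>" by (intro the_equality) blast+
  then have "hodge_star G \<Gamma> J g r \<beta> = \<gamma>"
    using r unfolding hodge_star_def by simp
  then show "hodge_star G \<Gamma> J g r \<beta> \<in> invariant_dforms (DIM('b) - r)"
    and "\<And>\<alpha> Zs x. \<alpha> \<in> dforms G \<Gamma> r \<Longrightarrow>
      (\<alpha> \<and>\<^sub>d hodge_star G \<Gamma> J g r \<beta>) Zs x = form_inner G g r \<alpha> \<beta> x * vol Zs x"
    using \<gamma> eq by simp_all
qed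

end

section \<open>Harmonic forms\<close>

locale special_metric =
  special_structure G \<Gamma> J u v A B A' B' + metric_forms G \<Gamma> J E g
  for G :: "('a::{t2_space, second_countable_topology}, 'b::euclidean_space) lgroup"
    and \<Gamma> J u v A B A' B' E g +
  assumes uv: "u \<in> E" "v \<in> E" and dim_ge_2: "2 \<le> DIM('b)"
begin

lemma D_Leibniz:
  "D1 (\<alpha> \<and>\<^sub>d \<beta>) = D1 \<alpha> \<and>\<^sub>d \<beta> + parity \<alpha> \<and>\<^sub>d D1 \<beta>"
  "D2 (\<alpha> \<and>\<^sub>d \<beta>) = D2 \<alpha> \<and>\<^sub>d \<beta> + parity \<alpha> \<and>\<^sub>d D2 \<beta>"
  unfolding D1_def D2_def wedge_add_left wedge_add_right
    wedge_contr_Leibniz[OF invariant_dformsD(2)[OF forms(1)]]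
    wedge_contr_Leibniz[OF invariant_dformsD(2)[OF forms(2)]]
    wedge_contr_Leibniz[OF invariant_dformsD(2)[OF forms(3)]]
    wedge_contr_Leibniz[OF invariant_dformsD(2)[OF forms(4)]]
  by (simp_all only: ac_simps)

text \<open>Each of the four summands vanishes separately; this is where \<open>u\<close> and
  \<open>v\<close> must belong to the frame \<open>E\<close>.\<close>

lemma D_Stokes:
  assumes "\<tau> \<in> invariant_dforms (DIM('b) - 1)"
  shows "D1 \<tau> = 0" "D2 \<tau> = 0"
proof -
  note d = invariant_dformsD[OF assms] and f = forms[THEN invariant_dformsD(1)] forms[THEN invariant_dformsD(2)]
  have c: "card E \<le> DIM('b)" using E(4) by simp
  note Stokes = wedge_contr_Stokes[OF E(1,2) c dim_ge_2 _ _ _ _ d(1,2)]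
  have "A \<and>\<^sub>d contr u \<tau> = 0" "B \<and>\<^sub>d contr u \<tau> = 0" "A' \<and>\<^sub>d contr v \<tau> = 0" "B' \<and>\<^sub>d contr v \<tau> = 0"
    by (rule Stokes; fact f contr_u contr_v uv)+
  then show "D1 \<tau> = 0" "D2 \<tau> = 0" unfolding D1_def D2_def by (simp_all only: add_0_left)
qed

text \<open>Since \<open>u\<close> and \<open>v\<close> annihilate the four structure forms and a
  repeated contraction is zero, only the scalar \<omega>(u, v) survives a double application. Even
  forms commute, which yields the anticommutation on \<omega>.\<close>

lemma D_omega:
  obtains c where "D1 (D2 \<omega>) = cscale c (A \<and>\<^sub>d A') + cscale (- c) (B' \<and>\<^sub>d B)"
    and "D2 (D1 \<omega>) = cscale (-1) (D1 (D2 \<omega>))"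
proof -
  define s where "s = contr v (contr u \<omega>)"
  have alt: "alternating V \<omega>" and hom: "homogeneous 2 \<omega>"
    using invariant_dformsD[OF fundamental_form_invariant] by blast+
  note par = forms[THEN invariant_dformsD(2), THEN parity_homogeneous, simplified]
  have cc: "contr u (contr u \<omega>) = 0" "contr v (contr v \<omega>) = 0"
    "contr u (contr v \<omega>) = cscale (-1) s"
    unfolding s_def
    by (rule alternating_contr_twice[OF alt] alternating_contr_swap[OF alt])+
  have s_hom: "homogeneous 0 s"
    unfolding s_def using hom homogeneous_contr by (metis numeral_2_eq_2)
  have s_const: "s Zs x = s Zs y" for Zs x y
    using invariant_dformsD(3)[OF fundamental_form_invariant]
    unfolding s_def contr_def constant_form_def by blast
  define c where "c = s [] undefined"
  \<comment> \<open>A form of degree 0 with constant value acts by scalar multiplication.\<close>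
  have ws: "X \<and>\<^sub>d s = cscale c X" if "homogeneous 2 X" for X
  proof (intro ext)
    fix Zs x
    show "(X \<and>\<^sub>d s) Zs x = cscale c X Zs x"
      unfolding wedge_commute_2[OF that] wedge_homogeneous_0[OF s_hom] cscale_def c_def
      using s_const[of "[]" x undefined] by simp
  qed
  note w = forms[THEN invariant_dformsD(2), THEN ws]
  have "contr u (D2 \<omega>) = cscale (- c) A'" "contr v (D2 \<omega>) = cscale c B"
    "contr u (D1 \<omega>) = cscale (- c) B'" "contr v (D1 \<omega>) = cscale c A"
    unfolding D1_def D2_def contr_add contr_wedge contr_u contr_v wedge_zero_left cc par
      wedge_scale_right wedge_zero_right s_def[symmetric] w
    by (simp_all add: cscale_def fun_eq_iff)
  then have DD: "D1 (D2 \<omega>) = cscale (- c) (A \<and>\<^sub>d A') + cscale c (B' \<and>\<^sub>d B)"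
    "D2 (D1 \<omega>) = cscale (- c) (B \<and>\<^sub>d B') + cscale c (A' \<and>\<^sub>d A)"
    by (simp_all only: D1_def[of "D2 \<omega>"] D2_def[of "D1 \<omega>"] wedge_scale_right)
  have "B \<and>\<^sub>d B' = B' \<and>\<^sub>d B" "A' \<and>\<^sub>d A = A \<and>\<^sub>d A'"
    using forms[THEN invariant_dformsD(2), THEN wedge_commute_2] by blast+
  then have "D2 (D1 \<omega>) = cscale (-1) (D1 (D2 \<omega>))"
    unfolding DD by (simp add: cscale_def fun_eq_iff)
  with that[of "- c"] DD(1) show ?thesis by simp
qed

text \<open>Two integrations by parts, through \<open>\<omega> \<and>\<^sub>d D2 \<gamma>\<close>
  and \<open>D1 \<omega> \<and>\<^sub>d \<gamma>\<close>, both of degree one below the top. They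
  produce the operators on \<omega> in the opposite order, whence the anticommutation from
  \<open>D_omega\<close>.\<close>

lemma wedge_D_omega_zero:
  assumes \<gamma>: "\<gamma> \<in> invariant_dforms (DIM('b) - 4)" "4 \<le> DIM('b)" "D1 (D2 \<gamma>) = 0"
  shows "D1 (D2 \<omega>) \<and>\<^sub>d \<gamma> = 0"
proof -
  note \<omega> = fundamental_form_invariant
  have p: "parity \<omega> = \<omega>" "parity (D1 \<omega>) = cscale (-1) (D1 \<omega>)"
    using parity_homogeneous[OF invariant_dformsD(2)[OF \<omega>]]
      parity_homogeneous[OF invariant_dformsD(2)[OF D1_invariant[OF \<omega>]]] by simp_all
  have "2 + Suc (DIM('b) - 4) = DIM('b) - 1" "Suc 2 + (DIM('b) - 4) = DIM('b) - 1"
    using \<gamma>(2) by simp_all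
  then have i: "\<omega> \<and>\<^sub>d D2 \<gamma> \<in> invariant_dforms (DIM('b) - 1)"
    "D1 \<omega> \<and>\<^sub>d \<gamma> \<in> invariant_dforms (DIM('b) - 1)"
    using invariant_dforms_wedge[OF \<omega> D2_invariant[OF \<gamma>(1)]]
      invariant_dforms_wedge[OF D1_invariant[OF \<omega>] \<gamma>(1)] by simp_all
  have 1: "D1 \<omega> \<and>\<^sub>d D2 \<gamma> = 0"
    using D_Stokes(1)[OF i(1)]
    by (simp only: D_Leibniz p \<gamma>(3) wedge_zero_right add_0_right)
  have 2: "D2 (D1 \<omega>) \<and>\<^sub>d \<gamma> = 0"
    using D_Stokes(2)[OF i(2)]
    by (simp only: D_Leibniz p wedge_scale_left 1 cvec.scale_zero_right add_0_right)
  obtain c where "D2 (D1 \<omega>) = cscale (-1) (D1 (D2 \<omega>))" by (rule D_omega)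
  with 2 have "cscale (-1) (D1 (D2 \<omega>) \<and>\<^sub>d \<gamma>) = 0" by (simp only: wedge_scale_left)
  then show ?thesis by simp
qed

text \<open>The star of a 1-form has degree one below the top, where \<open>delbar\<close> is zero
  by \<open>D_Stokes\<close>.\<close>

lemma closed_1_form_harmonic:
  assumes "\<alpha> \<in> pq_forms G \<Gamma> J p q" "p + q = 1" "invariant_form G \<alpha>" "ext_d G \<alpha> = 0"
  shows "\<alpha> \<in> bott_chern_harmonic G \<Gamma> J g p q"
proof -
  have "\<alpha> \<in> invariant_dforms 1"
    using assms by (simp add: pq_forms_def invariant_dforms_iff)
  then have s: "hodge_star G \<Gamma> J g 1 \<alpha> \<in> invariant_dforms (DIM('b) - 1)"
    using dim_ge_2 by (intro hodge_star) auto
  have "delbar G J (hodge_star G \<Gamma> J g 1 \<alpha>) = 0"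
    by (simp only: delbar_eq[OF s] D_Stokes[OF s])
  moreover have "del G J 0 = 0"
    unfolding del_eq[OF invariant_dforms_zero] D1_def
    by (simp only: contr_zero wedge_zero_right add_0_left)
  ultimately show ?thesis
    using assms unfolding bott_chern_harmonic_def by (simp only: mem_Collect_eq simp_thms)
qed

lemma form_inner_harmonic:
  assumes "\<sigma> \<in> bott_chern_harmonic G \<Gamma> J g 2 2" "\<sigma> \<in> invariant_dforms 4" "4 \<le> DIM('b)"
  shows "form_inner G g 4 (D1 (D2 \<omega>)) \<sigma> x = 0"
proof -
  let ?Q = "D1 (D2 \<omega>)" and ?\<gamma> = "hodge_star G \<Gamma> J g 4 \<sigma>"
  have Q: "?Q \<in> invariant_dforms 4"
    using D1_invariant[OF D2_invariant[OF fundamental_form_invariant]] by simp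
  note star = hodge_star[OF assms(2,3)]
  have "del G J (delbar G J ?\<gamma>) = 0"
    using assms(1) by (simp add: bott_chern_harmonic_def)
  then have "D1 (D2 ?\<gamma>) = 0"
    by (simp only: delbar_eq[OF star(1)] del_eq[OF D2_invariant[OF star(1)]])
  then have "?Q \<and>\<^sub>d ?\<gamma> = 0" by (rule wedge_D_omega_zero[OF star(1) assms(3)])
  moreover obtain Zs where "\<And>x. vol Zs x = 1" by (rule volume_form_nonzero) blast
  moreover have "?Q \<in> dforms G \<Gamma> 4" using Q by (simp add: invariant_dforms_iff)
  ultimately show ?thesis using star(2)[of ?Q Zs x] by simp
qed

lemma SKT_if_span_harmonic:
  assumes "A \<and>\<^sub>d A' \<in> cvec.span (bott_chern_harmonic G \<Gamma> J g 2 2 \<inter> invariant_dforms 4)"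
    and "B' \<and>\<^sub>d B \<in> cvec.span (bott_chern_harmonic G \<Gamma> J g 2 2 \<inter> invariant_dforms 4)"
  shows "SKT G J g"
proof -
  let ?Q = "D1 (D2 \<omega>)"
  have Q: "?Q \<in> invariant_dforms 4"
    using D1_invariant[OF D2_invariant[OF fundamental_form_invariant]] by simp
  have "?Q = 0"
  proof (cases "4 \<le> DIM('b)")
    \<comment> \<open>In lower dimension a 4-form is zero, and \<open>hodge_star\<close> would only
      have its default value.\<close>
    case False
    then show ?thesis
      using alternating_degree_too_large[OF invariant_dformsD(1)[OF Q] E(1,2) _
          invariant_dformsD(2)[OF Q]] E(4) by linarith
  next
    case True
    let ?L = "{Zs. length Zs = 4 \<and> set Zs \<subseteq> basis}"
    obtain c where "?Q = cscale c (A \<and>\<^sub>d A') + cscale (- c) (B' \<and>\<^sub>d B)" by (rule D_omega)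
    then have span: "?Q \<in> cvec.span (bott_chern_harmonic G \<Gamma> J g 2 2 \<inter> invariant_dforms 4)"
      using assms cvec.span_add cvec.span_scale by metis
    have zero: "?Q Zs x = 0" if Zs: "Zs \<in> ?L" for Zs x
    proof -
      have "form_inner G g 4 ?Q \<sigma> x = 0"
        if "\<sigma> \<in> cvec.span (bott_chern_harmonic G \<Gamma> J g 2 2 \<inter> invariant_dforms 4)" for \<sigma>
        using that
      proof (induction rule: cvec.span_induct_alt)
        case base
        show ?case by (simp add: form_inner_eq)
      next
        case (step c \<alpha> \<beta>)
        \<comment> \<open>The inner product is conjugate-linear in its second argument, so
          orthogonality extends from harmonic forms to their span, which contains \<open>?Q\<close>
          itself.\<close>
        have "form_inner G g 4 ?Q (cscale c \<alpha> + \<beta>) x =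
            cnj c * form_inner G g 4 ?Q \<alpha> x + form_inner G g 4 ?Q \<beta> x"
          unfolding form_inner_eq cscale_def
          by (simp add: sum_distrib_left sum.distrib add_divide_distrib algebra_simps)
        moreover have "form_inner G g 4 ?Q \<alpha> x = 0"
          using step form_inner_harmonic[OF _ _ True] by blast
        ultimately show ?case using step.IH by (simp del: plus_fun_apply)
      qed
      from this[OF span] have "(\<Sum>Zs\<in>?L. ?Q Zs x * cnj (?Q Zs x)) = 0"
        by (simp add: form_inner_eq)
      then have "(\<Sum>Zs\<in>?L. complex_of_real ((cmod (?Q Zs x))\<^sup>2)) = 0"
        by (simp only: complex_norm_square)
      then have "complex_of_real (\<Sum>Zs\<in>?L. (cmod (?Q Zs x))\<^sup>2) = 0"
        by (simp only: of_real_sum)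
      then have "(\<Sum>Zs\<in>?L. (cmod (?Q Zs x))\<^sup>2) = 0" by (simp only: of_real_eq_0_iff)
      moreover have "finite ?L"
        using finite_lists_length_eq[OF basis(1), of 4] by (simp add: conj_commute)
      ultimately have "(cmod (?Q Zs x))\<^sup>2 = 0"
        using Zs by (subst (asm) sum_nonneg_eq_0_iff) auto
      then show ?thesis by simp
    qed
    show ?thesis
    proof (intro ext)
      fix Zs x
      have "?Q Ys x = 0" if "set Ys \<subseteq> basis" for Ys
        using zero[of Ys x] that invariant_dformsD(2)[OF Q]
        by (cases "length Ys = 4") (auto simp: homogeneous_def)
      then show "?Q Zs x = 0 Zs x"
        using alternating_eqI_span[OF invariant_dformsD(1)[OF Q] basis(3)] by simp
    qed
  qed
  then show ?thesis
    unfolding SKT_def delbar_eq[OF fundamental_form_invariant]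
      del_eq[OF D2_invariant[OF fundamental_form_invariant]] .
qed

end

lemma wedge_in_span:
  assumes "\<alpha> \<in> cvec.span S" "\<beta> \<in> cvec.span T"
    and "\<And>\<sigma> \<tau>. \<sigma> \<in> S \<Longrightarrow> \<tau> \<in> T \<Longrightarrow> \<sigma> \<and>\<^sub>d \<tau> \<in> cvec.span H"
  shows "\<alpha> \<and>\<^sub>d \<beta> \<in> cvec.span H"
proof -
  have *: "\<sigma> \<and>\<^sub>d \<beta> \<in> cvec.span H" if "\<sigma> \<in> S" for \<sigma>
    using assms(2)
  proof (induction rule: cvec.span_induct_alt)
    case base
    show ?case by (simp only: wedge_zero_right cvec.span_zero)
  next
    case (step c \<tau> \<beta>)
    then show ?case
      using assms(3)[OF that] cvec.span_add cvec.span_scale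
      by (metis wedge_add_right wedge_scale_right)
  qed
  show ?thesis
    using assms(1)
  proof (induction rule: cvec.span_induct_alt)
    case base
    show ?case by (simp only: wedge_zero_left cvec.span_zero)
  next
    case (step c \<tau> \<alpha>)
    then show ?case
      using * cvec.span_add cvec.span_scale by (metis wedge_add_left wedge_scale_left)
  qed
qed

section \<open>The Koszul formula for central brackets\<close>

lemma nths_single: "i < length xs \<Longrightarrow> nths xs {i} = [xs ! i]"
proof (induction xs arbitrary: i)
  case (Cons x xs)
  show ?case
  proof (cases i)
    case 0
    then have "{j. Suc j \<in> {i}} = {}" by simp
    then show ?thesis using 0 by (simp add: nths_Cons)
  next
    case (Suc m)
    then have "{j. Suc j \<in> {i}} = {m}" by auto
    then show ?thesis using Suc Cons by (simp add: nths_Cons)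
  qed
qed simp

lemma nths_pair: "i < j \<Longrightarrow> j < length xs \<Longrightarrow> nths xs {i, j} = [xs ! i, xs ! j]"
proof (induction xs arbitrary: i j)
  case (Cons x xs)
  obtain n where j: "j = Suc n" using Cons.prems(1) by (cases j) auto
  show ?case
  proof (cases i)
    case 0
    then have "{m. Suc m \<in> {i, j}} = {n}" using j by auto
    then show ?thesis using 0 j Cons.prems by (simp add: nths_Cons nths_single)
  next
    case (Suc m)
    then have "{l. Suc l \<in> {i, j}} = {m, n}" using j by auto
    then show ?thesis using Suc j Cons by (simp add: nths_Cons)
  qed
qed simp

text \<open>The inversions come from the i positions before i and the j - 1 positions before j other
  than i, hence i + j - 1 in all.\<close>

lemma shuffle_sign_pair:
  assumes "i < j" "j < n"
  shows "shuffle_sign n {i, j} = - ((-1) ^ (i + j))"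
proof -
  have *: "{(a, b). a \<in> {i, j} \<and> b \<in> {..<n} - {i, j} \<and> b < a} =
      {i} \<times> {..<i} \<union> {j} \<times> ({..<j} - {i})"
    using assms by auto
  have "card ({i} \<times> {..<i} \<union> {j} \<times> ({..<j} - {i})) = i + (j - 1)"
    using assms by (subst card_Un_disjoint) (auto simp: card_cartesian_product_singleton)
  then show ?thesis
    unfolding shuffle_sign_def * using assms(1) by (cases j) auto
qed

text \<open>Written over pairs of indices, the product has the shape of the bracket sum in
  \<open>ext_d\<close>; the opposite sign matches the minus signs in the bracket assumption of
  \<open>ext_d_central_brackets\<close>.\<close>

lemma wedge_2:
  assumes "homogeneous 2 F"
  shows "(F \<and>\<^sub>d \<beta>) Zs x = - (\<Sum>(i, j)\<in>{(i, j). i < j \<and> j < length Zs}.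
    (-1) ^ (i + j) * F [Zs ! i, Zs ! j] x * \<beta> (nths Zs (- {i, j})) x)"
proof -
  let ?n = "length Zs"
  let ?P = "{(i, j). i < j \<and> j < ?n}"
  let ?f = "\<lambda>(i, j). {i, j :: nat}"
  let ?t = "\<lambda>S. shuffle_sign ?n S * F (nths Zs S) x * \<beta> (nths Zs (- S)) x"
  have inj: "inj_on ?f ?P"
    by (rule inj_onI) (auto simp: doubleton_eq_iff)
  have img: "?f ` ?P = {S \<in> Pow {..<?n}. card S = 2}"
  proof (intro equalityI subsetI)
    fix S assume "S \<in> {S \<in> Pow {..<?n}. card S = 2}"
    then obtain a b where S: "S = {a, b}" "a \<noteq> b" "a < ?n" "b < ?n"
      by (auto simp: card_2_iff)
    then show "S \<in> ?f ` ?P"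
    proof (cases "a < b")
      case True
      then show ?thesis using S by (intro image_eqI[of _ _ "(a, b)"]) auto
    next
      case False
      then show ?thesis using S by (intro image_eqI[of _ _ "(b, a)"]) auto
    qed
  qed auto
  have "(F \<and>\<^sub>d \<beta>) Zs x = sum ?t {S \<in> Pow {..<?n}. card S = 2}"
    unfolding wedge_def
  proof (rule sum.mono_neutral_right)
    show "\<forall>S\<in>Pow {..<?n} - {S \<in> Pow {..<?n}. card S = 2}. ?t S = 0"
    proof
      fix S assume "S \<in> Pow {..<?n} - {S \<in> Pow {..<?n}. card S = 2}"
      then have "length (nths Zs S) \<noteq> 2" using length_nths_subset[of S Zs] by auto
      then show "?t S = 0" using assms by (simp add: homogeneous_def)
    qed
  qed auto
  also have "\<dots> = (\<Sum>p\<in>?P. ?t (?f p))"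
    unfolding img[symmetric] sum.reindex[OF inj] by (simp add: o_def)
  also have "\<dots> = (\<Sum>p\<in>?P. - (case p of (i, j) \<Rightarrow>
      (-1) ^ (i + j) * F [Zs ! i, Zs ! j] x * \<beta> (nths Zs (- {i, j})) x))"
    by (rule sum.cong) (auto simp: shuffle_sign_pair nths_pair)
  finally show ?thesis by (simp only: sum_negf)
qed

text \<open>Induction on the index set: if some w is seen by a alone, a multiple of
  \<open>ev\<close> at a is subtracted from \<psi> so that w is annihilated; otherwise a adds no
  condition and gets coefficient 0. This will turn the absence of a dual vector into linear
  dependence of the coframe.\<close>

lemma functional_in_span:
  fixes ev :: "('a \<Rightarrow> 'b \<Rightarrow> complex) \<Rightarrow> 'i \<Rightarrow> complex"
  assumes "finite I" "cvec.subspace W"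
    and "\<And>i c x y. i \<in> I \<Longrightarrow> x \<in> W \<Longrightarrow> y \<in> W \<Longrightarrow> ev (cscale c x + y) i = c * ev x i + ev y i"
    and "\<And>c x y. x \<in> W \<Longrightarrow> y \<in> W \<Longrightarrow> \<psi> (cscale c x + y) = c * \<psi> x + \<psi> y"
    and "\<And>w. w \<in> W \<Longrightarrow> (\<And>i. i \<in> I \<Longrightarrow> ev w i = 0) \<Longrightarrow> \<psi> w = 0"
  shows "\<exists>c. \<forall>w\<in>W. \<psi> w = (\<Sum>i\<in>I. c i * ev w i)"
  using assms(1,3,4,5)
proof (induction I arbitrary: \<psi> rule: finite_induct)
  case empty
  then show ?case by simp
next
  case (insert a I)
  show ?case
  proof (cases "\<exists>w\<in>W. (\<forall>i\<in>I. ev w i = 0) \<and> ev w a \<noteq> 0")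
    case False
    then have "\<exists>c. \<forall>w\<in>W. \<psi> w = (\<Sum>i\<in>I. c i * ev w i)"
    proof (intro insert.IH)
      fix w assume w: "w \<in> W" "\<And>i. i \<in> I \<Longrightarrow> ev w i = 0"
      then have "ev w a = 0" using False by blast
      with w show "\<psi> w = 0" using insert.prems(3) by blast
    qed (use insert.prems in blast)+
    then obtain c where c: "\<forall>w\<in>W. \<psi> w = (\<Sum>i\<in>I. c i * ev w i)" by blast
    have "\<forall>w\<in>W. \<psi> w = (\<Sum>i\<in>insert a I. (c(a := 0)) i * ev w i)"
    proof
      fix w assume "w \<in> W"
      have "(\<Sum>i\<in>I. (c(a := 0)) i * ev w i) = (\<Sum>i\<in>I. c i * ev w i)"
        using insert.hyps by (intro sum.cong) auto
      then show "\<psi> w = (\<Sum>i\<in>insert a I. (c(a := 0)) i * ev w i)"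
        using c \<open>w \<in> W\<close> insert.hyps by simp
    qed
    then show ?thesis by blast
  next
    case True
    then obtain w where w: "w \<in> W" "\<forall>i\<in>I. ev w i = 0" "ev w a \<noteq> 0" by blast
    define d where "d = \<psi> w / ev w a"
    have "\<exists>c. \<forall>z\<in>W. \<psi> z - d * ev z a = (\<Sum>i\<in>I. c i * ev z i)"
    proof (rule insert.IH)
      show "\<And>i c x y. i \<in> I \<Longrightarrow> x \<in> W \<Longrightarrow> y \<in> W \<Longrightarrow> ev (cscale c x + y) i = c * ev x i + ev y i"
        using insert.prems(1) by blast
      show "\<psi> (cscale c x + y) - d * ev (cscale c x + y) a =
          c * (\<psi> x - d * ev x a) + (\<psi> y - d * ev y a)" if "x \<in> W" "y \<in> W" for c x y
      proof -
        have "ev (cscale c x + y) a = c * ev x a + ev y a" using insert.prems(1) that by blast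
        moreover have "\<psi> (cscale c x + y) = c * \<psi> x + \<psi> y" using insert.prems(2) that by blast
        ultimately show ?thesis by (simp only: algebra_simps)
      qed
      show "\<psi> z - d * ev z a = 0" if z: "z \<in> W" "\<And>i. i \<in> I \<Longrightarrow> ev z i = 0" for z
      proof -
        \<comment> \<open>The correction by w makes \<open>ev\<close> at a vanish and leaves the
          values at I unchanged.\<close>
        let ?c = "- ev z a / ev w a"
        let ?y = "cscale ?c w + z"
        have y: "?y \<in> W" using assms(2) w(1) z(1) cvec.subspace_add cvec.subspace_scale by metis
        have "ev ?y i = 0" if "i \<in> insert a I" for i
        proof -
          have "ev ?y i = ?c * ev w i + ev z i"
            using insert.prems(1) that w(1) z(1) by blast
          then show ?thesis using that w z(2) by auto
        qed
        then have "\<psi> ?y = 0" using insert.prems(3) y by blast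
        moreover have "\<psi> ?y = ?c * \<psi> w + \<psi> z" using insert.prems(2) w(1) z(1) by blast
        ultimately show ?thesis using w(3) by (simp add: d_def field_simps)
      qed
    qed
    then obtain c where c: "\<forall>z\<in>W. \<psi> z - d * ev z a = (\<Sum>i\<in>I. c i * ev z i)" by blast
    have "\<forall>z\<in>W. \<psi> z = (\<Sum>i\<in>insert a I. (c(a := d)) i * ev z i)"
    proof
      fix z assume "z \<in> W"
      have "(\<Sum>i\<in>I. (c(a := d)) i * ev z i) = (\<Sum>i\<in>I. c i * ev z i)"
        using insert.hyps by (intro sum.cong) auto
      moreover have "\<psi> z - d * ev z a = (\<Sum>i\<in>I. c i * ev z i)" using c \<open>z \<in> W\<close> by blast
      ultimately show "\<psi> z = (\<Sum>i\<in>insert a I. (c(a := d)) i * ev z i)"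
        using insert.hyps by (simp add: algebra_simps)
    qed
    then show ?thesis by blast
  qed
qed

section \<open>Conjugation of forms and the differential of invariant forms\<close>

lemma form_conj_simps:
  "form_conj (\<alpha> + \<beta>) = form_conj \<alpha> + form_conj \<beta>"
  "form_conj (cscale c \<alpha>) = cscale (cnj c) (form_conj \<alpha>)"
  "form_conj 0 = 0"
  by (simp_all add: form_conj_def cscale_def fun_eq_iff)

lemma form_conj_form_conj: "form_conj (form_conj \<alpha>) = \<alpha>"
  by (simp add: form_conj_def fun_eq_iff vconj_linear o_def)

lemma form_conj_wedge: "form_conj (\<alpha> \<and>\<^sub>d \<beta>) = form_conj \<alpha> \<and>\<^sub>d form_conj \<beta>"
  by (simp add: form_conj_def wedge_def fun_eq_iff nths_map shuffle_sign_def)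

lemma contr_form_conj: "contr Z (form_conj \<alpha>) = form_conj (contr (vconj Z) \<alpha>)"
  by (simp add: contr_def form_conj_def fun_eq_iff)

lemma form_conj_span:
  assumes "\<alpha> \<in> cvec.span S"
  shows "form_conj \<alpha> \<in> cvec.span (form_conj ` S)"
  using assms
proof (induction rule: cvec.span_induct_alt)
  case base
  show ?case by (simp only: form_conj_simps cvec.span_zero)
next
  case (step c \<alpha> \<beta>)
  then show ?case
    unfolding form_conj_simps
    by (intro cvec.span_add[OF cvec.span_scale[OF cvec.span_base[OF imageI]]])
qed

context lie_group_forms
begin

lemma invariant_dforms_conj:
  assumes "\<alpha> \<in> invariant_dforms n"
  shows "form_conj \<alpha> \<in> invariant_dforms n"
proof -
  note d = invariant_dformsD[OF assms]
  have conj_V: "vconj Z \<in> V \<longleftrightarrow> Z \<in> V" for Z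
    using vconj_closed[of Z] vconj_closed[of "vconj Z"] by (auto simp: vconj_linear)
  have "alternating V (form_conj \<alpha>)"
  proof (rule alternatingI)
    fix Xs Z Ys assume "Z \<notin> V"
    then show "form_conj \<alpha> (Xs @ Z # Ys) = 0"
      using alternatingD(1)[OF d(1), of "vconj Z"] by (simp add: form_conj_def conj_V fun_eq_iff)
  next
    fix Xs Ys Z W assume "Z \<in> V" "W \<in> V"
    then have "vconj Z \<in> V" "vconj W \<in> V" by (simp_all add: conj_V)
    from alternatingD(2)[OF d(1) this, of "map vconj Xs" "map vconj Ys"]
    show "form_conj \<alpha> (Xs @ (Z + W) # Ys) = form_conj \<alpha> (Xs @ Z # Ys) + form_conj \<alpha> (Xs @ W # Ys)"
      by (intro ext) (simp add: form_conj_def vconj_linear del: plus_fun_apply,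
          simp only: plus_fun_apply complex_cnj_add)
  next
    fix Xs Ys c Z assume "Z \<in> V"
    then have "vconj Z \<in> V" by (simp add: conj_V)
    from alternatingD(3)[OF d(1) this, of "map vconj Xs" "cnj c" "map vconj Ys"]
    show "form_conj \<alpha> (Xs @ cscale c Z # Ys) = (\<lambda>x. c * form_conj \<alpha> (Xs @ Z # Ys) x)"
      by (simp add: form_conj_def vconj_linear)
  next
    fix Xs Ys Z W
    show "form_conj \<alpha> (Xs @ Z # W # Ys) = (\<lambda>x. - form_conj \<alpha> (Xs @ W # Z # Ys) x)"
      using alternatingD(4)[OF d(1), of "map vconj Xs" "vconj Z" "vconj W" "map vconj Ys"]
      by (simp add: form_conj_def)
  qed
  moreover have "homogeneous n (form_conj \<alpha>)"
    using d(2) by (simp add: homogeneous_def form_conj_def fun_eq_iff)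
  moreover have "constant_form (form_conj \<alpha>)"
    using d(3) unfolding constant_form_def form_conj_def by metis
  ultimately show ?thesis by (simp add: invariant_dforms_def)
qed

text \<open>Components are constant, so the derivative terms of the Koszul formula disappear and the
  Chevalley-Eilenberg differential remains.\<close>

lemma ext_d_invariant:
  assumes "\<alpha> \<in> invariant_dforms n" "set Zs \<subseteq> V"
  shows "ext_d G \<alpha> Zs x = (\<Sum>(i, j)\<in>{(i, j). i < j \<and> j < length Zs}.
    (-1) ^ (i + j) * \<alpha> (lie_bracket (Zs ! i) (Zs ! j) # nths Zs (- {i, j})) x)"
proof -
  have "(Zs ! i) (\<alpha> Ys) = 0" if "i < length Zs" for i Ys
  proof -
    have "\<alpha> Ys = (\<lambda>_. \<alpha> Ys undefined)"
      using invariant_dformsD(3)[OF assms(1)] unfolding constant_form_def by (intro ext) blast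
    moreover have "Zs ! i \<in> vector_fields G"
      using that assms(2) lie_algebra_C_vector_fields by (meson nth_mem subsetD)
    ultimately show ?thesis using vector_fields_const by metis
  qed
  then show ?thesis using assms(2) by (simp add: ext_d_def)
qed

lemma ext_d_1_form:
  assumes "\<alpha> \<in> invariant_dforms n" "Z \<in> V" "W \<in> V"
  shows "ext_d G \<alpha> [Z, W] x = - \<alpha> [lie_bracket Z W] x"
proof -
  have "{(i, j). i < j \<and> j < length [Z, W]} = {(0, 1)}" by auto
  moreover have "nths [Z, W] (- {0, 1}) = []" by (simp add: nths_Cons)
  ultimately show ?thesis using ext_d_invariant[OF assms(1), of "[Z, W]" x] assms(2,3) by simp
qed

text \<open>Inserting the brackets into the Koszul sum and using linearity in the first slot gives,
  pair by pair, the sums of \<open>wedge_2\<close>.\<close>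

lemma ext_d_central_brackets:
  assumes "u \<in> V" "v \<in> V" "homogeneous 2 F" "homogeneous 2 F'" "alternating V F" "alternating V F'"
    and br: "\<And>Z W x. Z \<in> V \<Longrightarrow> W \<in> V \<Longrightarrow>
      lie_bracket Z W = cscale (- F [Z, W] x) u + cscale (- F' [Z, W] x) v"
    and \<alpha>: "\<alpha> \<in> invariant_dforms n"
  shows "ext_d G \<alpha> = F \<and>\<^sub>d contr u \<alpha> + F' \<and>\<^sub>d contr v \<alpha>"
proof (intro ext)
  fix Zs x
  note alt = invariant_dformsD(1)[OF \<alpha>]
  have "ext_d G \<alpha> Zs x = (F \<and>\<^sub>d contr u \<alpha>) Zs x + (F' \<and>\<^sub>d contr v \<alpha>) Zs x"
  proof (cases "set Zs \<subseteq> V")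
    case True
    have bracket: "\<alpha> (lie_bracket (Zs ! i) (Zs ! j) # Ys) x =
        - (F [Zs ! i, Zs ! j] x * contr u \<alpha> Ys x) - F' [Zs ! i, Zs ! j] x * contr v \<alpha> Ys x"
      if "i < length Zs" "j < length Zs" for i j Ys
    proof -
      let ?a = "- F [Zs ! i, Zs ! j] x" and ?b = "- F' [Zs ! i, Zs ! j] x"
      have ZW: "Zs ! i \<in> V" "Zs ! j \<in> V" using that True by (meson nth_mem subsetD)+
      have V: "cscale ?a u \<in> V" "cscale ?b v \<in> V"
        using lie_algebra_C_subspace cvec.subspace_scale assms(1,2) by blast+
      have "\<alpha> (lie_bracket (Zs ! i) (Zs ! j) # Ys) x =
          contr (cscale ?a u + cscale ?b v) \<alpha> Ys x"
        by (simp only: br[OF ZW, of x] contr_def)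
      also have "contr (cscale ?a u + cscale ?b v) \<alpha> =
          cscale ?a (contr u \<alpha>) + cscale ?b (contr v \<alpha>)"
        by (simp only: alternating_contr_add[OF alt V] alternating_contr_scale[OF alt assms(1)]
            alternating_contr_scale[OF alt assms(2)])
      finally show ?thesis by (simp add: cscale_def)
    qed
    show ?thesis
      unfolding ext_d_invariant[OF \<alpha> True] wedge_2[OF assms(3)] wedge_2[OF assms(4)]
        minus_add_distrib[symmetric] sum.distrib[symmetric] sum_negf[symmetric]
      by (intro sum.cong) (auto simp: bracket algebra_simps)
  next
    case False
    then show ?thesis
      using alternating_outside[OF alternating_wedge[OF assms(5) alternating_contr[OF alt]] False]
        alternating_outside[OF alternating_wedge[OF assms(6) alternating_contr[OF alt]] False]
      by (auto simp: ext_d_def)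
  qed
  then show "ext_d G \<alpha> Zs x = (F \<and>\<^sub>d contr u \<alpha> + F' \<and>\<^sub>d contr v \<alpha>) Zs x"
    by (simp only: plus_fun_apply)
qed

end

section \<open>The frame dual to a coframe of special type\<close>

locale special_type_frame = complex_lie_group_forms +
  fixes k :: nat and \<eta> :: "nat \<Rightarrow> 'a dform"
  assumes dim: "DIM('b) = 2 * k"
    and inj_\<eta>: "inj_on \<eta> {1..k}" and indep_\<eta>: "cvec.independent (\<eta> ` {1..k})"
    and span_\<eta>: "cvec.span (\<eta> ` {1..k}) = {\<alpha> \<in> pq_forms G \<Gamma> J 1 0. invariant_form G \<alpha>}"
    and closed_\<eta>: "\<And>j. j \<in> {1..<k} \<Longrightarrow> ext_d G (\<eta> j) = 0"
    and last_\<eta>: "ext_d G (\<eta> k) \<in> cvec.span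
          ({\<eta> i \<and>\<^sub>d \<eta> j | i j. i \<in> {1..<k} \<and> j \<in> {1..<k}} \<union>
           {\<eta> i \<and>\<^sub>d form_conj (\<eta> j) | i j. i \<in> {1..<k} \<and> j \<in> {1..<k}})"
begin

lemma k_pos: "1 \<le> k"
  using dim DIM_positive[where 'a = 'b] by linarith

lemma \<eta>_pq: "j \<in> {1..k} \<Longrightarrow> \<eta> j \<in> pq_forms G \<Gamma> J 1 0" "j \<in> {1..k} \<Longrightarrow> invariant_form G (\<eta> j)"
  using span_\<eta> cvec.span_base[of "\<eta> j" "\<eta> ` {1..k}"] by auto

lemma \<eta>_invariant: "j \<in> {1..k} \<Longrightarrow> \<eta> j \<in> invariant_dforms 1"
  using \<eta>_pq by (simp add: invariant_dforms_iff pq_forms_def)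

definition ev :: "'a vfield \<Rightarrow> nat \<Rightarrow> complex" where
  "ev Z j = \<eta> j [Z] undefined"

lemma \<eta>_ev: "j \<in> {1..k} \<Longrightarrow> \<eta> j [Z] x = ev Z j"
  using invariant_dformsD(3)[OF \<eta>_invariant] unfolding ev_def constant_form_def by blast

lemma ev_add:
  assumes "j \<in> {1..k}" "Z \<in> V" "W \<in> V"
  shows "ev (Z + W) j = ev Z j + ev W j"
  using alternatingD(2)[OF invariant_dformsD(1)[OF \<eta>_invariant[OF assms(1)]] assms(2,3), of "[]" "[]"]
  unfolding ev_def append_Nil by (simp only: plus_fun_apply)

lemma ev_scale:
  assumes "j \<in> {1..k}" "Z \<in> V"
  shows "ev (cscale c Z) j = c * ev Z j"
  using alternatingD(3)[OF invariant_dformsD(1)[OF \<eta>_invariant[OF assms(1)]] assms(2), of "[]" c "[]"]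
  unfolding ev_def append_Nil by simp

lemma ev_zero: "j \<in> {1..k} \<Longrightarrow> ev 0 j = 0"
  using ev_scale[of j 0 0] cvec.subspace_0[OF lie_algebra_C_subspace] by simp

lemma ev_01: "j \<in> {1..k} \<Longrightarrow> Z \<in> fields_01 G J \<Longrightarrow> ev Z j = 0"
proof -
  assume j: "j \<in> {1..k}" and Z: "Z \<in> fields_01 G J"
  show "ev Z j = 0"
  \<comment> \<open>The condition in \<open>pq_forms\<close> counts the entries of type (1, 0), and
    0 is of both types.\<close>
  proof (cases "Z \<in> fields_10 G J")
    case True
    then have "Z = 0" using proj_of_fields(1)[OF True] proj_of_fields(3)[OF Z] by simp
    then show ?thesis using ev_zero[OF j] by simp
  next
    case False
    then show ?thesis using \<eta>_pq(1)[OF j] Z by (simp add: pq_forms_def ev_def)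
  qed
qed

lemma ev_proj: "j \<in> {1..k} \<Longrightarrow> Z \<in> V \<Longrightarrow> ev Z j = ev (proj_10 J Z) j"
  using ev_add[of j "proj_10 J Z" "proj_01 J Z"] ev_01[of j "proj_01 J Z"]
    proj_closed[of Z] proj_fields(2)[of Z] by (simp only: proj_sum add_0_right)

text \<open>Otherwise a linear functional with value 1 at Z, composed with \<open>proj_10\<close>,
  is an invariant (1, 0)-form, hence a combination of coframe elements that all vanish at Z.\<close>

lemma separating:
  assumes "Z \<in> fields_10 G J" "\<And>j. j \<in> {1..k} \<Longrightarrow> ev Z j = 0"
  shows "Z = 0"
proof (rule ccontr)
  assume "Z \<noteq> 0"
  \<comment> \<open>The basis is taken in the space of all operators, so the coordinate functional
    of Z is defined and linear without restriction.\<close>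
  define B where "B = cvec.extend_basis {Z}"
  have indep: "cvec.independent {Z}" using \<open>Z \<noteq> 0\<close> by simp
  have B: "cvec.independent B" "Z \<in> B" "W \<in> cvec.span B" for W
    unfolding B_def using cvec.independent_extend_basis[OF indep] cvec.span_extend_basis[OF indep]
      cvec.extend_basis_superset[OF indep] by auto
  define f where "f W = cvec.representation B W Z" for W
  have f: "f (X + Y) = f X + f Y" "f (cscale c X) = c * f X" "f Z = 1" for X Y c
    unfolding f_def using B by (simp_all add: cvec.representation_add cvec.representation_scale
        cvec.representation_basis del: plus_fun_apply)
  have f0: "f 0 = 0" using f(2)[of 0 0] by simp
  define \<alpha> :: "'a dform" where
    "\<alpha> = (\<lambda>Zs x. case Zs of [W] \<Rightarrow> if W \<in> V then f (proj_10 J W) else 0 | _ \<Rightarrow> 0)"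
  have \<alpha>_simps: "\<alpha> [W] x = (if W \<in> V then f (proj_10 J W) else 0)"
    "length Ys \<noteq> 1 \<Longrightarrow> \<alpha> Ys x = 0" for W Ys x
    unfolding \<alpha>_def by (auto split: list.splits)
  have slot: "Xs = [] \<and> Ys = [] \<or> length (Xs @ X # Ys) \<noteq> 1" for Xs Ys and X :: "'a vfield"
    by (cases Xs) auto
  have "alternating V \<alpha>"
  proof (rule alternatingI)
    fix Xs X Ys assume "X \<notin> V"
    then show "\<alpha> (Xs @ X # Ys) = 0"
      using slot[of Xs Ys X] by (elim disjE) (auto simp: \<alpha>_simps fun_eq_iff)
  next
    fix Xs Ys X Y assume XY: "X \<in> V" "Y \<in> V"
    have 1: "\<alpha> [X + Y] x = \<alpha> [X] x + \<alpha> [Y] x" for x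
      using XY by (simp only: \<alpha>_simps V_add proj_add f if_True)
    have "\<alpha> (Xs @ (X + Y) # Ys) x = \<alpha> (Xs @ X # Ys) x + \<alpha> (Xs @ Y # Ys) x" for x
    proof (cases "Xs = [] \<and> Ys = []")
      case True
      then show ?thesis using 1 by (simp only: append_Nil)
    next
      case False
      then have "length (Xs @ W # Ys) \<noteq> 1" for W using slot by blast
      then show ?thesis using \<alpha>_simps(2) by (metis add_0)
    qed
    then show "\<alpha> (Xs @ (X + Y) # Ys) = \<alpha> (Xs @ X # Ys) + \<alpha> (Xs @ Y # Ys)"
      by (intro ext) (simp only: plus_fun_apply)
  next
    fix Xs Ys c X assume X: "X \<in> V"
    have 1: "\<alpha> [cscale c X] x = c * \<alpha> [X] x" for x
      using X by (simp only: \<alpha>_simps V_scale proj_scale f if_True)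
    have "\<alpha> (Xs @ cscale c X # Ys) x = c * \<alpha> (Xs @ X # Ys) x" for x
    proof (cases "Xs = [] \<and> Ys = []")
      case True
      then show ?thesis using 1 by (simp only: append_Nil)
    next
      case False
      then have "length (Xs @ W # Ys) \<noteq> 1" for W using slot by blast
      then show ?thesis using \<alpha>_simps(2) by (metis mult_zero_right)
    qed
    then show "\<alpha> (Xs @ cscale c X # Ys) = (\<lambda>x. c * \<alpha> (Xs @ X # Ys) x)"
      by (intro ext)
  next
    fix Xs Ys X Y
    show "\<alpha> (Xs @ X # Y # Ys) = (\<lambda>x. - \<alpha> (Xs @ Y # X # Ys) x)"
      by (intro ext) (simp add: \<alpha>_simps(2))
  qed
  moreover have "homogeneous 1 \<alpha>" using \<alpha>_simps(2) by (simp add: homogeneous_def fun_eq_iff)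
  moreover have "constant_form \<alpha>" by (simp add: constant_form_def \<alpha>_def)
  ultimately have inv: "\<alpha> \<in> invariant_dforms 1" by (simp add: invariant_dforms_def)
  have "\<alpha> Zs = 0" if Zs: "set Zs \<subseteq> fields_10 G J \<union> fields_01 G J"
    "length (filter (\<lambda>Z. Z \<in> fields_10 G J) Zs) \<noteq> 1" for Zs
  proof (cases "length Zs = 1")
    case True
    then obtain W where W: "Zs = [W]" by (auto simp: length_Suc_conv)
    then have "W \<in> fields_01 G J" using Zs by (auto split: if_splits)
    then have "proj_10 J W = 0" by (rule proj_of_fields(3))
    then show ?thesis unfolding W by (intro ext) (simp only: \<alpha>_simps f0 zero_fun_apply if_cancel)
  next
    case False
    then show ?thesis by (intro ext) (simp add: \<alpha>_simps(2))
  qed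
  then have "\<alpha> \<in> pq_forms G \<Gamma> J 1 0"
    using inv by (simp add: pq_forms_def invariant_dforms_iff)
  then have "\<alpha> \<in> cvec.span (\<eta> ` {1..k})" using span_\<eta> inv by (simp add: invariant_dforms_iff)
  then have "\<alpha> [Z] undefined = 0"
  proof (induction rule: cvec.span_induct_alt)
    case (step c \<beta> \<gamma>)
    then obtain j where "j \<in> {1..k}" "\<beta> = \<eta> j" by blast
    then have "\<beta> [Z] undefined = 0" using assms(2)[of j] by (simp add: ev_def)
    with step show ?case by (simp add: cscale_def)
  qed simp
  moreover have "\<alpha> [Z] undefined = 1"
    using f(3) assms(1) fields_V(1) by (simp only: \<alpha>_simps proj_of_fields(1) if_True)
  ultimately show False by simp
qed

lemma fields_10_subspace: "cvec.subspace (fields_10 G J)"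
proof (rule cvec.subspaceI)
  have J0: "J 0 = 0" using J_scale[of 0 0] cvec.subspace_0[OF lie_algebra_C_subspace] by simp
  show "0 \<in> fields_10 G J"
    using J0 cvec.subspace_0[OF lie_algebra_C_subspace] unfolding fields_10_def by simp
  show "x + y \<in> fields_10 G J" if "x \<in> fields_10 G J" "y \<in> fields_10 G J" for x y
    using that unfolding fields_10_def mem_Collect_eq
    by (simp only: V_add J_add cvec.scale_right_distrib simp_thms)
  show "cscale c x \<in> fields_10 G J" if "x \<in> fields_10 G J" for c x
    using that unfolding fields_10_def mem_Collect_eq
    by (simp only: V_scale J_scale cvec.scale_scale mult.commute simp_thms)
qed

text \<open>If there were none, every (1, 0)-field annihilated by the other coframe elements would
  be annihilated by \<open>\<eta> j\<close> as well; then \<open>functional_in_span\<close> makes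
  \<open>\<eta> j\<close> a combination of the others, against independence.\<close>

lemma dual_vector:
  assumes j: "j \<in> {1..k}"
  shows "\<exists>e\<in>fields_10 G J. \<forall>i\<in>{1..k}. ev e i = (if i = j then 1 else 0)"
proof (rule ccontr)
  assume no: "\<not> ?thesis"
  let ?I = "{1..k} - {j}"
  have lin: "ev (cscale c x + y) i = c * ev x i + ev y i"
    if "i \<in> {1..k}" "x \<in> fields_10 G J" "y \<in> fields_10 G J" for c x y i
    using that fields_V(1) by (simp only: ev_add ev_scale V_scale)
  have "\<exists>c. \<forall>w\<in>fields_10 G J. ev w j = (\<Sum>i\<in>?I. c i * ev w i)"
  proof (rule functional_in_span[OF _ fields_10_subspace])
    fix w assume w: "w \<in> fields_10 G J" "\<And>i. i \<in> ?I \<Longrightarrow> ev w i = 0"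
    show "ev w j = 0"
    proof (rule ccontr)
      assume nz: "ev w j \<noteq> 0"
      let ?e = "cscale (1 / ev w j) w"
      have "?e \<in> fields_10 G J" using fields_10_subspace cvec.subspace_scale w(1) by blast
      moreover have "ev ?e i = (if i = j then 1 else 0)" if "i \<in> {1..k}" for i
        using ev_scale[OF that fields_V(1)[OF w(1)]] w(2)[of i] nz that by simp
      ultimately show False using no by blast
    qed
  qed (use lin j in auto)
  then obtain c where c: "\<And>w. w \<in> fields_10 G J \<Longrightarrow> ev w j = (\<Sum>i\<in>?I. c i * ev w i)" by blast
  have "\<eta> j = (\<Sum>i\<in>?I. cscale (c i) (\<eta> i))"
  proof (intro ext)
    fix Zs x
    have "(\<Sum>i\<in>?I. cscale (c i) (\<eta> i)) Zs x = (\<Sum>i\<in>?I. c i * \<eta> i Zs x)"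
      by (simp add: sum_fun_apply cscale_def)
    also have "\<dots> = \<eta> j Zs x"
    proof (cases "length Zs = 1 \<and> set Zs \<subseteq> V")
      case False
      have "\<eta> i Zs x = 0" if "i \<in> {1..k}" for i
        using False invariant_dformsD(2)[OF \<eta>_invariant[OF that]]
          alternating_outside[OF invariant_dformsD(1)[OF \<eta>_invariant[OF that]], of Zs]
        by (cases "set Zs \<subseteq> V") (simp_all add: homogeneous_def)
      then show ?thesis using j by simp
    next
      case True
      then obtain Z where Z: "Zs = [Z]" "Z \<in> V" by (auto simp: length_Suc_conv)
      have "(\<Sum>i\<in>?I. c i * \<eta> i Zs x) = (\<Sum>i\<in>?I. c i * ev (proj_10 J Z) i)"
        unfolding Z(1) by (rule sum.cong) (use Z(2) in \<open>simp_all add: \<eta>_ev ev_proj[symmetric]\<close>)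
      also have "\<dots> = ev (proj_10 J Z) j" using c[OF proj_fields(1)[OF Z(2)]] by simp
      also have "\<dots> = \<eta> j Zs x" unfolding Z(1) by (simp only: \<eta>_ev[OF j] ev_proj[OF j Z(2)])
      finally show ?thesis .
    qed
    finally show "\<eta> j Zs x = (\<Sum>i\<in>?I. cscale (c i) (\<eta> i)) Zs x" by simp
  qed
  also have "\<dots> \<in> cvec.span (\<eta> ` ?I)"
    by (intro cvec.span_sum cvec.span_scale cvec.span_base imageI)
  also have "\<eta> ` ?I = \<eta> ` {1..k} - {\<eta> j}"
    using inj_\<eta> j by (subst inj_on_image_set_diff[of \<eta> "{1..k}"]) auto
  finally show False using indep_\<eta> j unfolding cvec.dependent_def by blast
qed

definition frame :: "nat \<Rightarrow> 'a vfield" where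
  "frame j = (SOME e. e \<in> fields_10 G J \<and> (\<forall>i\<in>{1..k}. ev e i = (if i = j then 1 else 0)))"

lemma frame:
  assumes "j \<in> {1..k}"
  shows "frame j \<in> fields_10 G J" "i \<in> {1..k} \<Longrightarrow> ev (frame j) i = (if i = j then 1 else 0)"
proof -
  have ex: "\<exists>e. e \<in> fields_10 G J \<and> (\<forall>i\<in>{1..k}. ev e i = (if i = j then 1 else 0))"
    using dual_vector[OF assms] by blast
  from someI_ex[OF ex] show "frame j \<in> fields_10 G J" "i \<in> {1..k} \<Longrightarrow> ev (frame j) i = (if i = j then 1 else 0)"
    unfolding frame_def by blast+
qed

lemma ev_sum:
  assumes "i \<in> {1..k}" "\<And>j. j \<in> S \<Longrightarrow> f j \<in> V"
  shows "(\<Sum>j\<in>S. f j) \<in> V \<and> ev (\<Sum>j\<in>S. f j) i = (\<Sum>j\<in>S. ev (f j) i)"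
  using assms(2)
  by (induction S rule: infinite_finite_induct)
    (simp_all add: ev_add[OF assms(1)] ev_zero[OF assms(1)] V_add
      cvec.subspace_0[OF lie_algebra_C_subspace] del: plus_fun_apply zero_fun_apply)

text \<open>The difference of both sides is annihilated by the whole coframe, so
  \<open>separating\<close> applies.\<close>

lemma expand_10:
  assumes Z: "Z \<in> fields_10 G J"
  shows "Z = (\<Sum>j\<in>{1..k}. cscale (ev Z j) (frame j))" (is "Z = ?S")
proof -
  have t: "cscale (ev Z j) (frame j) \<in> fields_10 G J" if "j \<in> {1..k}" for j
    using frame(1)[OF that] fields_10_subspace cvec.subspace_scale by blast
  have S: "?S \<in> fields_10 G J"
    by (rule cvec.subspace_sum[OF fields_10_subspace t])
  have D: "Z - ?S \<in> fields_10 G J" using fields_10_subspace cvec.subspace_diff Z S by blast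
  have "ev (Z - ?S) i = 0" if i: "i \<in> {1..k}" for i
  proof -
    have "ev ?S i = (\<Sum>j\<in>{1..k}. ev (cscale (ev Z j) (frame j)) i)"
      using ev_sum[OF i, of "{1..k}" "\<lambda>j. cscale (ev Z j) (frame j)"] fields_V(1)[OF t] by blast
    also have "\<dots> = (\<Sum>j\<in>{1..k}. if j = i then ev Z j else 0)"
    proof (rule sum.cong[OF refl])
      fix j assume j: "j \<in> {1..k}"
      have "frame j \<in> V" using frame(1)[OF j] fields_V(1) by blast
      then show "ev (cscale (ev Z j) (frame j)) i = (if j = i then ev Z j else 0)"
        using frame(2)[OF j i] by (simp add: ev_scale[OF i])
    qed
    also have "\<dots> = ev Z i" using i by simp
    finally have "ev ?S i = ev Z i" .
    moreover have "ev (Z - ?S + ?S) i = ev (Z - ?S) i + ev ?S i"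
      using ev_add[OF i fields_V(1)[OF D] fields_V(1)[OF S]] .
    ultimately show ?thesis by simp
  qed
  then have "Z - ?S = 0" by (rule separating[OF D])
  then show ?thesis by simp
qed

lemma expand:
  assumes "Z \<in> V"
  shows "Z = (\<Sum>j\<in>{1..k}. cscale (ev Z j) (frame j)) +
    (\<Sum>j\<in>{1..k}. cscale (cnj (ev (vconj Z) j)) (vconj (frame j)))"
proof -
  let ?P = "proj_10 J Z" and ?Q = "proj_01 J Z"
  \<comment> \<open>The (0, 1)-part is conjugated into type (1, 0), expanded there and conjugated
    back, which accounts for the coefficients in the second sum.\<close>
  have Q: "vconj ?Q \<in> fields_10 G J" using proj_fields(2)[OF assms] vconj_fields(2) by blast
  have cP: "vconj ?P \<in> fields_01 G J" using proj_fields(1)[OF assms] vconj_fields(1) by blast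
  have 1: "?P = (\<Sum>j\<in>{1..k}. cscale (ev Z j) (frame j))"
    using expand_10[OF proj_fields(1)[OF assms]] ev_proj[OF _ assms]
    by (metis (no_types, lifting) sum.cong)
  have "ev (vconj Z) j = ev (vconj ?Q) j" if j: "j \<in> {1..k}" for j
  proof -
    have "vconj Z = vconj ?P + vconj ?Q" by (simp only: proj_sum flip: vconj_linear(1))
    then show ?thesis
      using ev_add[OF j fields_V(2)[OF cP] fields_V(1)[OF Q]] ev_01[OF j cP] by simp
  qed
  then have "vconj ?Q = (\<Sum>j\<in>{1..k}. cscale (ev (vconj Z) j) (frame j))"
    using expand_10[OF Q] by (metis (no_types, lifting) sum.cong)
  then have "vconj (vconj ?Q) = vconj (\<Sum>j\<in>{1..k}. cscale (ev (vconj Z) j) (frame j))"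
    by (simp only:)
  then have 2: "?Q = (\<Sum>j\<in>{1..k}. cscale (cnj (ev (vconj Z) j)) (vconj (frame j)))"
    by (simp only: vconj_linear vconj_sum)
  show ?thesis using proj_sum[of Z] unfolding 1[symmetric] 2[symmetric] by simp
qed

definition full_frame :: "'a vfield set" where
  "full_frame = frame ` {1..k} \<union> (\<lambda>j. vconj (frame j)) ` {1..k}"

lemma frame_V: "j \<in> {1..k} \<Longrightarrow> frame j \<in> V" "j \<in> {1..k} \<Longrightarrow> vconj (frame j) \<in> V"
  using frame(1) fields_V vconj_closed by blast+

lemma full_frame_span: "cvec.span full_frame = V"
proof
  have "full_frame \<subseteq> V" unfolding full_frame_def using frame_V by blast
  then show "cvec.span full_frame \<subseteq> V" using cvec.span_minimal lie_algebra_C_subspace by blast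
  show "V \<subseteq> cvec.span full_frame"
  proof
    fix Z assume "Z \<in> V"
    show "Z \<in> cvec.span full_frame"
      by (subst expand[OF \<open>Z \<in> V\<close>])
        (intro cvec.span_add cvec.span_sum cvec.span_scale cvec.span_base; simp add: full_frame_def)
  qed
qed

lemma ev_vconj_frame:
  assumes "i \<in> {1..k}" "j \<in> {1..k}"
  shows "ev (vconj (frame j)) i = 0"
  using ev_01[OF assms(1) vconj_fields(1)[OF frame(1)[OF assms(2)]]] .

lemma full_frame_card: "finite full_frame" "card full_frame = DIM('b)"
proof -
  show "finite full_frame" by (simp add: full_frame_def)
  have inj: "inj_on frame {1..k}"
    by (rule inj_onI) (metis frame(2) zero_neq_one)
  then have inj': "inj_on (\<lambda>j. vconj (frame j)) {1..k}"
    unfolding inj_on_def by (metis vconj_linear(4))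
  have "frame ` {1..k} \<inter> (\<lambda>j. vconj (frame j)) ` {1..k} = {}"
  proof -
    have "frame i \<noteq> vconj (frame j)" if "i \<in> {1..k}" "j \<in> {1..k}" for i j
      using frame(2)[OF that(1,1)] ev_vconj_frame[OF that] by auto
    then show ?thesis by blast
  qed
  then show "card full_frame = DIM('b)"
    unfolding full_frame_def dim using inj inj' by (simp add: card_Un_disjoint card_image)
qed

text \<open>The functional \<open>ev\<close> at i, or its conjugate, is 1 on the chosen vector and 0
  on all others, hence 0 on their span.\<close>

lemma full_frame_independent: "cvec.independent full_frame"
  unfolding cvec.dependent_def
proof
  assume "\<exists>a\<in>full_frame. a \<in> cvec.span (full_frame - {a})"
  then obtain a where a: "a \<in> full_frame" "a \<in> cvec.span (full_frame - {a})" by blast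
  have FV: "full_frame \<subseteq> V" unfolding full_frame_def using frame_V by blast
  have vconj_cancel: "vconj (vconj Z) = Z" for Z :: "'a vfield" by (rule vconj_linear(4))
  consider i where "i \<in> {1..k}" "a = frame i" | i where "i \<in> {1..k}" "a = vconj (frame i)"
    using a(1) unfolding full_frame_def by blast
  then show False
  proof cases
    case (1 i)
    have "w \<in> V \<and> ev w i = 0" if "w \<in> cvec.span (full_frame - {a})" for w
      using that
    proof (induction rule: cvec.span_induct_alt)
      case base
      show ?case using ev_zero[OF 1(1)] cvec.subspace_0[OF lie_algebra_C_subspace] by blast
    next
      case (step c x y)
      have x: "x \<in> V" using step FV by blast
      have "ev x i = 0"
      proof -
        from step.hyps consider j where "j \<in> {1..k}" "x = frame j" "j \<noteq> i"
          | j where "j \<in> {1..k}" "x = vconj (frame j)"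
          unfolding full_frame_def 1(2) by blast
        then show ?thesis
          by cases (use frame(2) ev_vconj_frame 1(1) in auto)
      qed
      with step.IH x show ?case
        by (metis V_add V_scale add_0 ev_add ev_scale 1(1) mult_zero_right)
    qed
    with a(2) have "ev a i = 0" by blast
    then show False using frame(2)[OF 1(1,1)] 1(2) by simp
  next
    case (2 i)
    have "w \<in> V \<and> ev (vconj w) i = 0" if "w \<in> cvec.span (full_frame - {a})" for w
      using that
    proof (induction rule: cvec.span_induct_alt)
      case base
      have "vconj 0 = (0 :: 'a vfield)" by (simp add: vconj_def fun_eq_iff)
      then show ?case using ev_zero[OF 2(1)] cvec.subspace_0[OF lie_algebra_C_subspace] by metis
    next
      case (step c x y)
      have x: "x \<in> V" using step FV by blast
      have "ev (vconj x) i = 0"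
      proof -
        from step.hyps consider j where "j \<in> {1..k}" "x = vconj (frame j)" "j \<noteq> i"
          | j where "j \<in> {1..k}" "x = frame j"
          unfolding full_frame_def 2(2) by blast
        then show ?thesis
          by cases (use frame(2) ev_vconj_frame 2(1) vconj_cancel in auto)
      qed
      moreover have "ev (vconj (cscale c x + y)) i = cnj c * ev (vconj x) i + ev (vconj y) i"
        using x step.IH vconj_closed by (simp only: vconj_linear ev_add[OF 2(1)] ev_scale[OF 2(1)] V_scale)
      moreover have "cscale c x + y \<in> V" using x step.IH V_add V_scale by blast
      ultimately show ?case using step.IH by (simp del: plus_fun_apply)
    qed
    with a(2) have "ev (vconj a) i = 0" by blast
    then show False using frame(2)[OF 2(1,1)] 2(2) vconj_cancel by simp
  qed
qed

end

section \<open>The structure equations in the dual frame\<close>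

context special_type_frame
begin

abbreviation "u \<equiv> frame k"
abbreviation "v \<equiv> vconj (frame k)"

lemma k_in: "k \<in> {1..k}" and lt_in: "i \<in> {1..<k} \<Longrightarrow> i \<in> {1..k}" and lt_neq: "i \<in> {1..<k} \<Longrightarrow> i \<noteq> k"
  using k_pos by auto

text \<open>The coefficient of a bracket along \<open>frame j\<close> is minus the differential of
  \<open>\<eta> j\<close>, which is zero for j < k; the conjugate directions follow since
  conjugation respects brackets.\<close>

lemma lie_bracket_frame:
  assumes "Z \<in> V" "W \<in> V"
  shows "lie_bracket Z W = cscale (- ext_d G (\<eta> k) [Z, W] x) u +
    cscale (- form_conj (ext_d G (\<eta> k)) [Z, W] x) v"
proof -
  let ?L = "lie_bracket Z W"
  have L: "?L \<in> V" using lie_bracket_closed assms by blast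
  have ev_L: "ev (lie_bracket X Y) j = - ext_d G (\<eta> j) [X, Y] x"
    if "j \<in> {1..k}" "X \<in> V" "Y \<in> V" for X Y j
    using ext_d_1_form[OF \<eta>_invariant[OF that(1)] that(2,3), of x] \<eta>_ev[OF that(1)] by simp
  have zero: "ev (lie_bracket X Y) j = 0" if "j \<in> {1..<k}" "X \<in> V" "Y \<in> V" for X Y j
    using ev_L[OF lt_in[OF that(1)] that(2,3)] closed_\<eta>[OF that(1)] by simp
  have single: "(\<Sum>j\<in>{1..k}. cscale (c j) (f j)) = cscale (c k) (f k)"
    if "\<And>j. j \<in> {1..<k} \<Longrightarrow> c j = 0" for c and f :: "nat \<Rightarrow> 'a vfield"
  proof -
    have "{1..k} = insert k {1..<k}" using k_pos by auto
    moreover have "(\<Sum>j\<in>{1..<k}. cscale (c j) (f j)) = 0"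
      by (rule sum.neutral) (simp add: that)
    ultimately show ?thesis by simp
  qed
  have conj: "vconj ?L = lie_bracket (vconj Z) (vconj W)" "vconj Z \<in> V" "vconj W \<in> V"
    using vconj_lie_bracket vconj_closed assms by blast+
  have s: "(\<Sum>j\<in>{1..k}. cscale (ev ?L j) (frame j)) = cscale (ev ?L k) u"
    "(\<Sum>j\<in>{1..k}. cscale (cnj (ev (vconj ?L) j)) (vconj (frame j))) = cscale (cnj (ev (vconj ?L) k)) v"
    by (rule single, simp only: conj(1) zero[OF _ assms] zero[OF _ conj(2,3)] complex_cnj_zero)+
  have "?L = cscale (ev ?L k) u + cscale (cnj (ev (vconj ?L) k)) v"
    using expand[OF L] unfolding s .
  moreover have "cnj (ev (vconj ?L) k) = - form_conj (ext_d G (\<eta> k)) [Z, W] x"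
    unfolding conj(1) ev_L[OF k_in conj(2,3)] by (simp add: form_conj_def)
  ultimately show ?thesis by (simp only: ev_L[OF k_in assms])
qed

text \<open>Forms of type (p, n - p) built without \<open>\<eta> k\<close> and its conjugate: the
  contractions exclude these, and the weight under \<open>pull\<close> encodes the type.\<close>

definition eigenforms :: "nat \<Rightarrow> nat \<Rightarrow> 'a dform set" where
  "eigenforms n p = {\<alpha> \<in> invariant_dforms n. contr u \<alpha> = 0 \<and> contr v \<alpha> = 0 \<and>
     (\<forall>t. pull t \<alpha> = cscale (t ^ p) \<alpha>)}"

lemma eigenforms_subspace: "cvec.subspace (eigenforms n p)"
proof (rule cvec.subspaceI)
  have "pull t 0 = 0" for t by (simp add: pull_def fun_eq_iff)
  then show "0 \<in> eigenforms n p"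
    unfolding eigenforms_def mem_Collect_eq
    by (simp only: invariant_dforms_zero contr_zero cvec.scale_zero_right simp_thms)
  show "\<alpha> + \<beta> \<in> eigenforms n p" if "\<alpha> \<in> eigenforms n p" "\<beta> \<in> eigenforms n p" for \<alpha> \<beta>
    using that unfolding eigenforms_def mem_Collect_eq
    by (simp only: invariant_dforms_add contr_add pull_add cvec.scale_right_distrib add_0_left simp_thms)
  show "cscale c \<alpha> \<in> eigenforms n p" if "\<alpha> \<in> eigenforms n p" for c \<alpha>
    using that unfolding eigenforms_def mem_Collect_eq
    by (simp only: invariant_dforms_scale contr_scale pull_scale cvec.scale_zero_right
        cvec.scale_scale mult.commute simp_thms)
qed

lemma eigenforms_wedge:
  assumes "\<alpha> \<in> eigenforms m p" "\<beta> \<in> eigenforms n q"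
  shows "\<alpha> \<and>\<^sub>d \<beta> \<in> eigenforms (m + n) (p + q)"
  using assms unfolding eigenforms_def mem_Collect_eq
  by (simp only: invariant_dforms_wedge contr_wedge pull_wedge wedge_zero_left wedge_zero_right
      add_0_left wedge_scale_left wedge_scale_right cvec.scale_scale power_add mult.commute simp_thms)

lemma contr_\<eta>:
  assumes "i \<in> {1..k}" "ev Z i = 0"
  shows "contr Z (\<eta> i) = 0"
proof (intro ext)
  fix Zs x
  show "contr Z (\<eta> i) Zs x = 0 Zs x"
    using assms \<eta>_ev[OF assms(1), of Z x] invariant_dformsD(2)[OF \<eta>_invariant[OF assms(1)]]
    by (cases Zs) (simp_all add: contr_def homogeneous_def)
qed

lemma pull_1_form:
  assumes "\<alpha> \<in> invariant_dforms 1" "\<And>Z x. Z \<in> V \<Longrightarrow> \<alpha> [twist t Z] x = c * \<alpha> [Z] x"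
  shows "pull t \<alpha> = cscale c \<alpha>"
proof (intro ext)
  fix Zs x
  note d = invariant_dformsD[OF assms(1)]
  show "pull t \<alpha> Zs x = cscale c \<alpha> Zs x"
  proof (cases "length Zs = 1 \<and> set Zs \<subseteq> V")
    case True
    then obtain Z where "Zs = [Z]" "Z \<in> V" by (auto simp: length_Suc_conv)
    then show ?thesis using assms(2) by (simp add: pull_def cscale_def)
  next
    case False
    then show ?thesis
      using d(2) alternating_outside[OF d(1), of Zs]
      by (cases "set Zs \<subseteq> V") (simp_all add: pull_def cscale_def homogeneous_def)
  qed
qed

lemma \<eta>_eigenform:
  assumes "i \<in> {1..<k}"
  shows "\<eta> i \<in> eigenforms 1 1" "form_conj (\<eta> i) \<in> eigenforms 1 0"
proof -
  note i = lt_in[OF assms]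
  have c: "contr u (\<eta> i) = 0" "contr v (\<eta> i) = 0"
    using frame(2)[OF k_in i] ev_vconj_frame[OF i k_in] lt_neq[OF assms] by (auto intro!: contr_\<eta>[OF i])
  have P: "proj_10 J Z \<in> V" "proj_01 J Z \<in> V" "cscale t (proj_10 J Z) \<in> V" if "Z \<in> V" for Z t
    using proj_closed that V_scale by blast+
  have ev_twist: "ev (twist t Z) i = t * ev Z i" if "Z \<in> V" for t Z
    unfolding twist_def ev_add[OF i P(3)[OF that] P(2)[OF that]] ev_scale[OF i P(1)[OF that]]
      ev_01[OF i proj_fields(2)[OF that]] ev_proj[OF i that, symmetric] by simp
  have ev_vconj_twist: "ev (vconj (twist t Z)) i = ev (vconj Z) i" if Z: "Z \<in> V" for t Z
  proof -
    have C: "vconj (proj_10 J Z) \<in> fields_01 G J" "vconj (proj_01 J Z) \<in> fields_10 G J"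
      using proj_fields[OF Z] vconj_fields by blast+
    note CV = fields_V(2)[OF C(1)] fields_V(1)[OF C(2)]
    \<comment> \<open>The conjugate of the (1, 0)-part is invisible to \<open>\<eta> i\<close>,
      whatever its factor; comparing s = t with s = 1 removes the twist.\<close>
    have *: "ev (vconj (cscale s (proj_10 J Z) + proj_01 J Z)) i = ev (vconj (proj_01 J Z)) i" for s
      unfolding vconj_linear ev_add[OF i V_scale[OF CV(1)] CV(2)] ev_scale[OF i CV(1)] ev_01[OF i C(1)]
      by simp
    have "cscale 1 (proj_10 J Z) + proj_01 J Z = Z" by (simp only: cvec.scale_one proj_sum)
    then show ?thesis using *[of t] *[of 1] by (simp only: twist_def)
  qed
  have "pull t (\<eta> i) = cscale t (\<eta> i)" for t
    by (rule pull_1_form[OF \<eta>_invariant[OF i]]) (simp only: \<eta>_ev[OF i] ev_twist)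
  then show "\<eta> i \<in> eigenforms 1 1"
    using \<eta>_invariant[OF i] c unfolding eigenforms_def by simp
  have "pull t (form_conj (\<eta> i)) = cscale 1 (form_conj (\<eta> i))" for t
    by (rule pull_1_form[OF invariant_dforms_conj[OF \<eta>_invariant[OF i]]])
      (simp add: form_conj_def \<eta>_ev[OF i, simplified] ev_vconj_twist)
  moreover have "contr u (form_conj (\<eta> i)) = 0" "contr v (form_conj (\<eta> i)) = 0"
    unfolding contr_form_conj vconj_linear(4) c form_conj_simps by simp_all
  ultimately show "form_conj (\<eta> i) \<in> eigenforms 1 0"
    using invariant_dforms_conj[OF \<eta>_invariant[OF i]] unfolding eigenforms_def by simp
qed

definition "gens_20 = {\<eta> i \<and>\<^sub>d \<eta> j | i j. i \<in> {1..<k} \<and> j \<in> {1..<k}}"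
definition "gens_11 = {\<eta> i \<and>\<^sub>d form_conj (\<eta> j) | i j. i \<in> {1..<k} \<and> j \<in> {1..<k}}"

lemma gens_eigenforms:
  "gens_20 \<subseteq> eigenforms 2 2" "gens_11 \<subseteq> eigenforms 2 1"
  "form_conj ` gens_20 \<subseteq> eigenforms 2 0" "form_conj ` gens_11 \<subseteq> eigenforms 2 1"
proof -
  show "gens_20 \<subseteq> eigenforms 2 2" "gens_11 \<subseteq> eigenforms 2 1"
    unfolding gens_20_def gens_11_def
    using eigenforms_wedge[OF \<eta>_eigenform(1) \<eta>_eigenform(1)]
      eigenforms_wedge[OF \<eta>_eigenform(1) \<eta>_eigenform(2)] by (auto simp: one_add_one[symmetric] simp del: one_add_one)
  show "form_conj ` gens_20 \<subseteq> eigenforms 2 0" "form_conj ` gens_11 \<subseteq> eigenforms 2 1"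
    unfolding gens_20_def gens_11_def
    using eigenforms_wedge[OF \<eta>_eigenform(2) \<eta>_eigenform(2)]
      eigenforms_wedge[OF \<eta>_eigenform(2) \<eta>_eigenform(1)]
    by (auto simp: form_conj_wedge form_conj_form_conj one_add_one[symmetric] simp del: one_add_one)
qed

text \<open>The span of a union is the sum of the spans, which provides A and B; conjugation turns
  them into forms of type (0, 2) and (1, 1).\<close>

lemma special_structure_exists:
  obtains A B where "A \<in> cvec.span gens_20" "B \<in> cvec.span gens_11"
    "special_structure G J u v A B (form_conj A) (form_conj B)"
proof -
  obtain A B where AB: "ext_d G (\<eta> k) = A + B" "A \<in> cvec.span gens_20" "B \<in> cvec.span gens_11"
    using last_\<eta> unfolding cvec.span_Un gens_20_def gens_11_def by blast
  have eig: "A \<in> eigenforms 2 2" "B \<in> eigenforms 2 1"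
    "form_conj A \<in> eigenforms 2 0" "form_conj B \<in> eigenforms 2 1"
    using gens_eigenforms[THEN cvec.span_minimal, OF eigenforms_subspace] AB(2,3)
      AB(2,3)[THEN form_conj_span] by blast+
  have inv: "A \<in> invariant_dforms 2" "B \<in> invariant_dforms 2"
    "form_conj A \<in> invariant_dforms 2" "form_conj B \<in> invariant_dforms 2"
    using eig unfolding eigenforms_def by blast+
  have F: "A + B \<in> invariant_dforms 2" "form_conj A + form_conj B \<in> invariant_dforms 2"
    using inv invariant_dforms_add by blast+
  have uv: "u \<in> fields_10 G J" "v \<in> fields_01 G J"
    using frame(1)[OF k_in] vconj_fields(1) by blast+
  have br: "lie_bracket Z W = cscale (- (A + B) [Z, W] x) u +
      cscale (- (form_conj A + form_conj B) [Z, W] x) v" if "Z \<in> V" "W \<in> V" for Z W x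
    using lie_bracket_frame[OF that, of x] by (simp only: AB(1) form_conj_simps)
  have "special_structure G J u v A B (form_conj A) (form_conj B)"
  proof unfold_locales
    show "ext_d G \<alpha> = (A + B) \<and>\<^sub>d contr u \<alpha> + (form_conj A + form_conj B) \<and>\<^sub>d contr v \<alpha>"
      if "\<alpha> \<in> invariant_dforms n" for n \<alpha>
      by (rule ext_d_central_brackets[OF fields_V(1)[OF uv(1)] fields_V(2)[OF uv(2)]
            invariant_dformsD(2)[OF F(1)] invariant_dformsD(2)[OF F(2)]
            invariant_dformsD(1)[OF F(1)] invariant_dformsD(1)[OF F(2)] br that])
  qed (use uv inv eig in \<open>simp_all add: eigenforms_def\<close>)
  with AB(2,3) show ?thesis by (rule that)
qed

lemma SKT_if_formal:
  assumes "hermitian_metric G \<Gamma> J g" "invariant_metric G g" "geometrically_BC_formal G \<Gamma> J g"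
  shows "SKT G J g"
proof -
  obtain A B where A: "A \<in> cvec.span gens_20" and B: "B \<in> cvec.span gens_11"
    and "special_structure G J u v A B (form_conj A) (form_conj B)"
    by (rule special_structure_exists)
  then interpret S: special_structure G \<Gamma> J u v A B "form_conj A" "form_conj B" by simp
  interpret M: special_metric G \<Gamma> J u v A B "form_conj A" "form_conj B" full_frame g
  proof unfold_locales
    show "u \<in> full_frame" "v \<in> full_frame" using k_in unfolding full_frame_def by blast+
    show "2 \<le> DIM('b)" using dim k_pos by simp
  qed (fact full_frame_span full_frame_card full_frame_independent assms)+
  let ?BC = "bott_chern_harmonic G \<Gamma> J g"
  note formal = assms(3)[unfolded geometrically_BC_formal_def, rule_format]
  have 10: "\<eta> i \<in> ?BC 1 0" if "i \<in> {1..<k}" for i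
    using M.closed_1_form_harmonic[OF \<eta>_pq(1) _ \<eta>_pq(2)] lt_in closed_\<eta> that by simp
  have 01: "form_conj (\<eta> i) \<in> ?BC 0 1" if i: "i \<in> {1..<k}" for i
  proof (rule M.closed_1_form_harmonic)
    have inv: "form_conj (\<eta> i) \<in> invariant_dforms 1"
      and c: "contr u (form_conj (\<eta> i)) = 0" "contr v (form_conj (\<eta> i)) = 0"
      using \<eta>_eigenform(2)[OF i] unfolding eigenforms_def by blast+
    then show "invariant_form G (form_conj (\<eta> i))" by (simp add: invariant_dforms_iff)
    \<comment> \<open>Closedness is read off the formula for \<open>ext_d\<close>, since both
      contractions of the conjugate of \<open>\<eta> i\<close> vanish.\<close>
    show "ext_d G (form_conj (\<eta> i)) = 0"
      unfolding S.ext_d_eq[OF inv] c by (simp only: wedge_zero_right add_0_left)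
    have "form_conj (\<eta> i) Zs = 0" if Zs: "set Zs \<subseteq> fields_10 G J \<union> fields_01 G J"
      "length (filter (\<lambda>Z. Z \<in> fields_10 G J) Zs) \<noteq> 0" for Zs
    proof (cases "length Zs = 1")
      case True
      then obtain Z where Z: "Zs = [Z]" by (auto simp: length_Suc_conv)
      then have "Z \<in> fields_10 G J" using Zs(2) by (auto split: if_splits)
      then have "ev (vconj Z) i = 0" using vconj_fields(1) ev_01[OF lt_in[OF i]] by blast
      then show ?thesis
        unfolding Z form_conj_def using \<eta>_ev[OF lt_in[OF i]] by (simp add: fun_eq_iff)
    next
      case False
      then show ?thesis using invariant_dformsD(2)[OF inv] by (simp add: homogeneous_def)
    qed
    then show "form_conj (\<eta> i) \<in> pq_forms G \<Gamma> J 0 1"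
      using inv by (simp add: pq_forms_def invariant_dforms_iff)
  qed simp
  \<comment> \<open>First use of formality. Conjugating a generator of type (1, 1) again gives a
    product of closed 1-forms, now with the (0, 1)-factor in front.\<close>
  have harmonic: "gens_20 \<subseteq> ?BC 2 0" "gens_11 \<subseteq> ?BC 1 1"
    "form_conj ` gens_20 \<subseteq> ?BC 0 2" "form_conj ` gens_11 \<subseteq> ?BC 1 1"
    unfolding gens_20_def gens_11_def
    using formal[OF 10 10] formal[OF 10 01] formal[OF 01 01] formal[OF 01 10]
    by (auto simp: form_conj_wedge form_conj_form_conj one_add_one[symmetric] simp del: one_add_one)
  \<comment> \<open>Harmonic forms need not be invariant by definition; the explicit Hodge star
    requires it, hence the intersection.\<close>
  let ?H = "?BC 2 2 \<inter> invariant_dforms 4"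
  have inv: "\<sigma> \<and>\<^sub>d \<tau> \<in> invariant_dforms 4" if "\<sigma> \<in> eigenforms 2 p" "\<tau> \<in> eigenforms 2 q" for \<sigma> \<tau> p q
  proof -
    have "\<sigma> \<in> invariant_dforms 2" "\<tau> \<in> invariant_dforms 2" using that unfolding eigenforms_def by blast+
    from invariant_dforms_wedge[OF this] show ?thesis by simp
  qed
  have "A \<and>\<^sub>d form_conj A \<in> cvec.span ?H"
  proof (rule wedge_in_span[OF A form_conj_span[OF A]])
    fix \<sigma> \<tau> assume st: "\<sigma> \<in> gens_20" "\<tau> \<in> form_conj ` gens_20"
    then have "\<sigma> \<in> ?BC 2 0" "\<tau> \<in> ?BC 0 2" "\<sigma> \<in> eigenforms 2 2" "\<tau> \<in> eigenforms 2 0"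
      using harmonic gens_eigenforms by blast+
    then have "\<sigma> \<and>\<^sub>d \<tau> \<in> ?H" using formal[of \<sigma> 2 0 \<tau> 0 2, unfolded add_0_left add_0_right] inv by blast
    then show "\<sigma> \<and>\<^sub>d \<tau> \<in> cvec.span ?H" by (rule cvec.span_base)
  qed
  moreover have "form_conj B \<and>\<^sub>d B \<in> cvec.span ?H"
  proof (rule wedge_in_span[OF form_conj_span[OF B] B])
    fix \<sigma> \<tau> assume st: "\<sigma> \<in> form_conj ` gens_11" "\<tau> \<in> gens_11"
    then have "\<sigma> \<in> ?BC 1 1" "\<tau> \<in> ?BC 1 1" "\<sigma> \<in> eigenforms 2 1" "\<tau> \<in> eigenforms 2 1"
      using harmonic gens_eigenforms by blast+
    then have "\<sigma> \<and>\<^sub>d \<tau> \<in> ?H" using formal[of \<sigma> 1 1 \<tau> 1 1, unfolded one_add_one] inv by blast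
    then show "\<sigma> \<and>\<^sub>d \<tau> \<in> cvec.span ?H" by (rule cvec.span_base)
  qed
  ultimately show ?thesis by (rule M.SKT_if_span_harmonic)
qed

end

theorem proposition4p2:
  fixes G :: "('g::{t2_space, second_countable_topology}, 'e::euclidean_space) lgroup"
    and \<Gamma> :: "'g set"
    and J :: "'g vfield \<Rightarrow> 'g vfield"
    and g :: "'g metric_tensor"
  assumes "nilmanifold G \<Gamma>"
    and "special_type G \<Gamma> J"
    and "hermitian_metric G \<Gamma> J g"
    and "invariant_metric G g"
    and "geometrically_BC_formal G \<Gamma> J g"
  shows "SKT G J g"
proof -
  obtain k \<eta> where "special_type_frame G \<Gamma> J k \<eta>"
  proof -
    have lie: "lie_group G" using assms(1) by (simp add: nilmanifold_def)
    have acs: "almost_complex_structure G J" using assms(2) by (simp add: special_type_def)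
    obtain k \<eta> where "DIM('e) = 2 * k" "inj_on \<eta> {1..k}" "cvec.independent (\<eta> ` {1..k})"
      "cvec.span (\<eta> ` {1..k}) = {\<alpha> \<in> pq_forms G \<Gamma> J 1 0. invariant_form G \<alpha>}"
      "\<forall>j\<in>{1..<k}. ext_d G (\<eta> j) = 0"
      "ext_d G (\<eta> k) \<in> cvec.span
          ({\<eta> i \<and>\<^sub>d \<eta> j | i j. i \<in> {1..<k} \<and> j \<in> {1..<k}} \<union>
           {\<eta> i \<and>\<^sub>d form_conj (\<eta> j) | i j. i \<in> {1..<k} \<and> j \<in> {1..<k}})"
      using assms(2) unfolding special_type_def by blast
    with lie acs have "special_type_frame G \<Gamma> J k \<eta>"
      unfolding special_type_frame_def special_type_frame_axioms_def complex_lie_group_forms_def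
        complex_lie_group_forms_axioms_def lie_group_forms_def
      by (simp only: simp_thms) blast
    then show ?thesis by (rule that)
  qed
  then interpret special_type_frame G \<Gamma> J k \<eta> .
  show ?thesis by (rule SKT_if_formal[OF assms(3-5)])
qed

end
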